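(* Let $R$ be a unital ring and let $\mathcal{B}$ be an additive full subcategory of the category of finitely presented left $R$-modules. Assume that $\mathcal{E}$ is a class of right $R$-modules that is closed under direct summands and products in $\mathrm{Mod}\text{-}R$ and satisfies the conditions: (1) $\operatorname{Hom}_{\mathbb{Z}}(B,\mathbb{Q}/\mathbb{Z})$ belongs to $\mathcal{E}$ for every $B\in\mathcal{B}$; (2) $\operatorname{Hom}_{\mathbb{Z}}(E,\mathbb{Q}/\mathbb{Z})$ belongs to $\varinjlim\mathcal{B}$ for every $E\in\mathcal{E}$. Then there is an equality $(\mathrm{Mod}\text{-}R)^{\mathcal{B}} = \mathcal{E}\cap \mathrm{PureInj}\text{-}R$.
   Context: $\mathrm{Mod}\text{-}R$ is the category of right $R$-modules and $\mathrm{PureInj}\text{-}R$ is the class of pure injective right $R$-modules. $\varinjlim\mathcal{B}$ is the class of left $R$-modules that are filtered colimits of modules from $\mathcal{B}$. $(\mathrm{Mod}\text{-}R)^{\mathcal{B}}$ is the full subcategory of $\mathrm{Mod}\text{-}R$ whose objects are the direct summands of arbitrary set-indexed products of modules of the form $\operatorname{Hom}_{\mathbb{Z}}(B,\mathbb{Q}/\mathbb{Z})$ with $B\in\mathcal{B}$. *)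

theory Defs
  imports Complex_Main "HOL-Algebra.AbelCoset" "HOL-Algebra.Module"
begin

section \<open>Modules over a unital, not necessarily commutative ring\<close>

text \<open>
  The library locale \<open>module\<close> requires a commutative ring; only its record type is reused.  The
  ring fields \<open>mult\<close> and \<open>one\<close> of a module record carry no meaning.
\<close>

locale left_module = R?: ring R + M?: abelian_group M
  for R :: "('r, 'x) ring_scheme" (structure) and M :: "('r, 'm, 'y) module_scheme" (structure) +
  assumes smult_closed:
      "\<lbrakk>a \<in> carrier R; x \<in> carrier M\<rbrakk> \<Longrightarrow> a \<odot>\<^bsub>M\<^esub> x \<in> carrier M"
    and smult_l_distr:
      "\<lbrakk>a \<in> carrier R; b \<in> carrier R; x \<in> carrier M\<rbrakk> \<Longrightarrow>
       (a \<oplus> b) \<odot>\<^bsub>M\<^esub> x = a \<odot>\<^bsub>M\<^esub> x \<oplus>\<^bsub>M\<^esub> b \<odot>\<^bsub>M\<^esub> x"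
    and smult_r_distr:
      "\<lbrakk>a \<in> carrier R; x \<in> carrier M; y \<in> carrier M\<rbrakk> \<Longrightarrow>
       a \<odot>\<^bsub>M\<^esub> (x \<oplus>\<^bsub>M\<^esub> y) = a \<odot>\<^bsub>M\<^esub> x \<oplus>\<^bsub>M\<^esub> a \<odot>\<^bsub>M\<^esub> y"
    and smult_assoc:
      "\<lbrakk>a \<in> carrier R; b \<in> carrier R; x \<in> carrier M\<rbrakk> \<Longrightarrow>
       (a \<otimes> b) \<odot>\<^bsub>M\<^esub> x = a \<odot>\<^bsub>M\<^esub> (b \<odot>\<^bsub>M\<^esub> x)"
    and smult_one:
      "x \<in> carrier M \<Longrightarrow> \<one> \<odot>\<^bsub>M\<^esub> x = x"

text \<open>
  A right \<open>R\<close>-module is a left module over the opposite ring, \<open>a \<odot> x\<close> standing for \<open>x a\<close>.  The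
  notions below are stated once, for left modules over a ring \<open>S\<close>; for right \<open>R\<close>-modules take
  \<open>S = opposite_ring R\<close>.
\<close>

definition opposite_ring :: "'r ring \<Rightarrow> 'r ring" where
  "opposite_ring R = R\<lparr>mult := (\<lambda>a b. b \<otimes>\<^bsub>R\<^esub> a)\<rparr>"

lemma opposite_opposite_ring [simp]: "opposite_ring (opposite_ring R) = R"
  by (simp add: opposite_ring_def)

abbreviation right_module :: "'r ring \<Rightarrow> ('r, 'm) module \<Rightarrow> bool" where
  "right_module R M \<equiv> left_module (opposite_ring R) M"

definition linear_hom :: "'r ring \<Rightarrow> ('r, 'm) module \<Rightarrow> ('r, 'n) module \<Rightarrow> ('m \<Rightarrow> 'n) set" where
  "linear_hom S M N = {f \<in> hom (add_monoid M) (add_monoid N).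
     \<forall>a\<in>carrier S. \<forall>x\<in>carrier M. f (a \<odot>\<^bsub>M\<^esub> x) = a \<odot>\<^bsub>N\<^esub> f x}"

definition module_isomorphic :: "'r ring \<Rightarrow> ('r, 'm) module \<Rightarrow> ('r, 'n) module \<Rightarrow> bool" where
  "module_isomorphic S M N \<longleftrightarrow> (\<exists>f \<in> linear_hom S M N. bij_betw f (carrier M) (carrier N))"

text \<open>In particular every module isomorphic to a direct summand of \<open>N\<close> is one.\<close>

definition direct_summand :: "'r ring \<Rightarrow> ('r, 'm) module \<Rightarrow> ('r, 'n) module \<Rightarrow> bool" where
  "direct_summand S M N \<longleftrightarrow>
     (\<exists>f \<in> linear_hom S M N. \<exists>g \<in> linear_hom S N M. \<forall>x\<in>carrier M. g (f x) = x)"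

definition product_module :: "'i set \<Rightarrow> ('i \<Rightarrow> ('r, 'm) module) \<Rightarrow> ('r, 'i \<Rightarrow> 'm) module" where
  "product_module I N =
     \<lparr>carrier = (\<Pi>\<^sub>E i\<in>I. carrier (N i)), mult = undefined, one = undefined,
      zero = (\<lambda>i\<in>I. \<zero>\<^bsub>N i\<^esub>), add = (\<lambda>x y. \<lambda>i\<in>I. x i \<oplus>\<^bsub>N i\<^esub> y i),
      smult = (\<lambda>a x. \<lambda>i\<in>I. a \<odot>\<^bsub>N i\<^esub> x i)\<rparr>"

definition direct_sum_module :: "'i set \<Rightarrow> ('i \<Rightarrow> ('r, 'm) module) \<Rightarrow> ('r, 'i \<Rightarrow> 'm) module" where
  "direct_sum_module I N = (product_module I N)
     \<lparr>carrier := {x \<in> \<Pi>\<^sub>E i\<in>I. carrier (N i). finite {i \<in> I. x i \<noteq> \<zero>\<^bsub>N i\<^esub>}}\<rparr>"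

definition quotient_module :: "('r, 'm) module \<Rightarrow> 'm set \<Rightarrow> ('r, 'm set) module" where
  "quotient_module M K =
     \<lparr>carrier = a_rcosets\<^bsub>M\<^esub> K, mult = undefined, one = undefined, zero = K, add = set_add M,
      smult = (\<lambda>a X. \<Union>x\<in>X. K +>\<^bsub>M\<^esub> (a \<odot>\<^bsub>M\<^esub> x))\<rparr>"

definition generated_submodule :: "'r ring \<Rightarrow> ('r, 'm) module \<Rightarrow> 'm set \<Rightarrow> 'm set" where
  "generated_submodule S M X = \<Inter>{H. submodule H S M \<and> X \<subseteq> H}"

definition regular_module :: "'r ring \<Rightarrow> ('r, 'r) module" where
  "regular_module S =
     \<lparr>carrier = carrier S, mult = undefined, one = undefined, zero = \<zero>\<^bsub>S\<^esub>,
      add = (\<lambda>x y. x \<oplus>\<^bsub>S\<^esub> y), smult = (\<lambda>a x. a \<otimes>\<^bsub>S\<^esub> x)\<rparr>"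

definition free_module :: "'r ring \<Rightarrow> nat \<Rightarrow> ('r, nat \<Rightarrow> 'r) module" where
  "free_module S n = product_module {..<n} (\<lambda>_. regular_module S)"

definition finitely_presented :: "'r ring \<Rightarrow> ('r, 'm) module \<Rightarrow> bool" where
  "finitely_presented S M \<longleftrightarrow> left_module S M \<and>
     (\<exists>m n. \<exists>f \<in> linear_hom S (free_module S m) (free_module S n).
            \<exists>g \<in> linear_hom S (free_module S n) M.
        g ` carrier (free_module S n) = carrier M \<and>
        a_kernel (free_module S n) M g = f ` carrier (free_module S m))"

text \<open>A full subcategory is given by its class of objects.\<close>

definition additive_full_subcategory :: "'r ring \<Rightarrow> ('r, 'm) module set \<Rightarrow> bool" where
  "additive_full_subcategory S \<C> \<longleftrightarrow> (\<forall>M\<in>\<C>. left_module S M) \<and>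
     (\<exists>Z\<in>\<C>. carrier Z = {\<zero>\<^bsub>Z\<^esub>}) \<and>
     (\<forall>M\<in>\<C>. \<forall>N\<in>\<C>. \<exists>P\<in>\<C>.
        module_isomorphic S P (product_module (UNIV :: bool set) (\<lambda>b. if b then M else N)))"


section \<open>Character modules\<close>

definition rat_mod_int :: "rat set monoid" where
  "rat_mod_int = \<lparr>carrier = UNIV, mult = (+), one = 0\<rparr> Mod \<int>"

text \<open>
  \<open>Hom(M, \<rat>/\<int>)\<close> over the integers, with \<open>(a f)(x) = f(a x)\<close>: for a left \<open>S\<close>-module \<open>M\<close> this is a
  left module over \<open>opposite_ring S\<close>.  Since \<open>opposite_ring\<close> is an involution, the same operation
  takes right \<open>R\<close>-modules to left \<open>R\<close>-modules.
\<close>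

definition character_module :: "('r, 'm) module \<Rightarrow> ('r, 'm \<Rightarrow> rat set) module" where
  "character_module M =
     \<lparr>carrier = hom (add_monoid M) rat_mod_int \<inter> extensional (carrier M),
      mult = undefined, one = undefined,
      zero = (\<lambda>x\<in>carrier M. \<one>\<^bsub>rat_mod_int\<^esub>),
      add = (\<lambda>f g. \<lambda>x\<in>carrier M. f x \<otimes>\<^bsub>rat_mod_int\<^esub> g x),
      smult = (\<lambda>a f. \<lambda>x\<in>carrier M. f (a \<odot>\<^bsub>M\<^esub> x))\<rparr>"


section \<open>Filtered colimits\<close>

record ('o, 'a) small_category =
  Obj :: "'o set"
  Arr :: "'a set"
  Dom :: "'a \<Rightarrow> 'o"
  Cod :: "'a \<Rightarrow> 'o"
  Ident :: "'o \<Rightarrow> 'a"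
  Comp :: "'a \<Rightarrow> 'a \<Rightarrow> 'a"

locale category =
  fixes J :: "('o, 'a) small_category"
  assumes Dom_Obj: "f \<in> Arr J \<Longrightarrow> Dom J f \<in> Obj J"
    and Cod_Obj: "f \<in> Arr J \<Longrightarrow> Cod J f \<in> Obj J"
    and Ident_Arr: "i \<in> Obj J \<Longrightarrow>
          Ident J i \<in> Arr J \<and> Dom J (Ident J i) = i \<and> Cod J (Ident J i) = i"
    and Comp_Arr: "\<lbrakk>f \<in> Arr J; g \<in> Arr J; Cod J f = Dom J g\<rbrakk> \<Longrightarrow>
          Comp J g f \<in> Arr J \<and> Dom J (Comp J g f) = Dom J f \<and> Cod J (Comp J g f) = Cod J g"
    and Comp_Ident: "f \<in> Arr J \<Longrightarrow>
          Comp J f (Ident J (Dom J f)) = f \<and> Comp J (Ident J (Cod J f)) f = f"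
    and Comp_assoc: "\<lbrakk>f \<in> Arr J; g \<in> Arr J; h \<in> Arr J; Cod J f = Dom J g; Cod J g = Dom J h\<rbrakk> \<Longrightarrow>
          Comp J (Comp J h g) f = Comp J h (Comp J g f)"

locale filtered_category = category +
  assumes nonempty: "Obj J \<noteq> {}"
    and upper_bound: "\<lbrakk>i \<in> Obj J; j \<in> Obj J\<rbrakk> \<Longrightarrow>
          \<exists>f\<in>Arr J. \<exists>g\<in>Arr J. Dom J f = i \<and> Dom J g = j \<and> Cod J f = Cod J g"
    and coequalize: "\<lbrakk>f \<in> Arr J; g \<in> Arr J; Dom J f = Dom J g; Cod J f = Cod J g\<rbrakk> \<Longrightarrow>
          \<exists>h\<in>Arr J. Dom J h = Cod J f \<and> Comp J h f = Comp J h g"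

locale module_diagram = category J
  for S :: "'r ring" and J :: "('o, 'a) small_category"
    and F :: "'o \<Rightarrow> ('r, 'm) module" and \<phi> :: "'a \<Rightarrow> 'm \<Rightarrow> 'm" +
  assumes F_module: "i \<in> Obj J \<Longrightarrow> left_module S (F i)"
    and \<phi>_hom: "f \<in> Arr J \<Longrightarrow> \<phi> f \<in> linear_hom S (F (Dom J f)) (F (Cod J f))"
    and \<phi>_Ident: "\<lbrakk>i \<in> Obj J; x \<in> carrier (F i)\<rbrakk> \<Longrightarrow> \<phi> (Ident J i) x = x"
    and \<phi>_Comp: "\<lbrakk>f \<in> Arr J; g \<in> Arr J; Cod J f = Dom J g; x \<in> carrier (F (Dom J f))\<rbrakk> \<Longrightarrow>
          \<phi> (Comp J g f) x = \<phi> g (\<phi> f x)"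

definition sum_inj :: "'i set \<Rightarrow> ('i \<Rightarrow> ('r, 'm) module) \<Rightarrow> 'i \<Rightarrow> 'm \<Rightarrow> 'i \<Rightarrow> 'm" where
  "sum_inj I N i x = (\<lambda>j\<in>I. if j = i then x else \<zero>\<^bsub>N j\<^esub>)"

text \<open>The colimit of a diagram: the direct sum modulo the identifications made by the arrows.\<close>

definition colimit_module ::
  "'r ring \<Rightarrow> ('o, 'a) small_category \<Rightarrow> ('o \<Rightarrow> ('r, 'm) module) \<Rightarrow> ('a \<Rightarrow> 'm \<Rightarrow> 'm) \<Rightarrow>
   ('r, ('o \<Rightarrow> 'm) set) module" where
  "colimit_module S J F \<phi> =
     (let D = direct_sum_module (Obj J) F in
      quotient_module D (generated_submodule S D
        {sum_inj (Obj J) F (Cod J f) (\<phi> f x) \<ominus>\<^bsub>D\<^esub> sum_inj (Obj J) F (Dom J f) x | f x.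
           f \<in> Arr J \<and> x \<in> carrier (F (Dom J f))}))"

text \<open>
  The modules that are filtered colimits of modules from \<open>\<B>\<close>; the two type arguments say where the
  objects and arrows of the index categories live.
\<close>

definition filtered_colimits ::
  "'o itself \<Rightarrow> 'a itself \<Rightarrow> 'r ring \<Rightarrow> ('r, 'b) module set \<Rightarrow> ('r, 'm) module set" where
  "filtered_colimits _ _ S \<B> = {L. left_module S L \<and>
     (\<exists>(J :: ('o, 'a) small_category) F \<phi>. filtered_category J \<and> module_diagram S J F \<phi> \<and>
        (\<forall>i\<in>Obj J. F i \<in> \<B>) \<and> module_isomorphic S L (colimit_module S J F \<phi>))}"


section \<open>Purity\<close>

definition short_exact ::
  "'r ring \<Rightarrow> ('r, 'k) module \<Rightarrow> ('k \<Rightarrow> 'm) \<Rightarrow> ('r, 'm) module \<Rightarrow> ('m \<Rightarrow> 'n) \<Rightarrow> ('r, 'n) module \<Rightarrow> bool"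
  where
  "short_exact S K f M g N \<longleftrightarrow> left_module S K \<and> left_module S M \<and> left_module S N \<and>
     f \<in> linear_hom S K M \<and> g \<in> linear_hom S M N \<and>
     inj_on f (carrier K) \<and> f ` carrier K = a_kernel M N g \<and> g ` carrier M = carrier N"

text \<open>
  A short exact sequence is pure if it remains exact under \<open>Hom(P, -)\<close> for each finitely presented
  \<open>P\<close>.  Each such \<open>P\<close> is isomorphic to a module of cosets in some \<open>free_module S n\<close>, so
  \<open>(nat \<Rightarrow> 'r) set\<close> is a large enough carrier type.
\<close>

definition pure_exact ::
  "'r ring \<Rightarrow> ('r, 'k) module \<Rightarrow> ('k \<Rightarrow> 'm) \<Rightarrow> ('r, 'm) module \<Rightarrow> ('m \<Rightarrow> 'n) \<Rightarrow> ('r, 'n) module \<Rightarrow> bool"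
  where
  "pure_exact S K f M g N \<longleftrightarrow> short_exact S K f M g N \<and>
     (\<forall>P :: ('r, (nat \<Rightarrow> 'r) set) module. finitely_presented S P \<longrightarrow>
        (\<forall>h \<in> linear_hom S P N. \<exists>h' \<in> linear_hom S P M. \<forall>x\<in>carrier P. g (h' x) = h x))"

text \<open>
  \<open>M\<close> is pure injective if \<open>Hom(-, M)\<close> is exact on pure exact sequences.  A formula cannot quantify
  over modules of all carrier types.  Here the sequences range over all modules with carrier in
  \<open>'t + (('m \<Rightarrow> rat set) \<Rightarrow> rat set)\<close>, with \<open>'t\<close> arbitrary; the second summand holds
  the double character module of \<open>M\<close>, into which \<open>M\<close> embeds purely, so that the resulting notion
  does not depend on \<open>'t\<close>.
\<close>

definition pure_injective :: "'t itself \<Rightarrow> 'r ring \<Rightarrow> ('r, 'm) module \<Rightarrow> bool" where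
  "pure_injective _ S M \<longleftrightarrow> left_module S M \<and>
     (\<forall>(K :: ('r, 't + (('m \<Rightarrow> rat set) \<Rightarrow> rat set)) module)
       (L :: ('r, 't + (('m \<Rightarrow> rat set) \<Rightarrow> rat set)) module)
       (N :: ('r, 't + (('m \<Rightarrow> rat set) \<Rightarrow> rat set)) module) f g.
        pure_exact S K f L g N \<longrightarrow>
        (\<forall>h \<in> linear_hom S K M. \<exists>h' \<in> linear_hom S L M. \<forall>x\<in>carrier K. h' (f x) = h x))"


section \<open>Classes of modules\<close>

text \<open>
  A class of modules is a set of modules on one arbitrary carrier type; modules on other types
  belong to it up to isomorphism.
\<close>

definition belongs_to :: "'r ring \<Rightarrow> ('r, 'n) module \<Rightarrow> ('r, 'm) module set \<Rightarrow> bool" where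
  "belongs_to S X \<E> \<longleftrightarrow> (\<exists>M\<in>\<E>. module_isomorphic S X M)"

definition summands_of_products ::
  "'i itself \<Rightarrow> 'r ring \<Rightarrow> ('r, 'n) module set \<Rightarrow> ('r, 'm) module set" where
  "summands_of_products _ S \<C> = {M. left_module S M \<and>
     (\<exists>(I :: 'i set) N. (\<forall>i\<in>I. N i \<in> \<C>) \<and> direct_summand S M (product_module I N))}"

text \<open>
  A product of modules on \<open>'m\<close> lives on \<open>'i \<Rightarrow> 'm\<close>, not on \<open>'m\<close>.  Closure under direct summands
  and products is therefore expressed in one step; singleton index sets give the closure under
  direct summands alone, and \<open>M\<close> isomorphic to the product gives the closure under products.
\<close>

definition closed_under_summands_and_products ::
  "'i itself \<Rightarrow> 'r ring \<Rightarrow> ('r, 'm) module set \<Rightarrow> bool" where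
  "closed_under_summands_and_products T S \<E> \<longleftrightarrow> summands_of_products T S \<E> \<subseteq> \<E>"

text \<open>The subcategory \<open>(Mod-R)\<^sup>\<B>\<close>, for a class \<open>\<B>\<close> of left \<open>R\<close>-modules.\<close>

definition Mod_char ::
  "'i itself \<Rightarrow> 'r ring \<Rightarrow> ('r, 'b) module set \<Rightarrow> ('r, 'm) module set" where
  "Mod_char T R \<B> = summands_of_products T (opposite_ring R) (character_module ` \<B>)"

definition PureInj :: "'t itself \<Rightarrow> 'r ring \<Rightarrow> ('r, 'm) module set" where
  "PureInj T R = {M. right_module R M \<and> pure_injective T (opposite_ring R) M}"

end

theory Submission
  imports Defs "HOL-Algebra.Free_Abelian_Groups"
begin

text \<open>
  Write \<open>M\<^sup>+\<close> for the character module of \<open>M\<close>.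

  One inclusion rests on the fact that \<open>B\<^sup>+\<close> is pure injective for finitely presented \<open>B\<close>
  (\<open>character_module_extension\<close>).  If \<open>B\<close> has \<open>n\<close> generators, a linear map \<open>K \<rightarrow> B\<^sup>+\<close> is a character of
  \<open>K\<^sup>n\<close> that vanishes on the combinations of the relations of \<open>B\<close>, and it extends from \<open>K\<^sup>n\<close> to
  \<open>L\<^sup>n\<close> because \<open>\<rat>/\<int>\<close> is injective; that the extension can be required to vanish on the relations
  as well is what purity of \<open>K\<close> in \<open>L\<close> provides.  Pure injectivity passes to summands of products,
  and membership in \<open>\<E>\<close> is a matter of closure.

  For the other inclusion let \<open>E\<close> be pure injective in \<open>\<E>\<close>.  Evaluation embeds \<open>E\<close> purely in
  \<open>E\<^sup>+\<^sup>+\<close>, so \<open>E\<close> is a summand of \<open>E\<^sup>+\<^sup>+\<close> (\<open>pure_injective_splits\<close>).  As \<open>E\<^sup>+\<close> is a filtered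
  colimit of modules \<open>B\<^sub>k \<in> \<B>\<close>, it suffices that the character module of a filtered colimit is a
  summand of \<open>\<Prod>\<^sub>k B\<^sub>k\<^sup>+\<close> (\<open>colimit_character_summand\<close>).  The inclusion sends a character to its
  restrictions along the maps \<open>B\<^sub>k \<rightarrow> colim B\<close>.  A retraction has to make a compatible family out of
  an arbitrary family \<open>(p\<^sub>k)\<close>; it sends \<open>x \<in> B\<^sub>j\<close> to the limit of \<open>p\<^sub>k (c\<^sub>j x)\<close> over all cocones
  \<open>(k, c)\<close> over larger and larger finite parts of the diagram, where \<open>c\<^sub>j\<close> is the leg \<open>j \<rightarrow> k\<close>.  Such a
  limit exists for every family of values in \<open>\<rat>/\<int>\<close>: it is an additive extension of the evident
  functional on eventually constant families (\<open>limit_functional\<close>).  For a family that comes from a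
  character of the colimit the values are eventually constant, so the retraction gives it back.

  Purity is used throughout as solvability of systems of linear equations (\<open>pure_embedding\<close>), which
  makes tensor products unnecessary.
\<close>

section \<open>The group of rationals modulo the integers\<close>

abbreviation QZ :: "rat set monoid" where "QZ \<equiv> rat_mod_int"

definition rat_class :: "rat \<Rightarrow> rat set" where
  "rat_class x = \<int> #>\<^bsub>\<lparr>carrier = UNIV, mult = (+), one = 0\<rparr>\<^esub> x"

lemma rat_class_eq_iff: "rat_class x = rat_class y \<longleftrightarrow> x - y \<in> \<int>"
proof
  assume "rat_class x = rat_class y"
  moreover have "x \<in> rat_class x"
    by (force simp: rat_class_def r_coset_def)
  ultimately have "x \<in> rat_class y" by simp
  then show "x - y \<in> \<int>"
    by (auto simp: rat_class_def r_coset_def)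
next
  assume d: "x - y \<in> \<int>"
  have "h + x \<in> (\<Union>h\<in>\<int>. {h + y})" if "h \<in> \<int>" for h
    using d that by (intro UN_I[of "h + (x - y)"]) auto
  moreover have "h + y \<in> (\<Union>h\<in>\<int>. {h + x})" if "h \<in> \<int>" for h
    using d that by (intro UN_I[of "h - (x - y)"]) auto
  ultimately show "rat_class x = rat_class y"
    unfolding rat_class_def r_coset_def by auto
qed

lemma comm_group_rat: "comm_group (\<lparr>carrier = UNIV, mult = (+), one = 0\<rparr> :: rat monoid)"
  by (rule comm_groupI) (auto intro: exI[of _ "- x" for x])

lemma subgroup_Ints: "subgroup \<int> (\<lparr>carrier = UNIV, mult = (+), one = 0\<rparr> :: rat monoid)"
proof -
  interpret G: comm_group "\<lparr>carrier = UNIV, mult = (+), one = 0\<rparr> :: rat monoid"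
    by (rule comm_group_rat)
  have inv: "inv\<^bsub>\<lparr>carrier = UNIV, mult = (+), one = 0\<rparr>\<^esub> x = - x" for x :: rat
    by (rule G.inv_equality) auto
  show ?thesis
    by (rule G.subgroupI) (auto simp: inv)
qed

lemma carrier_rat_mod_int: "carrier QZ = range rat_class"
  by (auto simp: rat_mod_int_def FactGroup_def RCOSETS_def rat_class_def)

lemma one_rat_mod_int: "\<one>\<^bsub>QZ\<^esub> = rat_class 0"
  by (auto simp: rat_mod_int_def FactGroup_def rat_class_def r_coset_def)

lemma mult_rat_mod_int: "rat_class x \<otimes>\<^bsub>QZ\<^esub> rat_class y = rat_class (x + y)"
proof -
  interpret G: comm_group "\<lparr>carrier = UNIV, mult = (+), one = 0\<rparr> :: rat monoid"
    by (rule comm_group_rat)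
  show ?thesis
    using normal.rcos_sum[OF G.subgroup_imp_normal[OF subgroup_Ints], of x y]
    by (simp add: rat_mod_int_def FactGroup_def rat_class_def)
qed

interpretation QZ: comm_group QZ
  unfolding rat_mod_int_def
  by (rule comm_group.abelian_FactGroup[OF comm_group_rat subgroup_Ints])

lemma rat_class_closed [simp]: "rat_class x \<in> carrier QZ"
  by (simp add: carrier_rat_mod_int)

lemma rat_class_pow: "rat_class x [^]\<^bsub>QZ\<^esub> (n::nat) = rat_class (of_nat n * x)"
  by (induction n) (simp_all add: one_rat_mod_int mult_rat_mod_int algebra_simps)

lemma rat_mod_int_divisible:
  assumes "c \<in> carrier QZ" and "0 < n"
  shows "\<exists>d\<in>carrier QZ. d [^]\<^bsub>QZ\<^esub> (n::nat) = c"
proof -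
  obtain x where "c = rat_class x" using assms(1) by (auto simp: carrier_rat_mod_int)
  then show ?thesis
    using assms(2) by (intro bexI[of _ "rat_class (x / of_nat n)"]) (auto simp: rat_class_pow)
qed

lemma rat_mod_int_torsion:
  assumes "n \<noteq> 1"
  shows "\<exists>c\<in>carrier QZ. c \<noteq> \<one>\<^bsub>QZ\<^esub> \<and> c [^]\<^bsub>QZ\<^esub> (n::nat) = \<one>\<^bsub>QZ\<^esub>"
proof -
  define m :: nat where "m = (if n = 0 then 2 else n)"
  have m: "m \<ge> 2" using assms by (auto simp: m_def)
  have "(1 / of_nat m :: rat) \<notin> \<int>"
  proof
    assume "(1 / of_nat m :: rat) \<in> \<int>"
    then obtain k :: int where k: "1 / of_nat m = (of_int k :: rat)" by (auto elim: Ints_cases)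
    have "(0::rat) < 1 / of_nat m" "1 / of_nat m < (1::rat)" using m by auto
    then have "0 < k" "k < 1" unfolding k by auto
    then show False by simp
  qed
  then have "rat_class (1 / of_nat m) \<noteq> \<one>\<^bsub>QZ\<^esub>"
    by (simp add: one_rat_mod_int rat_class_eq_iff)
  moreover have "rat_class (1 / of_nat m) [^]\<^bsub>QZ\<^esub> n = \<one>\<^bsub>QZ\<^esub>"
    by (auto simp: rat_class_pow one_rat_mod_int rat_class_eq_iff m_def)
  ultimately show ?thesis by (intro bexI[of _ "rat_class (1 / of_nat m)"]) auto
qed


section \<open>Extending and separating by characters\<close>

text \<open>The least positive element generates, by division with remainder.\<close>

lemma int_subgroup_multiples:
  fixes I :: "int set"
  assumes "0 \<in> I" and diff: "\<And>a b. a \<in> I \<Longrightarrow> b \<in> I \<Longrightarrow> a - b \<in> I"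
  shows "\<exists>n::nat. I = {k. int n dvd k}"
proof (cases "I \<subseteq> {0}")
  case True
  then show ?thesis using assms(1) by (intro exI[of _ 0]) auto
next
  case False
  have neg: "- a \<in> I" if "a \<in> I" for a using diff[OF assms(1) that] by simp
  have add: "a + b \<in> I" if "a \<in> I" "b \<in> I" for a b using diff[OF that(1) neg[OF that(2)]] by simp
  define P where "P m \<longleftrightarrow> 0 < m \<and> int m \<in> I" for m
  obtain a where a: "a \<in> I" "a \<noteq> 0" using False by auto
  have "P (nat \<bar>a\<bar>)" using a neg[of a] by (auto simp: P_def abs_if)
  then have n: "P (LEAST m. P m)" by (rule LeastI)
  define n where "n = (LEAST m. P m)"
  have n: "0 < n" "int n \<in> I" using n by (auto simp: P_def n_def)
  have mult: "int n * q \<in> I" for q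
  proof -
    have nat_mult: "int n * int q \<in> I" for q
      by (induction q) (use assms(1) add n(2) in \<open>auto simp: algebra_simps\<close>)
    show ?thesis
      using nat_mult[of "nat q"] neg[OF nat_mult[of "nat (- q)"]] by (cases "q \<ge> 0") auto
  qed
  have "int n dvd k" if "k \<in> I" for k
  proof (rule ccontr)
    assume "\<not> int n dvd k"
    then have "k mod int n \<noteq> 0" by (simp add: dvd_eq_mod_eq_0)
    moreover have "0 \<le> k mod int n" "k mod int n < int n" using n(1) by auto
    moreover have "k mod int n \<in> I"
      using diff[OF that mult[of "k div int n"]] by (simp add: minus_mult_div_eq_mod)
    ultimately have "P (nat (k mod int n))" "nat (k mod int n) < n"
      by (auto simp: P_def)
    then show False unfolding n_def using not_less_Least by blast
  qed
  then show ?thesis using mult by (intro exI[of _ n]) (auto simp: dvd_def)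
qed

text \<open>A partial character of a group is presented by its graph: a subgroup of the product with
  \<open>\<rat>/\<int>\<close> that is single-valued at the neutral element, hence everywhere.  Unions of chains of graphs
  are immediate, and a graph can be written down before it is known to define a function.\<close>

definition partial_char :: "('g, 'z) monoid_scheme \<Rightarrow> ('g \<times> rat set) set \<Rightarrow> bool" where
  "partial_char G A \<longleftrightarrow>
    A \<subseteq> carrier G \<times> carrier QZ \<and> (\<one>\<^bsub>G\<^esub>, \<one>\<^bsub>QZ\<^esub>) \<in> A \<and>
    (\<forall>a c b d. (a, c) \<in> A \<longrightarrow> (b, d) \<in> A \<longrightarrow> (a \<otimes>\<^bsub>G\<^esub> b, c \<otimes>\<^bsub>QZ\<^esub> d) \<in> A) \<and>
    (\<forall>a c. (a, c) \<in> A \<longrightarrow> (inv\<^bsub>G\<^esub> a, inv\<^bsub>QZ\<^esub> c) \<in> A) \<and>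
    (\<forall>c. (\<one>\<^bsub>G\<^esub>, c) \<in> A \<longrightarrow> c = \<one>\<^bsub>QZ\<^esub>)"

context comm_group
begin

lemma partial_charI:
  assumes "A \<subseteq> carrier G \<times> carrier QZ" and "(\<one>, \<one>\<^bsub>QZ\<^esub>) \<in> A"
    and "\<And>a c b d. (a, c) \<in> A \<Longrightarrow> (b, d) \<in> A \<Longrightarrow> (a \<otimes> b, c \<otimes>\<^bsub>QZ\<^esub> d) \<in> A"
    and "\<And>a c. (a, c) \<in> A \<Longrightarrow> (inv a, inv\<^bsub>QZ\<^esub> c) \<in> A"
    and "\<And>c. (\<one>, c) \<in> A \<Longrightarrow> c = \<one>\<^bsub>QZ\<^esub>"
  shows "partial_char G A"
  unfolding partial_char_def by (intro conjI allI impI assms)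

lemma partial_charD:
  assumes "partial_char G A"
  shows "(a, c) \<in> A \<Longrightarrow> a \<in> carrier G" and "(a, c) \<in> A \<Longrightarrow> c \<in> carrier QZ"
    and "(\<one>, \<one>\<^bsub>QZ\<^esub>) \<in> A"
    and "(a, c) \<in> A \<Longrightarrow> (b, d) \<in> A \<Longrightarrow> (a \<otimes> b, c \<otimes>\<^bsub>QZ\<^esub> d) \<in> A"
    and "(a, c) \<in> A \<Longrightarrow> (inv a, inv\<^bsub>QZ\<^esub> c) \<in> A"
    and "(\<one>, c) \<in> A \<Longrightarrow> c = \<one>\<^bsub>QZ\<^esub>"
  using assms unfolding partial_char_def by auto

lemma partial_char_unique:
  assumes A: "partial_char G A" and "(a, c) \<in> A" "(a, d) \<in> A"
  shows "c = d"
proof -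
  note D = partial_charD[OF A]
  have "(a \<otimes> inv a, c \<otimes>\<^bsub>QZ\<^esub> inv\<^bsub>QZ\<^esub> d) \<in> A"
    using D(4)[OF assms(2) D(5)[OF assms(3)]] .
  then have "c \<otimes>\<^bsub>QZ\<^esub> inv\<^bsub>QZ\<^esub> d = \<one>\<^bsub>QZ\<^esub>"
    using D(1)[OF assms(2)] D(6) by simp
  then show ?thesis
    using D(2)[OF assms(2)] D(2)[OF assms(3)] by (metis QZ.inv_equality QZ.inv_inv QZ.inv_closed)
qed

lemma partial_char_pow:
  assumes A: "partial_char G A" and "(a, c) \<in> A"
  shows "(a [^] (k::int), c [^]\<^bsub>QZ\<^esub> k) \<in> A"
proof -
  note D = partial_charD[OF A]
  have nat: "(a [^] (k::nat), c [^]\<^bsub>QZ\<^esub> k) \<in> A" for k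
  proof (induction k)
    case 0 then show ?case using D(3) by simp
  next
    case (Suc k) then show ?case using D(4)[OF Suc assms(2)] by simp
  qed
  have car: "a \<in> carrier G" "c \<in> carrier QZ" using D(1,2)[OF assms(2)] by auto
  show ?thesis
  proof (cases k rule: int_cases2)
    case (nonneg n)
    then show ?thesis using nat[of n] by (simp add: int_pow_int)
  next
    case (nonpos n)
    then show ?thesis using D(5)[OF nat[of n]] car by (simp add: int_pow_neg_int QZ.int_pow_neg_int)
  qed
qed

definition adjoin :: "('a \<times> rat set) set \<Rightarrow> 'a \<Rightarrow> rat set \<Rightarrow> ('a \<times> rat set) set" where
  "adjoin A g c =
     {(a \<otimes> g [^] (k::int), d \<otimes>\<^bsub>QZ\<^esub> c [^]\<^bsub>QZ\<^esub> k) |a d k. (a, d) \<in> A}"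

lemma adjoinI: "(a, d) \<in> A \<Longrightarrow>
    (a \<otimes> g [^] (k::int), d \<otimes>\<^bsub>QZ\<^esub> c [^]\<^bsub>QZ\<^esub> k) \<in> adjoin A g c"
  unfolding adjoin_def by blast

lemma subset_adjoin:
  assumes A: "partial_char G A" and "g \<in> carrier G" "c \<in> carrier QZ"
  shows "A \<subseteq> adjoin A g c" and "(g, c) \<in> adjoin A g c"
proof -
  note D = partial_charD[OF A]
  show "A \<subseteq> adjoin A g c"
    using adjoinI[where k = 0] D(1,2) by fastforce
  show "(g, c) \<in> adjoin A g c"
    using adjoinI[OF D(3), of g 1 c] assms(2,3) by simp
qed

text \<open>The exponents \<open>k\<close> with \<open>g [^] k\<close> in the domain of \<open>A\<close> form a subgroup \<open>n\<int>\<close>, so a value at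
  \<open>g\<close> is admissible as soon as its \<open>n\<close>-th power is the one that \<open>A\<close> prescribes.\<close>

lemma exponents:
  assumes A: "partial_char G A" and g: "g \<in> carrier G"
  obtains n d where "(g [^] (n::nat), d) \<in> A"
    and "\<And>c. c \<in> carrier QZ \<Longrightarrow> c [^]\<^bsub>QZ\<^esub> n = d \<Longrightarrow> partial_char G (adjoin A g c)"
proof -
  note D = partial_charD[OF A]
  have "\<exists>n::nat. {k::int. \<exists>d. (g [^] k, d) \<in> A} = {k. int n dvd k}"
  proof (rule int_subgroup_multiples)
    show "0 \<in> {k::int. \<exists>d. (g [^] k, d) \<in> A}" using D(3) by auto
    fix a b :: int assume "a \<in> {k. \<exists>d. (g [^] k, d) \<in> A}" "b \<in> {k. \<exists>d. (g [^] k, d) \<in> A}"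
    then obtain c d where "(g [^] a, c) \<in> A" "(g [^] b, d) \<in> A" by auto
    from D(4)[OF this(1) D(5)[OF this(2)]]
    show "a - b \<in> {k. \<exists>d. (g [^] k, d) \<in> A}" using g by (auto simp: int_pow_diff)
  qed
  then obtain n :: nat where n: "(\<exists>d. (g [^] (k::int), d) \<in> A) \<longleftrightarrow> int n dvd k" for k
    by (auto simp: set_eq_iff)
  have "\<exists>d. (g [^] int n, d) \<in> A" using n[of "int n"] by simp
  then obtain d where d: "(g [^] n, d) \<in> A" by (auto simp: int_pow_int)
  have "partial_char G (adjoin A g c)"
    if c: "c \<in> carrier QZ" and cn: "c [^]\<^bsub>QZ\<^esub> n = d" for c
  proof (rule partial_charI)
    show "adjoin A g c \<subseteq> carrier G \<times> carrier QZ"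
      using D(1,2) g c by (auto simp: adjoin_def)
    show "(\<one>, \<one>\<^bsub>QZ\<^esub>) \<in> adjoin A g c"
      using subset_adjoin(1)[OF A g c] D(3) by auto
  next
    fix a1 d1 a2 d2 assume "(a1, d1) \<in> adjoin A g c" "(a2, d2) \<in> adjoin A g c"
    then obtain b1 e1 k1 b2 e2 k2 where
      *: "a1 = b1 \<otimes> g [^] (k1::int)" "d1 = e1 \<otimes>\<^bsub>QZ\<^esub> c [^]\<^bsub>QZ\<^esub> k1" "(b1, e1) \<in> A"
      "a2 = b2 \<otimes> g [^] (k2::int)" "d2 = e2 \<otimes>\<^bsub>QZ\<^esub> c [^]\<^bsub>QZ\<^esub> k2" "(b2, e2) \<in> A"
      unfolding adjoin_def by blast
    have "a1 \<otimes> a2 = (b1 \<otimes> b2) \<otimes> g [^] (k1 + k2)"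
      using * g D(1) by (auto simp: int_pow_mult m_ac)
    moreover have "d1 \<otimes>\<^bsub>QZ\<^esub> d2 =
        (e1 \<otimes>\<^bsub>QZ\<^esub> e2) \<otimes>\<^bsub>QZ\<^esub> c [^]\<^bsub>QZ\<^esub> (k1 + k2)"
      using * c D(2) by (auto simp: QZ.int_pow_mult QZ.m_ac)
    ultimately show "(a1 \<otimes> a2, d1 \<otimes>\<^bsub>QZ\<^esub> d2) \<in> adjoin A g c"
      using adjoinI[OF D(4)[OF *(3) *(6)], of g "k1 + k2" c] by simp
  next
    fix a1 d1 assume "(a1, d1) \<in> adjoin A g c"
    then obtain b1 e1 k1 where
      *: "a1 = b1 \<otimes> g [^] (k1::int)" "d1 = e1 \<otimes>\<^bsub>QZ\<^esub> c [^]\<^bsub>QZ\<^esub> k1" "(b1, e1) \<in> A"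
      unfolding adjoin_def by blast
    have "inv a1 = inv b1 \<otimes> g [^] (- k1)"
      using * g D(1) by (auto simp: int_pow_neg inv_mult)
    moreover have "inv\<^bsub>QZ\<^esub> d1 =
        inv\<^bsub>QZ\<^esub> e1 \<otimes>\<^bsub>QZ\<^esub> c [^]\<^bsub>QZ\<^esub> (- k1)"
      using * c D(2) by (auto simp: QZ.int_pow_neg QZ.inv_mult)
    ultimately show "(inv a1, inv\<^bsub>QZ\<^esub> d1) \<in> adjoin A g c"
      using adjoinI[OF D(5)[OF *(3)], of g "- k1" c] by simp
  next
    fix e assume "(\<one>, e) \<in> adjoin A g c"
    then obtain b1 e1 k where
      *: "\<one> = b1 \<otimes> g [^] (k::int)" "e = e1 \<otimes>\<^bsub>QZ\<^esub> c [^]\<^bsub>QZ\<^esub> k" "(b1, e1) \<in> A"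
      unfolding adjoin_def by blast
    have b1: "b1 \<in> carrier G" "e1 \<in> carrier QZ" using D * by auto
    have "g [^] k = inv b1"
      using *(1) b1 g by (metis int_pow_closed inv_equality inv_inv)
    then have k: "(g [^] k, inv\<^bsub>QZ\<^esub> e1) \<in> A" using D(5)[OF *(3)] by simp
    then have "int n dvd k" using n[of k] by auto
    then obtain q where q: "k = int n * q" by (auto simp: dvd_def)
    have "(g [^] k, c [^]\<^bsub>QZ\<^esub> k) \<in> A"
      using partial_char_pow[OF A d, of q] g c cn
      by (simp add: q int_pow_pow[symmetric] QZ.int_pow_pow[symmetric] int_pow_int)
    then have "inv\<^bsub>QZ\<^esub> e1 = c [^]\<^bsub>QZ\<^esub> k"
      by (rule partial_char_unique[OF A k])
    then show "e = \<one>\<^bsub>QZ\<^esub>" using *(2) b1 QZ.r_inv[of e1] by simp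
  qed
  from that[OF d this] show thesis .
qed

text \<open>\<open>\<rat>/\<int>\<close> is an injective abelian group.  By divisibility a maximal partial character is defined
  at every \<open>g\<close>: otherwise a root of the value prescribed at a power of \<open>g\<close> could be adjoined.\<close>

theorem partial_char_extends:
  assumes "partial_char G A"
  shows "\<exists>\<xi>\<in>hom G QZ. \<forall>a c. (a, c) \<in> A \<longrightarrow> \<xi> a = c"
proof -
  let ?P = "{B. partial_char G B \<and> A \<subseteq> B}"
  have "\<exists>M\<in>?P. \<forall>X\<in>?P. M \<subseteq> X \<longrightarrow> X = M"
  proof (rule subset_Zorn_nonempty)
    show "?P \<noteq> {}" using assms by auto
    fix C assume C: "C \<noteq> {}" "subset.chain ?P C"
    then have pc: "partial_char G B" "A \<subseteq> B" if "B \<in> C" for B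
      using that by (auto simp: subset.chain_def)
    have tot: "B \<subseteq> B' \<or> B' \<subseteq> B" if "B \<in> C" "B' \<in> C" for B B'
      using C(2) that unfolding subset.chain_def by blast
    have "partial_char G (\<Union>C)"
    proof (rule partial_charI)
      show "\<Union> C \<subseteq> carrier G \<times> carrier QZ"
      proof
        fix p assume "p \<in> \<Union>C"
        then obtain B where "B \<in> C" "p \<in> B" by blast
        then show "p \<in> carrier G \<times> carrier QZ"
          using partial_charD(1,2)[OF pc(1), of B "fst p" "snd p"] by (cases p) auto
      qed
      show "(\<one>, \<one>\<^bsub>QZ\<^esub>) \<in> \<Union>C"
        using partial_charD(3)[OF pc(1)] C(1) by blast
      show "(a \<otimes> b, c \<otimes>\<^bsub>QZ\<^esub> d) \<in> \<Union>C" if ab: "(a, c) \<in> \<Union>C" "(b, d) \<in> \<Union>C" for a b c d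
      proof -
        obtain B B' where "B \<in> C" "B' \<in> C" "(a, c) \<in> B" "(b, d) \<in> B'" using ab by blast
        then obtain B where "B \<in> C" "(a, c) \<in> B" "(b, d) \<in> B" using tot[of B B'] by blast
        from this(1) partial_charD(4)[OF pc(1) this(2,3)] show ?thesis by blast
      qed
      show "(inv a, inv\<^bsub>QZ\<^esub> c) \<in> \<Union>C" if "(a, c) \<in> \<Union>C" for a c
        using partial_charD(5)[OF pc(1)] that by blast
      show "c = \<one>\<^bsub>QZ\<^esub>" if "(\<one>, c) \<in> \<Union>C" for c
        using partial_charD(6)[OF pc(1)] that by blast
    qed
    then show "\<Union>C \<in> ?P" using pc C(1) by blast
  qed
  then obtain M where "M \<in> ?P" and max': "\<forall>X\<in>?P. M \<subseteq> X \<longrightarrow> X = M" ..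
  then have M: "partial_char G M" "A \<subseteq> M" by simp_all
  have max: "X = M" if "partial_char G X" "M \<subseteq> X" for X
    using max' that M(2) by simp
  have "\<exists>c. (g, c) \<in> M" if g: "g \<in> carrier G" for g
  proof -
    obtain n d where d: "(g [^] (n::nat), d) \<in> M" and
      adj: "\<And>c. c \<in> carrier QZ \<Longrightarrow> c [^]\<^bsub>QZ\<^esub> n = d \<Longrightarrow> partial_char G (adjoin M g c)"
      using exponents[OF M(1) g] by metis
    have "\<exists>c\<in>carrier QZ. c [^]\<^bsub>QZ\<^esub> n = d"
    proof (cases "n = 0")
      case True
      then show ?thesis using d partial_charD(6)[OF M(1)] by auto
    next
      case False
      then show ?thesis using rat_mod_int_divisible partial_charD(2)[OF M(1) d] by blast
    qed
    then obtain c where c: "c \<in> carrier QZ" "c [^]\<^bsub>QZ\<^esub> n = d" by blast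
    then show ?thesis
      using max[OF adj] subset_adjoin[OF M(1) g c(1)] by blast
  qed
  then obtain \<xi> where \<xi>: "(g, \<xi> g) \<in> M" if "g \<in> carrier G" for g by metis
  have eq: "\<xi> a = c" if "(a, c) \<in> M" for a c
    by (rule partial_char_unique[OF M(1) \<xi>[OF partial_charD(1)[OF M(1) that]] that])
  have "\<xi> \<in> hom G QZ"
  proof (rule homI)
    show "\<xi> a \<in> carrier QZ" if "a \<in> carrier G" for a
      by (rule partial_charD(2)[OF M(1) \<xi>[OF that]])
    show "\<xi> (a \<otimes> b) = \<xi> a \<otimes>\<^bsub>QZ\<^esub> \<xi> b" if "a \<in> carrier G" "b \<in> carrier G" for a b
      by (rule eq[OF partial_charD(4)[OF M(1) \<xi>[OF that(1)] \<xi>[OF that(2)]]])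
  qed
  moreover have "\<xi> a = c" if "(a, c) \<in> A" for a c
    using eq M(2) that by auto
  ultimately show ?thesis by auto
qed

text \<open>Let \<open>n\<close> generate the exponents that take \<open>y\<close> into \<open>H\<close>.  Since \<open>y \<notin> H\<close>, \<open>n \<noteq> 1\<close>, so \<open>\<rat>/\<int>\<close> has a
  non-trivial element killed by \<open>n\<close>, which is admissible as the value at \<open>y\<close>.\<close>

theorem characters_separate:
  assumes H: "subgroup H G" and y: "y \<in> carrier G" "y \<notin> H"
  obtains \<xi> where "\<xi> \<in> hom G QZ" and "\<And>h. h \<in> H \<Longrightarrow> \<xi> h = \<one>\<^bsub>QZ\<^esub>"
    and "\<xi> y \<noteq> \<one>\<^bsub>QZ\<^esub>"
proof -
  let ?A = "H \<times> {\<one>\<^bsub>QZ\<^esub>}"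
  have A: "partial_char G ?A"
    using subgroup.subset[OF H] subgroup.one_closed[OF H] subgroup.m_closed[OF H]
      subgroup.m_inv_closed[OF H]
    by (intro partial_charI) auto
  obtain n d where n: "(y [^] (n::nat), d) \<in> ?A" and
    adj: "\<And>c. c \<in> carrier QZ \<Longrightarrow> c [^]\<^bsub>QZ\<^esub> n = d \<Longrightarrow> partial_char G (adjoin ?A y c)"
    using exponents[OF A y(1)] by metis
  have "n \<noteq> 1" using n y by auto
  then obtain c where c: "c \<in> carrier QZ" "c \<noteq> \<one>\<^bsub>QZ\<^esub>"
    "c [^]\<^bsub>QZ\<^esub> n = \<one>\<^bsub>QZ\<^esub>"
    using rat_mod_int_torsion by blast
  have "partial_char G (adjoin ?A y c)" using adj c n by auto
  then obtain \<xi> where "\<xi> \<in> hom G QZ" and \<xi>: "\<And>a e. (a, e) \<in> adjoin ?A y c \<Longrightarrow> \<xi> a = e"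
    using partial_char_extends by blast
  then show thesis
    using that[of \<xi>] subset_adjoin[OF A y(1) c(1)] c(2) by blast
qed

end

text \<open>\<open>\<rat>/\<int>\<close> is not compact, so there is no limit along an ultrafilter; injectivity replaces it:
  extend the functional that sends a function that is eventually constant along \<open>F\<close> to its value.\<close>

lemma limit_functional:
  assumes F: "F \<noteq> bot"
  shows "\<exists>\<Phi> :: ('x \<Rightarrow> rat set) \<Rightarrow> rat set.
    (\<forall>g. \<Phi> g \<in> carrier QZ) \<and>
    (\<forall>g h k. eventually (\<lambda>x. g x \<in> carrier QZ \<and> h x \<in> carrier QZ \<and>
        k x = g x \<otimes>\<^bsub>QZ\<^esub> h x) F \<longrightarrow> \<Phi> k = \<Phi> g \<otimes>\<^bsub>QZ\<^esub> \<Phi> h) \<and>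
    (\<forall>g c. c \<in> carrier QZ \<longrightarrow> eventually (\<lambda>x. g x = c) F \<longrightarrow> \<Phi> g = c) \<and>
    (\<forall>g h. eventually (\<lambda>x. g x = h x) F \<longrightarrow> \<Phi> g = \<Phi> h)"
proof -
  let ?G = "product_group UNIV (\<lambda>x::'x. QZ)"
  interpret G: comm_group ?G
    by (rule group.group_comm_groupI) (auto simp: PiE_iff QZ.m_comm QZ.is_group intro!: restrict_ext)
  let ?A = "{(g, c). g \<in> carrier ?G \<and> c \<in> carrier QZ \<and> eventually (\<lambda>x. g x = c) F}"
  have "partial_char ?G ?A"
  proof (rule G.partial_charI)
    fix a c assume "(a, c) \<in> ?A"
    then show "(inv\<^bsub>?G\<^esub> a, inv\<^bsub>QZ\<^esub> c) \<in> ?A"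
      by (auto elim: eventually_mono simp: QZ.is_group)
  next
    fix a c b d assume "(a, c) \<in> ?A" "(b, d) \<in> ?A"
    then show "(a \<otimes>\<^bsub>?G\<^esub> b, c \<otimes>\<^bsub>QZ\<^esub> d) \<in> ?A"
      by (auto elim: eventually_elim2)
  next
    fix c assume "(\<one>\<^bsub>?G\<^esub>, c) \<in> ?A"
    then show "c = \<one>\<^bsub>QZ\<^esub>" using F by (auto simp: eventually_const_iff)
  qed auto
  then obtain \<xi> where \<xi>: "\<xi> \<in> hom ?G QZ" and eq: "\<And>g c. (g, c) \<in> ?A \<Longrightarrow> \<xi> g = c"
    using G.partial_char_extends by blast
  \<comment> \<open>The values outside \<open>\<rat>/\<int>\<close> are replaced by zero, so that only the eventual behaviour of \<open>g\<close>
    matters.\<close>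
  define N where "N g = (\<lambda>x. if g x \<in> carrier QZ then g x else \<one>\<^bsub>QZ\<^esub>)"
    for g :: "'x \<Rightarrow> rat set"
  have N: "N g \<in> carrier ?G" for g by (auto simp: N_def)
  interpret \<xi>: group_hom ?G QZ \<xi> using \<xi> by unfold_locales
  define \<Phi> where "\<Phi> g = \<xi> (N g)" for g
  have c: "\<Phi> g = c" if "c \<in> carrier QZ" "eventually (\<lambda>x. g x = c) F" for g c
    unfolding \<Phi>_def by (rule eq) (use that N in \<open>auto simp: N_def elim: eventually_mono\<close>)
  have m: "\<Phi> k = \<Phi> g \<otimes>\<^bsub>QZ\<^esub> \<Phi> h"
    if ev: "eventually (\<lambda>x. g x \<in> carrier QZ \<and> h x \<in> carrier QZ \<and>
              k x = g x \<otimes>\<^bsub>QZ\<^esub> h x) F" for g h k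
  proof -
    let ?q = "N k \<otimes>\<^bsub>?G\<^esub> inv\<^bsub>?G\<^esub> (N g \<otimes>\<^bsub>?G\<^esub> N h)"
    have mem: "N g \<otimes>\<^bsub>?G\<^esub> N h \<in> carrier ?G" using N by blast
    have "\<xi> ?q = \<one>\<^bsub>QZ\<^esub>"
    proof (rule eq)
      have "eventually (\<lambda>x. ?q x = \<one>\<^bsub>QZ\<^esub>) F"
        using ev
        by (rule eventually_mono)
          (subst inv_product_group, use mem in \<open>auto simp: N_def QZ.is_group QZ.r_inv\<close>)
      then show "(?q, \<one>\<^bsub>QZ\<^esub>) \<in> ?A" using N mem by (auto simp del: mult_product_group carrier_product_group)
    qed
    then have "\<xi> (N k) \<otimes>\<^bsub>QZ\<^esub> inv\<^bsub>QZ\<^esub> (\<xi> (N g) \<otimes>\<^bsub>QZ\<^esub> \<xi> (N h)) = \<one>\<^bsub>QZ\<^esub>"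
      using N mem by (simp del: mult_product_group carrier_product_group inv_product_group)
    then show ?thesis unfolding \<Phi>_def
      using \<xi>.hom_closed[OF N]
      by (metis QZ.inv_closed QZ.inv_equality QZ.inv_inv QZ.m_closed)
  qed
  have e: "\<Phi> g = \<Phi> h" if "eventually (\<lambda>x. g x = h x) F" for g h
  proof -
    have "\<Phi> (N g) = \<Phi> (N h) \<otimes>\<^bsub>QZ\<^esub> \<Phi> (\<lambda>_. \<one>\<^bsub>QZ\<^esub>)"
      by (rule m, rule eventually_mono[OF that]) (simp add: N_def)
    moreover have "\<Phi> (\<lambda>_. \<one>\<^bsub>QZ\<^esub>) = \<one>\<^bsub>QZ\<^esub>" by (rule c) auto
    moreover have "N (N f) = N f" for f by (simp add: N_def fun_eq_iff)
    ultimately show ?thesis using \<xi>.hom_closed[OF N] by (simp add: \<Phi>_def)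
  qed
  have closed: "\<Phi> g \<in> carrier QZ" for g
    unfolding \<Phi>_def by (rule \<xi>.hom_closed[OF N])
  show ?thesis
    by (rule exI[of _ \<Phi>], intro conjI allI impI) (rule closed, rule m, assumption, rule c, assumption+, rule e)
qed

section \<open>Modules and linear maps\<close>

lemma finprod_hom:
  assumes "comm_group G" "comm_group H" "h \<in> hom G H" "u \<in> I \<rightarrow> carrier G"
  shows "h (finprod G u I) = finprod H (\<lambda>i. h (u i)) I"
proof -
  interpret G: comm_group G by fact
  interpret H: comm_group H by fact
  interpret h: group_hom G H h using assms(3) by unfold_locales
  show ?thesis
    using assms(4)
  proof (induction I rule: infinite_finite_induct)
    case (insert i I)
    then show ?case by (subst G.finprod_insert; (subst H.finprod_insert)?) (auto simp: Pi_iff)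
  qed auto
qed

lemma (in comm_monoid) finprod_swap:
  assumes "\<And>i j. i \<in> I \<Longrightarrow> j \<in> J \<Longrightarrow> f i j \<in> carrier G"
  shows "finprod G (\<lambda>i. finprod G (\<lambda>j. f i j) J) I = finprod G (\<lambda>j. finprod G (\<lambda>i. f i j) I) J"
  using assms
proof (induction I rule: infinite_finite_induct)
  case (insert i I)
  have c: "finprod G (f k) J \<in> carrier G" if "k \<in> insert i I" for k
    using that insert.prems by (intro finprod_closed) auto
  have "finprod G (\<lambda>i. finprod G (\<lambda>j. f i j) J) (insert i I) =
      finprod G (\<lambda>j. f i j) J \<otimes> finprod G (\<lambda>j. finprod G (\<lambda>i. f i j) I) J"
    using insert c by (subst finprod_insert) auto
  also have "\<dots> = finprod G (\<lambda>j. f i j \<otimes> finprod G (\<lambda>i. f i j) I) J"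
    using insert.prems by (intro finprod_multf[symmetric] Pi_I finprod_closed) auto
  also have "\<dots> = finprod G (\<lambda>j. finprod G (\<lambda>i. f i j) (insert i I)) J"
    using insert.hyps insert.prems by (intro finprod_cong') auto
  finally show ?case .
qed (auto intro!: finprod_one_eqI[symmetric])

lemma opposite_ring_simps [simp]:
  "carrier (opposite_ring S) = carrier S" "add (opposite_ring S) = add S"
  "\<zero>\<^bsub>opposite_ring S\<^esub> = \<zero>\<^bsub>S\<^esub>" "\<one>\<^bsub>opposite_ring S\<^esub> = \<one>\<^bsub>S\<^esub>"
  "a \<otimes>\<^bsub>opposite_ring S\<^esub> b = b \<otimes>\<^bsub>S\<^esub> a"
  by (simp_all add: opposite_ring_def)

lemma ring_opposite_ring [simp]:
  assumes "ring S" shows "ring (opposite_ring S)"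
proof -
  interpret ring S by fact
  show ?thesis
  proof (rule ringI)
    have "add_monoid (opposite_ring S) = add_monoid S" by (simp add: opposite_ring_def)
    then show "abelian_group (opposite_ring S)"
      by (intro comm_group_abelian_groupI) (use a_comm_group in simp)
    show "monoid (opposite_ring S)"
      by (rule monoidI) (auto simp: m_assoc)
  qed (auto simp: l_distr r_distr)
qed

lemma left_moduleI:
  assumes "ring S" "abelian_group M"
    and "\<And>a x. a \<in> carrier S \<Longrightarrow> x \<in> carrier M \<Longrightarrow> a \<odot>\<^bsub>M\<^esub> x \<in> carrier M"
    and "\<And>a b x. a \<in> carrier S \<Longrightarrow> b \<in> carrier S \<Longrightarrow> x \<in> carrier M \<Longrightarrow>
           (a \<oplus>\<^bsub>S\<^esub> b) \<odot>\<^bsub>M\<^esub> x = a \<odot>\<^bsub>M\<^esub> x \<oplus>\<^bsub>M\<^esub> b \<odot>\<^bsub>M\<^esub> x"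
    and "\<And>a x y. a \<in> carrier S \<Longrightarrow> x \<in> carrier M \<Longrightarrow> y \<in> carrier M \<Longrightarrow>
           a \<odot>\<^bsub>M\<^esub> (x \<oplus>\<^bsub>M\<^esub> y) = a \<odot>\<^bsub>M\<^esub> x \<oplus>\<^bsub>M\<^esub> a \<odot>\<^bsub>M\<^esub> y"
    and "\<And>a b x. a \<in> carrier S \<Longrightarrow> b \<in> carrier S \<Longrightarrow> x \<in> carrier M \<Longrightarrow>
           (a \<otimes>\<^bsub>S\<^esub> b) \<odot>\<^bsub>M\<^esub> x = a \<odot>\<^bsub>M\<^esub> (b \<odot>\<^bsub>M\<^esub> x)"
    and "\<And>x. x \<in> carrier M \<Longrightarrow> \<one>\<^bsub>S\<^esub> \<odot>\<^bsub>M\<^esub> x = x"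
  shows "left_module S M"
  using assms by (intro left_module.intro left_module_axioms.intro) auto

lemma left_moduleD:
  assumes "left_module S M"
  shows "ring S" "abelian_group M" "comm_group (add_monoid M)" "group (add_monoid M)"
proof -
  interpret left_module S M by fact
  show "ring S" "abelian_group M" by unfold_locales
  show "comm_group (add_monoid M)" by (rule M.a_comm_group)
  then show "group (add_monoid M)" by (rule comm_group.axioms)
qed

context left_module
begin

lemma smult_hom: "a \<in> carrier R \<Longrightarrow> (\<lambda>x. a \<odot>\<^bsub>M\<^esub> x) \<in> hom (add_monoid M) (add_monoid M)"
  by (rule homI) (auto simp: smult_closed smult_r_distr)

lemma smult_zero [simp]: "a \<in> carrier R \<Longrightarrow> a \<odot>\<^bsub>M\<^esub> \<zero>\<^bsub>M\<^esub> = \<zero>\<^bsub>M\<^esub>"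
  using hom_one[OF smult_hom M.a_group M.a_group] by simp

lemma zero_smult [simp]:
  assumes "x \<in> carrier M" shows "\<zero> \<odot>\<^bsub>M\<^esub> x = \<zero>\<^bsub>M\<^esub>"
proof -
  have "\<zero> \<odot>\<^bsub>M\<^esub> x \<oplus>\<^bsub>M\<^esub> \<zero> \<odot>\<^bsub>M\<^esub> x = \<zero> \<odot>\<^bsub>M\<^esub> x"
    using smult_l_distr[of \<zero> \<zero> x] assms by simp
  then show ?thesis using assms by (metis M.add.l_cancel_one' R.zero_closed smult_closed)
qed

lemma smult_finsum:
  assumes "a \<in> carrier R" "u \<in> I \<rightarrow> carrier M"
  shows "a \<odot>\<^bsub>M\<^esub> finsum M u I = finsum M (\<lambda>i. a \<odot>\<^bsub>M\<^esub> u i) I"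
  using finprod_hom[OF M.a_comm_group M.a_comm_group smult_hom[OF assms(1)], of u I] assms(2)
  by (simp add: finsum_def)

end

lemma linear_homI:
  assumes "\<And>x. x \<in> carrier M \<Longrightarrow> f x \<in> carrier N"
    and "\<And>x y. x \<in> carrier M \<Longrightarrow> y \<in> carrier M \<Longrightarrow> f (x \<oplus>\<^bsub>M\<^esub> y) = f x \<oplus>\<^bsub>N\<^esub> f y"
    and "\<And>a x. a \<in> carrier S \<Longrightarrow> x \<in> carrier M \<Longrightarrow> f (a \<odot>\<^bsub>M\<^esub> x) = a \<odot>\<^bsub>N\<^esub> f x"
  shows "f \<in> linear_hom S M N"
  using assms by (auto simp: linear_hom_def hom_def)

lemma linear_homD:
  assumes "f \<in> linear_hom S M N"
  shows "x \<in> carrier M \<Longrightarrow> f x \<in> carrier N"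
    and "x \<in> carrier M \<Longrightarrow> y \<in> carrier M \<Longrightarrow> f (x \<oplus>\<^bsub>M\<^esub> y) = f x \<oplus>\<^bsub>N\<^esub> f y"
    and "a \<in> carrier S \<Longrightarrow> x \<in> carrier M \<Longrightarrow> f (a \<odot>\<^bsub>M\<^esub> x) = a \<odot>\<^bsub>N\<^esub> f x"
    and "f \<in> hom (add_monoid M) (add_monoid N)"
  using assms by (auto simp: linear_hom_def hom_def)

lemma linear_hom_zero:
  assumes "f \<in> linear_hom S M N" "left_module S M" "left_module S N"
  shows "f \<zero>\<^bsub>M\<^esub> = \<zero>\<^bsub>N\<^esub>"
  using hom_one[OF linear_homD(4)[OF assms(1)] left_moduleD(4)[OF assms(2)] left_moduleD(4)[OF assms(3)]]
  by simp

lemma linear_hom_minus: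
  assumes "f \<in> linear_hom S M N" "left_module S M" "left_module S N" "x \<in> carrier M"
  shows "f (\<ominus>\<^bsub>M\<^esub> x) = \<ominus>\<^bsub>N\<^esub> f x"
proof -
  interpret group_hom "add_monoid M" "add_monoid N" f
    using linear_homD(4)[OF assms(1)] left_moduleD(4)[OF assms(2)] left_moduleD(4)[OF assms(3)]
    by (simp add: group_hom_def group_hom_axioms_def)
  show ?thesis using hom_inv[of x] assms(4) by (simp add: a_inv_def)
qed

lemma linear_hom_finsum:
  assumes "f \<in> linear_hom S M N" "left_module S M" "left_module S N" "u \<in> I \<rightarrow> carrier M"
  shows "f (finsum M u I) = finsum N (\<lambda>i. f (u i)) I"
  using finprod_hom[OF left_moduleD(3)[OF assms(2)] left_moduleD(3)[OF assms(3)] linear_homD(4)[OF assms(1)], of u I]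
    assms(4) by (simp add: finsum_def)

lemma linear_hom_comp:
  assumes "f \<in> linear_hom S L M" "g \<in> linear_hom S M N"
  shows "(\<lambda>x. g (f x)) \<in> linear_hom S L N"
  using assms by (intro linear_homI) (simp_all add: linear_homD)

lemma linear_hom_the_inv:
  assumes f: "f \<in> linear_hom S M N" "bij_betw f (carrier M) (carrier N)" and M: "left_module S M"
  shows "the_inv_into (carrier M) f \<in> linear_hom S N M"
proof -
  interpret left_module S M by fact
  let ?g = "the_inv_into (carrier M) f"
  have inj: "inj_on f (carrier M)" using f by (simp add: bij_betw_def)
  have g: "?g y \<in> carrier M" "f (?g y) = y" if "y \<in> carrier N" for y
    using that f bij_betw_the_inv_into[OF f(2)]
    by (auto simp: bij_betw_def intro: the_inv_into_into f_the_inv_into_f)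
  show ?thesis
  proof (rule linear_homI)
    show "?g y \<in> carrier M" if "y \<in> carrier N" for y using g that by simp
    show "?g (x \<oplus>\<^bsub>N\<^esub> y) = ?g x \<oplus>\<^bsub>M\<^esub> ?g y" if "x \<in> carrier N" "y \<in> carrier N" for x y
      using g that by (intro the_inv_into_f_eq[OF inj]) (simp_all add: linear_homD[OF f(1)])
    show "?g (a \<odot>\<^bsub>N\<^esub> x) = a \<odot>\<^bsub>M\<^esub> ?g x" if "a \<in> carrier S" "x \<in> carrier N" for a x
      using g that smult_closed
      by (intro the_inv_into_f_eq[OF inj]) (simp_all add: linear_homD[OF f(1)])
  qed
qed

lemma module_isomorphic_direct_summand:
  assumes "module_isomorphic S M N" "left_module S M"
  shows "direct_summand S M N" "direct_summand S N M"
proof -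
  obtain f where f: "f \<in> linear_hom S M N" "bij_betw f (carrier M) (carrier N)"
    using assms(1) by (auto simp: module_isomorphic_def)
  note g = linear_hom_the_inv[OF f assms(2)]
  have "the_inv_into (carrier M) f (f x) = x" if "x \<in> carrier M" for x
    using f(2) that by (simp add: bij_betw_def the_inv_into_f_f)
  then show "direct_summand S M N" unfolding direct_summand_def using f g by blast
  have "f (the_inv_into (carrier M) f y) = y" if "y \<in> carrier N" for y
    using f(2) that by (auto simp: bij_betw_def f_the_inv_into_f)
  then show "direct_summand S N M" unfolding direct_summand_def using f g by blast
qed

lemma direct_summand_trans:
  assumes "direct_summand S L M" "direct_summand S M N"
  shows "direct_summand S L N"
proof -
  obtain f g where f: "f \<in> linear_hom S L M" "g \<in> linear_hom S M L" "\<And>x. x \<in> carrier L \<Longrightarrow> g (f x) = x"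
    using assms(1) by (auto simp: direct_summand_def)
  obtain f' g' where f': "f' \<in> linear_hom S M N" "g' \<in> linear_hom S N M" "\<And>x. x \<in> carrier M \<Longrightarrow> g' (f' x) = x"
    using assms(2) by (auto simp: direct_summand_def)
  show ?thesis unfolding direct_summand_def
    by (intro bexI[OF _ linear_hom_comp[OF f(1) f'(1)]] bexI[OF _ linear_hom_comp[OF f'(2) f(2)]])
      (simp add: f f' linear_homD[OF f(1)])
qed


section \<open>Products, free modules and quotients\<close>

lemma product_module_simps [simp]:
  "carrier (product_module I N) = (\<Pi>\<^sub>E i\<in>I. carrier (N i))"
  "\<zero>\<^bsub>product_module I N\<^esub> = (\<lambda>i\<in>I. \<zero>\<^bsub>N i\<^esub>)"
  "x \<oplus>\<^bsub>product_module I N\<^esub> y = (\<lambda>i\<in>I. x i \<oplus>\<^bsub>N i\<^esub> y i)"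
  "a \<odot>\<^bsub>product_module I N\<^esub> x = (\<lambda>i\<in>I. a \<odot>\<^bsub>N i\<^esub> x i)"
  by (simp_all add: product_module_def)

lemma left_module_product:
  fixes S :: "'r ring" and N :: "'i \<Rightarrow> ('r, 'm) module"
  assumes "ring S" and N: "\<And>i. i \<in> I \<Longrightarrow> left_module S (N i)"
  shows "left_module S (product_module I N)"
proof (rule left_moduleI)
  have N': "abelian_group (N i)" if "i \<in> I" for i using N[OF that] by (rule left_moduleD)
  show "abelian_group (product_module I N)"
  proof (rule abelian_groupI)
    fix x assume x: "x \<in> carrier (product_module I N)"
    then show "\<exists>y\<in>carrier (product_module I N). y \<oplus>\<^bsub>product_module I N\<^esub> x = \<zero>\<^bsub>product_module I N\<^esub>"
      using N' by (intro bexI[of _ "\<lambda>i\<in>I. \<ominus>\<^bsub>N i\<^esub> x i"])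
        (auto simp: PiE_iff abelian_group.l_neg abelian_group.a_inv_closed intro!: restrict_ext)
    show "\<zero>\<^bsub>product_module I N\<^esub> \<oplus>\<^bsub>product_module I N\<^esub> x = x"
      using x N' by (intro ext) (auto simp: PiE_iff extensional_def abelian_group.axioms(1)
          abelian_monoid.l_zero)
    fix y assume y: "y \<in> carrier (product_module I N)"
    show "x \<oplus>\<^bsub>product_module I N\<^esub> y = y \<oplus>\<^bsub>product_module I N\<^esub> x"
      using x y N' by (auto simp: PiE_iff abelian_group.axioms(1) abelian_monoid.a_comm intro!: restrict_ext)
  qed (use N' in \<open>auto simp: PiE_iff abelian_group.axioms(1) abelian_monoid.a_closed
      abelian_monoid.zero_closed abelian_monoid.a_assoc intro!: restrict_ext\<close>)
  show "\<one>\<^bsub>S\<^esub> \<odot>\<^bsub>product_module I N\<^esub> x = x" if "x \<in> carrier (product_module I N)" for x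
    using that left_module.smult_one[OF N] by (auto simp: PiE_iff extensional_def intro!: ext)
qed (use assms(1) left_module.smult_closed[OF N] left_module.smult_l_distr[OF N]
    left_module.smult_r_distr[OF N] left_module.smult_assoc[OF N]
    in \<open>auto simp: PiE_iff intro!: restrict_ext\<close>)

lemma product_module_minus:
  fixes S :: "'r ring" and N :: "'i \<Rightarrow> ('r, 'm) module"
  assumes "ring S" and N: "\<And>i. i \<in> I \<Longrightarrow> left_module S (N i)"
    and x: "x \<in> carrier (product_module I N)" and i: "i \<in> I"
  shows "(\<ominus>\<^bsub>product_module I N\<^esub> x) i = \<ominus>\<^bsub>N i\<^esub> x i"
proof -
  have "(\<lambda>x. x i) \<in> linear_hom S (product_module I N) (N i)"
    using i by (intro linear_homI) auto
  from linear_hom_minus[OF this left_module_product[OF assms(1,2)] N[OF i] x] show ?thesis .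
qed

lemma regular_module_simps [simp]:
  "carrier (regular_module S) = carrier S" "\<zero>\<^bsub>regular_module S\<^esub> = \<zero>\<^bsub>S\<^esub>"
  "x \<oplus>\<^bsub>regular_module S\<^esub> y = x \<oplus>\<^bsub>S\<^esub> y" "a \<odot>\<^bsub>regular_module S\<^esub> x = a \<otimes>\<^bsub>S\<^esub> x"
  by (simp_all add: regular_module_def)

lemma left_module_regular:
  assumes "ring S" shows "left_module S (regular_module S)"
proof -
  interpret ring S by fact
  have "abelian_group (regular_module S)"
    by (rule abelian_groupI) (auto simp: a_ac intro: l_neg bexI[of _ "\<ominus>\<^bsub>S\<^esub> x" for x])
  then show ?thesis
    using assms by (intro left_moduleI) (auto simp: l_distr r_distr m_assoc)
qed

lemma free_module_simps [simp]:
  "carrier (free_module S n) = (\<Pi>\<^sub>E i\<in>{..<n}. carrier S)"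
  "\<zero>\<^bsub>free_module S n\<^esub> = (\<lambda>i\<in>{..<n}. \<zero>\<^bsub>S\<^esub>)"
  "x \<oplus>\<^bsub>free_module S n\<^esub> y = (\<lambda>i\<in>{..<n}. x i \<oplus>\<^bsub>S\<^esub> y i)"
  "a \<odot>\<^bsub>free_module S n\<^esub> x = (\<lambda>i\<in>{..<n}. a \<otimes>\<^bsub>S\<^esub> x i)"
  by (simp_all add: free_module_def cong: restrict_cong)

lemma left_module_free: "ring S \<Longrightarrow> left_module S (free_module S n)"
  unfolding free_module_def by (intro left_module_product left_module_regular)

definition lincomb :: "('r, 'm) module \<Rightarrow> nat \<Rightarrow> (nat \<Rightarrow> 'm) \<Rightarrow> (nat \<Rightarrow> 'r) \<Rightarrow> 'm" where
  "lincomb M n u x = finsum M (\<lambda>j. x j \<odot>\<^bsub>M\<^esub> u j) {..<n}"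

definition unit_vector :: "'r ring \<Rightarrow> nat \<Rightarrow> nat \<Rightarrow> nat \<Rightarrow> 'r" where
  "unit_vector S n j = (\<lambda>i\<in>{..<n}. if i = j then \<one>\<^bsub>S\<^esub> else \<zero>\<^bsub>S\<^esub>)"

context
  fixes S :: "'r ring" and M :: "('r, 'm) module"
  assumes M: "left_module S M"
begin

interpretation left_module S M by (rule M)

lemma lincomb_closed:
  assumes "\<And>j. j < n \<Longrightarrow> u j \<in> carrier M" "\<And>j. j < n \<Longrightarrow> x j \<in> carrier S"
  shows "lincomb M n u x \<in> carrier M"
  unfolding lincomb_def using assms smult_closed by (intro M.finsum_closed) auto

lemma lincomb_linear:
  assumes u: "\<And>j. j < n \<Longrightarrow> u j \<in> carrier M"
  shows "lincomb M n u \<in> linear_hom S (free_module S n) M"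
proof (rule linear_homI)
  show "lincomb M n u x \<in> carrier M" if "x \<in> carrier (free_module S n)" for x
    using u that by (intro lincomb_closed) auto
  show "lincomb M n u (x \<oplus>\<^bsub>free_module S n\<^esub> y) = lincomb M n u x \<oplus>\<^bsub>M\<^esub> lincomb M n u y"
    if "x \<in> carrier (free_module S n)" "y \<in> carrier (free_module S n)" for x y
  proof -
    have "lincomb M n u (x \<oplus>\<^bsub>free_module S n\<^esub> y) =
        finsum M (\<lambda>j. x j \<odot>\<^bsub>M\<^esub> u j \<oplus>\<^bsub>M\<^esub> y j \<odot>\<^bsub>M\<^esub> u j) {..<n}"
      unfolding lincomb_def
      by (rule M.finsum_cong') (use u that in \<open>auto simp: PiE_iff smult_closed smult_l_distr\<close>)
    then show ?thesis unfolding lincomb_def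
      using u that by (subst M.finsum_addf[symmetric]) (auto simp: PiE_iff smult_closed)
  qed
  show "lincomb M n u (a \<odot>\<^bsub>free_module S n\<^esub> x) = a \<odot>\<^bsub>M\<^esub> lincomb M n u x"
    if "a \<in> carrier S" "x \<in> carrier (free_module S n)" for a x
    unfolding lincomb_def
    by (subst smult_finsum)
      (use u that in \<open>auto simp: PiE_iff smult_closed smult_assoc intro!: M.finsum_cong'\<close>)
qed

lemma lincomb_unit_vector:
  assumes u: "\<And>j. j < n \<Longrightarrow> u j \<in> carrier M" and j: "j < n"
  shows "lincomb M n u (unit_vector S n j) = u j"
proof -
  have "lincomb M n u (unit_vector S n j) =
      finsum M (\<lambda>i. if j = i then u i else \<zero>\<^bsub>M\<^esub>) {..<n}"
    unfolding lincomb_def unit_vector_def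
    by (rule M.finsum_cong') (use u in \<open>auto simp: smult_one\<close>)
  also have "\<dots> = u j" using u j by (intro M.finsum_singleton) auto
  finally show ?thesis .
qed

lemma linear_hom_lincomb:
  assumes N: "left_module S N" and h: "h \<in> linear_hom S M N"
    and u: "\<And>j. j < n \<Longrightarrow> u j \<in> carrier M" and x: "\<And>j. j < n \<Longrightarrow> x j \<in> carrier S"
  shows "h (lincomb M n u x) = lincomb N n (\<lambda>j. h (u j)) x"
proof -
  interpret N: left_module S N by fact
  have "h (lincomb M n u x) = finsum N (\<lambda>j. h (x j \<odot>\<^bsub>M\<^esub> u j)) {..<n}"
    unfolding lincomb_def
    by (rule linear_hom_finsum[OF h M N]) (use u x smult_closed in auto)
  also have "\<dots> = lincomb N n (\<lambda>j. h (u j)) x"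
    unfolding lincomb_def
    by (rule N.M.finsum_cong') (use u x in \<open>auto simp: linear_homD[OF h] N.smult_closed\<close>)
  finally show ?thesis .
qed

end

lemma unit_vector_closed [simp]: "ring S \<Longrightarrow> unit_vector S n j \<in> carrier (free_module S n)"
  by (auto simp: unit_vector_def ring.ring_simprules)

lemma lincomb_free_unit_vectors:
  assumes S: "ring S" and x: "x \<in> carrier (free_module S n)"
  shows "lincomb (free_module S n) n (unit_vector S n) x = x"
proof -
  have xS: "x j \<in> carrier S" if "j < n" for j using x that by auto
  let ?l = "lincomb (free_module S n) n (unit_vector S n) x"
  have l: "?l \<in> carrier (free_module S n)"
    using unit_vector_closed[OF S] xS by (intro lincomb_closed[OF left_module_free[OF S]])
  show ?thesis
  proof (rule ext)
    fix k show "?l k = x k"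
    proof (cases "k < n")
      case False then show ?thesis using l x by (auto simp: PiE_iff extensional_def)
    next
      case k: True
      have p: "(\<lambda>y. y k) \<in> linear_hom S (free_module S n) (regular_module S)"
        using k by (intro linear_homI) auto
      interpret G: left_module S "regular_module S" using S by (rule left_module_regular)
      have "?l k = lincomb (regular_module S) n (\<lambda>j. unit_vector S n j k) x"
        using unit_vector_closed[OF S] xS
        by (intro linear_hom_lincomb[OF left_module_free[OF S] G.left_module_axioms p])
      also have "\<dots> = finsum (regular_module S) (\<lambda>j. if k = j then x j else \<zero>\<^bsub>regular_module S\<^esub>) {..<n}"
        unfolding lincomb_def using k xS ring.ring_simprules[OF S]
        by (intro G.M.finsum_cong') (auto simp: unit_vector_def)
      also have "\<dots> = x k" using k xS by (intro G.M.finsum_singleton) auto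
      finally show ?thesis .
    qed
  qed
qed

lemma linear_hom_free:
  assumes S: "ring S" and M: "left_module S M" and h: "h \<in> linear_hom S (free_module S n) M"
    and x: "x \<in> carrier (free_module S n)"
  shows "h x = lincomb M n (\<lambda>j. h (unit_vector S n j)) x"
proof -
  have "h (lincomb (free_module S n) n (unit_vector S n) x) = lincomb M n (\<lambda>j. h (unit_vector S n j)) x"
    using unit_vector_closed[OF S] x by (intro linear_hom_lincomb[OF left_module_free[OF S] M h]) auto
  then show ?thesis using lincomb_free_unit_vectors[OF S x] by simp
qed

lemma submoduleI':
  assumes M: "left_module S M" and "H \<subseteq> carrier M" "\<zero>\<^bsub>M\<^esub> \<in> H"
    and "\<And>x y. x \<in> H \<Longrightarrow> y \<in> H \<Longrightarrow> x \<oplus>\<^bsub>M\<^esub> y \<in> H" "\<And>x. x \<in> H \<Longrightarrow> \<ominus>\<^bsub>M\<^esub> x \<in> H"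
    and "\<And>a x. a \<in> carrier S \<Longrightarrow> x \<in> H \<Longrightarrow> a \<odot>\<^bsub>M\<^esub> x \<in> H"
  shows "submodule H S M"
  using assms by (intro submodule.intro submodule_axioms.intro subgroup.intro) (auto simp: a_inv_def)

lemma submodule_image:
  assumes M: "left_module S M" and N: "left_module S N" and f: "f \<in> linear_hom S M N"
  shows "submodule (f ` carrier M) S N"
proof -
  interpret M: left_module S M by fact
  show ?thesis
  proof (rule submoduleI'[OF N])
    show "\<zero>\<^bsub>N\<^esub> \<in> f ` carrier M" using linear_hom_zero[OF f M N] by (metis M.M.zero_closed imageI)
    show "x \<oplus>\<^bsub>N\<^esub> y \<in> f ` carrier M" if "x \<in> f ` carrier M" "y \<in> f ` carrier M" for x y
      using that linear_homD(2)[OF f, symmetric] by auto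
    show "\<ominus>\<^bsub>N\<^esub> x \<in> f ` carrier M" if "x \<in> f ` carrier M" for x
      using that linear_hom_minus[OF f M N, symmetric] by auto
    show "a \<odot>\<^bsub>N\<^esub> x \<in> f ` carrier M" if "a \<in> carrier S" "x \<in> f ` carrier M" for a x
      using that linear_homD(3)[OF f, symmetric] M.smult_closed by auto
  qed (use linear_homD(1)[OF f] in auto)
qed

context
  fixes S :: "'r ring" and M :: "('r, 'm) module" and K :: "'m set"
  assumes M: "left_module S M" and K: "submodule K S M"
begin

interpretation left_module S M by (rule M)
interpretation K: submodule K S M by (rule K)

lemma abelian_subgroup_submodule: "abelian_subgroup K M"
  by (rule abelian_subgroupI3, rule additive_subgroupI) (unfold_locales)

interpretation A: abelian_subgroup K M by (rule abelian_subgroup_submodule)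

lemma quotient_carrier: "carrier (quotient_module M K) = (\<lambda>x. K +>\<^bsub>M\<^esub> x) ` carrier M"
  by (auto simp: quotient_module_def A_RCOSETS_def')

lemma quotient_zero: "\<zero>\<^bsub>quotient_module M K\<^esub> = K +>\<^bsub>M\<^esub> \<zero>\<^bsub>M\<^esub>"
  using M.a_coset_add_zero[OF A.a_subset] by (simp add: quotient_module_def)

lemma quotient_add:
  "x \<in> carrier M \<Longrightarrow> y \<in> carrier M \<Longrightarrow>
    (K +>\<^bsub>M\<^esub> x) \<oplus>\<^bsub>quotient_module M K\<^esub> (K +>\<^bsub>M\<^esub> y) = K +>\<^bsub>M\<^esub> (x \<oplus>\<^bsub>M\<^esub> y)"
  using A.a_rcos_sum by (simp add: quotient_module_def)

lemma coset_eq_iff: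
  assumes "x \<in> carrier M" "y \<in> carrier M"
  shows "K +>\<^bsub>M\<^esub> x = K +>\<^bsub>M\<^esub> y \<longleftrightarrow> x \<ominus>\<^bsub>M\<^esub> y \<in> K"
proof
  assume "K +>\<^bsub>M\<^esub> x = K +>\<^bsub>M\<^esub> y"
  then have "K +>\<^bsub>M\<^esub> (x \<ominus>\<^bsub>M\<^esub> y) = K"
    using M.a_coset_add_inv2[of K x y] assms A.a_subset by (simp add: a_minus_def)
  then show "x \<ominus>\<^bsub>M\<^esub> y \<in> K"
    using M.a_coset_join1[of K] assms A.a_subgroup by auto
next
  assume "x \<ominus>\<^bsub>M\<^esub> y \<in> K"
  then have "K +>\<^bsub>M\<^esub> (x \<ominus>\<^bsub>M\<^esub> y) = K"
    using M.a_coset_join2[of _ K] assms A.a_subgroup by auto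
  then show "K +>\<^bsub>M\<^esub> x = K +>\<^bsub>M\<^esub> y"
    using M.a_coset_add_inv1[of K x y] assms A.a_subset by (simp add: a_minus_def)
qed

lemma quotient_smult:
  assumes a: "a \<in> carrier S" and x: "x \<in> carrier M"
  shows "a \<odot>\<^bsub>quotient_module M K\<^esub> (K +>\<^bsub>M\<^esub> x) = K +>\<^bsub>M\<^esub> (a \<odot>\<^bsub>M\<^esub> x)"
proof -
  have "K +>\<^bsub>M\<^esub> (a \<odot>\<^bsub>M\<^esub> y) = K +>\<^bsub>M\<^esub> (a \<odot>\<^bsub>M\<^esub> x)" if y: "y \<in> K +>\<^bsub>M\<^esub> x" for y
  proof -
    obtain k where k: "k \<in> K" "y = k \<oplus>\<^bsub>M\<^esub> x" using y by (auto simp: a_r_coset_def')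
    have kM: "k \<in> carrier M" using k(1) A.a_subset by auto
    have "(a \<odot>\<^bsub>M\<^esub> y) \<ominus>\<^bsub>M\<^esub> (a \<odot>\<^bsub>M\<^esub> x) = a \<odot>\<^bsub>M\<^esub> k"
      using a x kM by (simp add: k smult_r_distr a_minus_def M.a_assoc M.r_neg smult_closed)
    then show ?thesis using a x k kM K.smult_closed
      by (subst coset_eq_iff) (simp_all add: smult_closed)
  qed
  then have "(\<Union>y\<in>K +>\<^bsub>M\<^esub> x. K +>\<^bsub>M\<^esub> (a \<odot>\<^bsub>M\<^esub> y)) = K +>\<^bsub>M\<^esub> (a \<odot>\<^bsub>M\<^esub> x)"
    by (rule UN_constant_eq[OF A.a_rcos_self[OF x], OF ballI])
  then show ?thesis by (simp add: quotient_module_def)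
qed

lemma left_module_quotient: "left_module S (quotient_module M K)"
proof (rule left_moduleI)
  show "ring S" by unfold_locales
  show "abelian_group (quotient_module M K)"
  proof (rule abelian_groupI)
    fix X assume "X \<in> carrier (quotient_module M K)"
    then obtain x where x: "x \<in> carrier M" "X = K +>\<^bsub>M\<^esub> x" by (auto simp: quotient_carrier)
    then show "\<exists>Y\<in>carrier (quotient_module M K). Y \<oplus>\<^bsub>quotient_module M K\<^esub> X = \<zero>\<^bsub>quotient_module M K\<^esub>"
      by (intro bexI[of _ "K +>\<^bsub>M\<^esub> (\<ominus>\<^bsub>M\<^esub> x)"])
        (auto simp: quotient_add quotient_zero quotient_carrier M.l_neg)
  qed (auto simp: quotient_add quotient_zero quotient_carrier M.a_ac)
qed (auto simp: quotient_add quotient_smult quotient_carrier smult_closed smult_l_distr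
    smult_r_distr smult_assoc smult_one)

lemma coset_linear: "(\<lambda>x. K +>\<^bsub>M\<^esub> x) \<in> linear_hom S M (quotient_module M K)"
  by (rule linear_homI) (auto simp: quotient_carrier quotient_add quotient_smult)

lemma coset_eq_zero_iff:
  "x \<in> carrier M \<Longrightarrow> K +>\<^bsub>M\<^esub> x = \<zero>\<^bsub>quotient_module M K\<^esub> \<longleftrightarrow> x \<in> K"
  using M.a_coset_join1[of K x] M.a_coset_join2[of x K] A.a_subgroup
  by (auto simp: quotient_module_def)

end

lemma factor_through_surjection:
  assumes L: "left_module S L" and M: "left_module S M" and N: "left_module S N"
    and p: "p \<in> linear_hom S L M" "p ` carrier L = carrier M"
    and h: "h \<in> linear_hom S L N"
    and ker: "\<And>x. x \<in> carrier L \<Longrightarrow> p x = \<zero>\<^bsub>M\<^esub> \<Longrightarrow> h x = \<zero>\<^bsub>N\<^esub>"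
  shows "\<exists>k\<in>linear_hom S M N. \<forall>x\<in>carrier L. k (p x) = h x"
proof -
  interpret L: left_module S L by fact
  interpret M: left_module S M by fact
  interpret N: left_module S N by fact
  define s where "s y = (SOME x. x \<in> carrier L \<and> p x = y)" for y
  have s: "s y \<in> carrier L \<and> p (s y) = y" if "y \<in> carrier M" for y
    unfolding s_def by (rule someI_ex) (use that in \<open>auto simp: p(2)[symmetric]\<close>)
  have eq: "h x = h x'" if "x \<in> carrier L" "x' \<in> carrier L" "p x = p x'" for x x'
  proof -
    have "p (x \<oplus>\<^bsub>L\<^esub> \<ominus>\<^bsub>L\<^esub> x') = \<zero>\<^bsub>M\<^esub>"
      using that linear_homD(1)[OF p(1)]
      by (simp add: linear_homD[OF p(1)] linear_hom_minus[OF p(1) L M] M.M.r_neg)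
    then have "h (x \<oplus>\<^bsub>L\<^esub> \<ominus>\<^bsub>L\<^esub> x') = \<zero>\<^bsub>N\<^esub>" using ker that by auto
    then have "h x \<oplus>\<^bsub>N\<^esub> \<ominus>\<^bsub>N\<^esub> h x' = \<zero>\<^bsub>N\<^esub>"
      using that by (simp add: linear_homD[OF h] linear_hom_minus[OF h L N])
    moreover have "h x \<in> carrier N" "h x' \<in> carrier N"
      using linear_homD(1)[OF h that(1)] linear_homD(1)[OF h that(2)] .
    ultimately have "\<ominus>\<^bsub>N\<^esub> (\<ominus>\<^bsub>N\<^esub> h x') = h x"
      by (intro N.M.minus_equality N.M.a_inv_closed)
    then show ?thesis using N.M.minus_minus[OF \<open>h x' \<in> carrier N\<close>] by simp
  qed
  have k: "h (s (p x)) = h x" if "x \<in> carrier L" for x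
    using s[OF linear_homD(1)[OF p(1) that]] that by (intro eq) simp_all
  have "(\<lambda>y. h (s y)) \<in> linear_hom S M N"
  proof (rule linear_homI)
    show "h (s y) \<in> carrier N" if "y \<in> carrier M" for y using s that linear_homD(1)[OF h] by auto
    show "h (s (x \<oplus>\<^bsub>M\<^esub> y)) = h (s x) \<oplus>\<^bsub>N\<^esub> h (s y)" if "x \<in> carrier M" "y \<in> carrier M" for x y
      using k[of "s x \<oplus>\<^bsub>L\<^esub> s y"] s that by (simp add: linear_homD[OF h] linear_homD[OF p(1)])
    show "h (s (a \<odot>\<^bsub>M\<^esub> x)) = a \<odot>\<^bsub>N\<^esub> h (s x)" if "a \<in> carrier S" "x \<in> carrier M" for a x
      using k[of "a \<odot>\<^bsub>L\<^esub> s x"] s that L.smult_closed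
      by (simp add: linear_homD[OF h] linear_homD[OF p(1)])
  qed
  then show ?thesis using k by (intro bexI[of _ "\<lambda>y. h (s y)"]) auto
qed

section \<open>Character modules\<close>

lemma character_module_simps [simp]:
  "carrier (character_module M) = hom (add_monoid M) QZ \<inter> extensional (carrier M)"
  "\<zero>\<^bsub>character_module M\<^esub> = (\<lambda>x\<in>carrier M. \<one>\<^bsub>QZ\<^esub>)"
  "f \<oplus>\<^bsub>character_module M\<^esub> g = (\<lambda>x\<in>carrier M. f x \<otimes>\<^bsub>QZ\<^esub> g x)"
  "a \<odot>\<^bsub>character_module M\<^esub> f = (\<lambda>x\<in>carrier M. f (a \<odot>\<^bsub>M\<^esub> x))"
  by (simp_all add: character_module_def)

lemma character_closed:
  assumes "\<chi> \<in> carrier (character_module M)" "x \<in> carrier M"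
  shows "\<chi> x \<in> carrier QZ"
  using assms by (auto simp: hom_def)

lemma character_add:
  assumes "\<chi> \<in> carrier (character_module M)" "x \<in> carrier M" "y \<in> carrier M"
  shows "\<chi> (x \<oplus>\<^bsub>M\<^esub> y) = \<chi> x \<otimes>\<^bsub>QZ\<^esub> \<chi> y"
  using assms by (auto simp: hom_def)

lemma character_moduleI:
  assumes "\<And>x. x \<in> carrier M \<Longrightarrow> \<chi> x \<in> carrier QZ"
    and "\<And>x y. x \<in> carrier M \<Longrightarrow> y \<in> carrier M \<Longrightarrow> \<chi> (x \<oplus>\<^bsub>M\<^esub> y) = \<chi> x \<otimes>\<^bsub>QZ\<^esub> \<chi> y"
    and "\<chi> \<in> extensional (carrier M)"
  shows "\<chi> \<in> carrier (character_module M)"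
  using assms by (auto simp: hom_def)

lemma character_ext:
  assumes "\<chi> \<in> carrier (character_module M)" "\<psi> \<in> carrier (character_module M)"
    and "\<And>x. x \<in> carrier M \<Longrightarrow> \<chi> x = \<psi> x"
  shows "\<chi> = \<psi>"
  using assms by (auto intro: extensionalityI)

lemma character_finsum:
  assumes "left_module S M" "\<chi> \<in> carrier (character_module M)" "u \<in> I \<rightarrow> carrier M"
  shows "\<chi> (finsum M u I) = finprod QZ (\<lambda>i. \<chi> (u i)) I"
  using finprod_hom[OF left_moduleD(3)[OF assms(1)] QZ.comm_group_axioms, of \<chi> u I] assms(2,3)
  by (simp add: finsum_def)

lemma character_zero:
  assumes "left_module S M" "\<chi> \<in> carrier (character_module M)"
  shows "\<chi> \<zero>\<^bsub>M\<^esub> = \<one>\<^bsub>QZ\<^esub>"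
  using hom_one[OF _ left_moduleD(4)[OF assms(1)] QZ.is_group, of \<chi>] assms(2) by simp

lemma left_module_character:
  assumes M: "left_module S M"
  shows "left_module (opposite_ring S) (character_module M)"
proof (rule left_moduleI)
  interpret M: left_module S M by fact
  note [simp del] = character_module_simps(1)
  note ch = character_closed character_add M.smult_closed
  show "ring (opposite_ring S)" using left_moduleD(1)[OF M] by simp
  have zero: "\<zero>\<^bsub>character_module M\<^esub> \<in> carrier (character_module M)"
    by (rule character_moduleI) auto
  have add: "\<chi> \<oplus>\<^bsub>character_module M\<^esub> \<psi> \<in> carrier (character_module M)"
    if "\<chi> \<in> carrier (character_module M)" "\<psi> \<in> carrier (character_module M)" for \<chi> \<psi>
    by (rule character_moduleI) (use that in \<open>auto simp: ch QZ.m_ac\<close>)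
  show smult: "a \<odot>\<^bsub>character_module M\<^esub> \<chi> \<in> carrier (character_module M)"
    if "a \<in> carrier (opposite_ring S)" "\<chi> \<in> carrier (character_module M)" for a \<chi>
    by (rule character_moduleI) (use that in \<open>auto simp: ch M.smult_r_distr\<close>)
  show "abelian_group (character_module M)"
  proof (rule abelian_groupI)
    fix \<chi> assume \<chi>: "\<chi> \<in> carrier (character_module M)"
    have "(\<lambda>x\<in>carrier M. inv\<^bsub>QZ\<^esub> \<chi> x) \<in> carrier (character_module M)"
      by (rule character_moduleI) (use \<chi> in \<open>auto simp: ch QZ.inv_mult\<close>)
    then show "\<exists>\<psi>\<in>carrier (character_module M). \<psi> \<oplus>\<^bsub>character_module M\<^esub> \<chi> = \<zero>\<^bsub>character_module M\<^esub>"
      by (rule bexI[rotated]) (use \<chi> in \<open>auto simp: ch QZ.l_inv intro!: restrict_ext\<close>)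
    show "\<zero>\<^bsub>character_module M\<^esub> \<oplus>\<^bsub>character_module M\<^esub> \<chi> = \<chi>"
      using \<chi> by (intro character_ext[OF add[OF zero \<chi>] \<chi>]) (auto simp: ch)
    fix \<psi> assume \<psi>: "\<psi> \<in> carrier (character_module M)"
    show "\<chi> \<oplus>\<^bsub>character_module M\<^esub> \<psi> = \<psi> \<oplus>\<^bsub>character_module M\<^esub> \<chi>"
      using \<chi> \<psi> by (auto simp: ch QZ.m_comm intro!: restrict_ext)
    fix \<omega> assume \<omega>: "\<omega> \<in> carrier (character_module M)"
    show "\<chi> \<oplus>\<^bsub>character_module M\<^esub> \<psi> \<oplus>\<^bsub>character_module M\<^esub> \<omega> =
        \<chi> \<oplus>\<^bsub>character_module M\<^esub> (\<psi> \<oplus>\<^bsub>character_module M\<^esub> \<omega>)"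
      using \<chi> \<psi> \<omega> by (auto simp: ch QZ.m_assoc intro!: restrict_ext)
  qed (use zero add in auto)
  show "\<one>\<^bsub>opposite_ring S\<^esub> \<odot>\<^bsub>character_module M\<^esub> \<chi> = \<chi>" if "\<chi> \<in> carrier (character_module M)" for \<chi>
    by (rule character_ext[OF smult that]) (use that in \<open>auto simp: M.smult_one\<close>)
  show "(a \<oplus>\<^bsub>opposite_ring S\<^esub> b) \<odot>\<^bsub>character_module M\<^esub> \<chi> =
      a \<odot>\<^bsub>character_module M\<^esub> \<chi> \<oplus>\<^bsub>character_module M\<^esub> b \<odot>\<^bsub>character_module M\<^esub> \<chi>"
    if "a \<in> carrier (opposite_ring S)" "b \<in> carrier (opposite_ring S)" "\<chi> \<in> carrier (character_module M)" for a b \<chi>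
    using that by (auto simp: ch M.smult_l_distr intro!: restrict_ext)
  show "a \<odot>\<^bsub>character_module M\<^esub> (\<chi> \<oplus>\<^bsub>character_module M\<^esub> \<psi>) =
      a \<odot>\<^bsub>character_module M\<^esub> \<chi> \<oplus>\<^bsub>character_module M\<^esub> a \<odot>\<^bsub>character_module M\<^esub> \<psi>"
    if "a \<in> carrier (opposite_ring S)" for a \<chi> \<psi>
    using that by (auto simp: ch intro!: restrict_ext)
  show "a \<otimes>\<^bsub>opposite_ring S\<^esub> b \<odot>\<^bsub>character_module M\<^esub> \<chi> =
      a \<odot>\<^bsub>character_module M\<^esub> (b \<odot>\<^bsub>character_module M\<^esub> \<chi>)"
    if "a \<in> carrier (opposite_ring S)" "b \<in> carrier (opposite_ring S)" for a b \<chi>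
    using that by (auto simp: ch M.smult_assoc intro!: restrict_ext)
qed

lemma finsum_character_apply:
  fixes S :: "'r ring"
  assumes M: "left_module S M" and "\<And>i. i \<in> I \<Longrightarrow> u i \<in> carrier (character_module M)" and x: "x \<in> carrier M"
  shows "finsum (character_module M) u I x = finprod QZ (\<lambda>i. u i x) I"
proof -
  have "(\<lambda>\<chi>. \<chi> x) \<in> hom (add_monoid (character_module M)) QZ"
    using x by (intro homI) (auto simp: hom_def)
  from finprod_hom[OF left_moduleD(3)[OF left_module_character[OF M]] QZ.comm_group_axioms this, of u I]
  show ?thesis using assms(2) by (simp add: finsum_def Pi_iff)
qed

lemma direct_summand_character:
  assumes "module_isomorphic S M N" and M: "left_module S M" and N: "left_module S N"
  shows "direct_summand (opposite_ring S) (character_module M) (character_module N)"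
proof -
  interpret M: left_module S M by fact
  interpret N: left_module S N by fact
  obtain f g where f: "f \<in> linear_hom S M N" "g \<in> linear_hom S N M" "\<And>x. x \<in> carrier M \<Longrightarrow> g (f x) = x"
    using module_isomorphic_direct_summand(1)[OF assms(1) M] by (auto simp: direct_summand_def)
  note F = linear_homD[OF f(1)] and G = linear_homD[OF f(2)]
  note [simp del] = character_module_simps(1)
  note ch = character_closed character_add M.smult_closed N.smult_closed
  have 1: "(\<lambda>\<chi>. \<lambda>y\<in>carrier N. \<chi> (g y)) \<in> linear_hom (opposite_ring S) (character_module M) (character_module N)"
    by (rule linear_homI, rule character_moduleI) (auto simp: ch G intro!: restrict_ext)
  have 2: "(\<lambda>\<chi>. \<lambda>x\<in>carrier M. \<chi> (f x)) \<in> linear_hom (opposite_ring S) (character_module N) (character_module M)"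
    by (rule linear_homI, rule character_moduleI) (auto simp: ch F intro!: restrict_ext)
  have 3: "(\<lambda>x\<in>carrier M. (\<lambda>y\<in>carrier N. \<chi> (g y)) (f x)) = \<chi>" if "\<chi> \<in> carrier (character_module M)" for \<chi>
    by (rule extensionalityI) (use that in \<open>auto simp: F f(3) character_module_simps(1)\<close>)
  show ?thesis unfolding direct_summand_def
    by (rule bexI[OF bexI[OF ballI 2] 1]) (rule 3)
qed


section \<open>Purity by systems of linear equations\<close>

text \<open>Purity of \<open>f\<close> in its equational form.  Here \<open>a\<close> is the matrix of a system with constants \<open>y\<close>;
  for short exact sequences it is equivalent to the lifting of maps from finitely presented modules
  by the two lemmas that end this section.\<close>

definition pure_embedding :: "'r ring \<Rightarrow> ('r, 'k) module \<Rightarrow> ('k \<Rightarrow> 'l) \<Rightarrow> ('r, 'l) module \<Rightarrow> bool" where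
  "pure_embedding S K f L \<longleftrightarrow>
    (\<forall>(m::nat) n a u y. (\<forall>i<m. \<forall>j<n. a i j \<in> carrier S) \<longrightarrow> (\<forall>j<n. u j \<in> carrier L) \<longrightarrow> (\<forall>i<m. y i \<in> carrier K) \<longrightarrow>
       (\<forall>i<m. lincomb L n u (a i) = f (y i)) \<longrightarrow>
       (\<exists>v. (\<forall>j<n. v j \<in> carrier K) \<and> (\<forall>i<m. lincomb K n v (a i) = y i)))"

lemma pure_embeddingD:
  fixes m n :: nat
  assumes "pure_embedding S K f L"
    and "\<And>i j. i < m \<Longrightarrow> j < n \<Longrightarrow> a i j \<in> carrier S" "\<And>j. j < n \<Longrightarrow> u j \<in> carrier L"
    and "\<And>i. i < m \<Longrightarrow> y i \<in> carrier K" "\<And>i. i < m \<Longrightarrow> lincomb L n u (a i) = f (y i)"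
  obtains v where "\<And>j. j < n \<Longrightarrow> v j \<in> carrier K" "\<And>i. i < m \<Longrightarrow> lincomb K n v (a i) = y i"
proof -
  have "\<exists>v. (\<forall>j<n. v j \<in> carrier K) \<and> (\<forall>i<m. lincomb K n v (a i) = y i)"
    using assms(1)[unfolded pure_embedding_def, rule_format, of m n a u y] assms(2-) by simp
  then show thesis using that by auto
qed

lemma lincomb_add:
  assumes M: "left_module S M" and "\<And>j. j < n \<Longrightarrow> u j \<in> carrier M" "\<And>j. j < n \<Longrightarrow> w j \<in> carrier M"
    and "\<And>j. j < n \<Longrightarrow> x j \<in> carrier S"
  shows "lincomb M n (\<lambda>j. u j \<oplus>\<^bsub>M\<^esub> w j) x = lincomb M n u x \<oplus>\<^bsub>M\<^esub> lincomb M n w x"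
proof -
  interpret left_module S M by fact
  have "lincomb M n (\<lambda>j. u j \<oplus>\<^bsub>M\<^esub> w j) x = finsum M (\<lambda>j. x j \<odot>\<^bsub>M\<^esub> u j \<oplus>\<^bsub>M\<^esub> x j \<odot>\<^bsub>M\<^esub> w j) {..<n}"
    unfolding lincomb_def by (rule M.finsum_cong') (use assms(2-) in \<open>auto simp: smult_closed smult_r_distr\<close>)
  also have "\<dots> = lincomb M n u x \<oplus>\<^bsub>M\<^esub> lincomb M n w x"
    unfolding lincomb_def by (rule M.finsum_addf) (use assms(2-) in \<open>auto simp: smult_closed\<close>)
  finally show ?thesis .
qed

lemma lincomb_cong:
  assumes M: "left_module S M" and "\<And>j. j < n \<Longrightarrow> w j \<in> carrier M" "\<And>j. j < n \<Longrightarrow> y j \<in> carrier S"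
    and "\<And>j. j < n \<Longrightarrow> u j = w j" "\<And>j. j < n \<Longrightarrow> x j = y j"
  shows "lincomb M n u x = lincomb M n w y"
proof -
  interpret left_module S M by fact
  show ?thesis unfolding lincomb_def
    by (rule M.finsum_cong') (use assms(2-) in \<open>auto simp: smult_closed\<close>)
qed

lemma lincomb_zero:
  assumes M: "left_module S M" and "\<And>j. j < n \<Longrightarrow> x j \<in> carrier S" "\<And>j. j < n \<Longrightarrow> u j = \<zero>\<^bsub>M\<^esub>"
  shows "lincomb M n u x = \<zero>\<^bsub>M\<^esub>"
proof -
  interpret left_module S M by fact
  have "lincomb M n u x = finsum M (\<lambda>j. \<zero>\<^bsub>M\<^esub>) {..<n}"
    unfolding lincomb_def by (rule M.finsum_cong') (use assms(2-) in auto)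
  then show ?thesis by simp
qed

lemma a_kernel_iff: "x \<in> a_kernel M N g \<longleftrightarrow> x \<in> carrier M \<and> g x = \<zero>\<^bsub>N\<^esub>"
  by (auto simp: a_kernel_def kernel_def)

lemma finitely_presentedI:
  assumes "left_module S P" "\<phi> \<in> linear_hom S (free_module S m) (free_module S n)"
    and "p \<in> linear_hom S (free_module S n) P" "p ` carrier (free_module S n) = carrier P"
    and "a_kernel (free_module S n) P p = \<phi> ` carrier (free_module S m)"
  shows "finitely_presented S P"
  unfolding finitely_presented_def
  by (rule conjI[OF assms(1)], rule exI[of _ m], rule exI[of _ n], rule bexI[OF _ assms(2)],
      rule bexI[OF _ assms(3)], rule conjI[OF assms(4,5)])

lemma finitely_presentedE:
  assumes "finitely_presented S P"
  obtains m n \<phi> p where "left_module S P" "\<phi> \<in> linear_hom S (free_module S m) (free_module S n)"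
    and "p \<in> linear_hom S (free_module S n) P" "p ` carrier (free_module S n) = carrier P"
    and "a_kernel (free_module S n) P p = \<phi> ` carrier (free_module S m)"
  using assms unfolding finitely_presented_def
  apply (elim conjE exE bexE)
  apply (rule that)
      apply assumption+
  done

text \<open>The coefficient matrix presents a module \<open>P\<close>.  As the constants vanish in \<open>N\<close>, a solution \<open>u\<close> in
  \<open>L\<close> gives a map \<open>P \<rightarrow> N\<close>; a lift of it to \<open>L\<close> is a solution \<open>w\<close> of the homogeneous system, and
  \<open>u - w\<close> is a solution in \<open>K\<close>.\<close>

lemma pure_exact_imp_pure_embedding:
  assumes "pure_exact S K f L g N"
  shows "pure_embedding S K f L"
  unfolding pure_embedding_def
proof (intro allI impI)
  fix m n :: nat and a :: "nat \<Rightarrow> nat \<Rightarrow> 'a" and u y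
  have ex: "short_exact S K f L g N"
    and lift: "\<And>(P :: ('a, (nat \<Rightarrow> 'a) set) module) h. finitely_presented S P \<Longrightarrow> h \<in> linear_hom S P N \<Longrightarrow>
      \<exists>h' \<in> linear_hom S P L. \<forall>x\<in>carrier P. g (h' x) = h x"
    using assms by (auto simp: pure_exact_def)
  have K: "left_module S K" and L: "left_module S L" and N: "left_module S N"
    and f: "f \<in> linear_hom S K L" and g: "g \<in> linear_hom S L N" and inj: "inj_on f (carrier K)"
    and im: "f ` carrier K = a_kernel L N g"
    using ex by (auto simp: short_exact_def)
  have S: "ring S" using K by (rule left_moduleD)
  interpret L: left_module S L by fact
  assume a: "\<forall>i<m. \<forall>j<n. a i j \<in> carrier S" and u: "\<forall>j<n. u j \<in> carrier L" and y: "\<forall>i<m. y i \<in> carrier K"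
    and eq: "\<forall>i<m. lincomb L n u (a i) = f (y i)"
  define A where "A i = restrict (a i) {..<n}" for i
  have A: "A i \<in> carrier (free_module S n)" if "i < m" for i using a that by (auto simp: A_def)
  have lc: "lincomb L n w (A i) = lincomb L n w (a i)" if "i < m" "\<And>j. j < n \<Longrightarrow> w j \<in> carrier L" for i w
    by (rule lincomb_cong[OF L]) (use a that in \<open>auto simp: A_def\<close>)
  let ?F = "free_module S n" and ?E = "free_module S m"
  have F: "left_module S ?F" and E: "left_module S ?E" using left_module_free[OF S] by auto
  define \<phi> where "\<phi> = lincomb ?F m A"
  have \<phi>: "\<phi> \<in> linear_hom S ?E ?F" unfolding \<phi>_def using A by (rule lincomb_linear[OF F])
  have \<phi>e: "\<phi> (unit_vector S m i) = A i" if "i < m" for i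
    unfolding \<phi>_def using A that by (rule lincomb_unit_vector[OF F])
  let ?H = "\<phi> ` carrier ?E"
  have H: "submodule ?H S ?F" by (rule submodule_image[OF E F \<phi>])
  let ?P = "quotient_module ?F ?H" and ?p = "\<lambda>x. ?H +>\<^bsub>?F\<^esub> x"
  have P: "left_module S ?P" by (rule left_module_quotient[OF F H])
  have p: "?p \<in> linear_hom S ?F ?P" by (rule coset_linear[OF F H])
  have psurj: "?p ` carrier ?F = carrier ?P" by (rule quotient_carrier[OF F H, symmetric])
  have pker: "?p x = \<zero>\<^bsub>?P\<^esub> \<longleftrightarrow> x \<in> ?H" if "x \<in> carrier ?F" for x
    by (rule coset_eq_zero_iff[OF F H that])
  have "a_kernel ?F ?P ?p = ?H"
    using pker linear_homD(1)[OF \<phi>] by (auto simp only: a_kernel_iff)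
  then have fp: "finitely_presented S ?P"
    using P \<phi> p psurj by (intro finitely_presentedI)
  define h0 where "h0 x = g (lincomb L n u x)" for x
  have h0: "h0 \<in> linear_hom S ?F N"
    unfolding h0_def by (rule linear_hom_comp[OF lincomb_linear[OF L] g]) (use u in simp)
  have ann: "h0 x = \<zero>\<^bsub>N\<^esub>" if x: "x \<in> carrier ?F" "?p x = \<zero>\<^bsub>?P\<^esub>" for x
  proof -
    obtain z where z: "z \<in> carrier ?E" "x = \<phi> z" using pker[OF x(1)] x(2) by auto
    have "h0 (\<phi> z) = lincomb N m (\<lambda>i. h0 (\<phi> (unit_vector S m i))) z"
      by (rule linear_hom_free[OF S N linear_hom_comp[OF \<phi> h0] z(1)])
    also have "\<dots> = \<zero>\<^bsub>N\<^esub>"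
    proof (rule lincomb_zero[OF N])
      fix i assume i: "i < m"
      have "h0 (A i) = g (f (y i))" using lc[OF i, of u] u eq i by (simp add: h0_def)
      also have "\<dots> = \<zero>\<^bsub>N\<^esub>" using im y i by (auto simp: a_kernel_iff set_eq_iff)
      finally show "h0 (\<phi> (unit_vector S m i)) = \<zero>\<^bsub>N\<^esub>" using \<phi>e[OF i] by simp
      show "z i \<in> carrier S" using z i by auto
    qed
    finally show ?thesis using z by simp
  qed
  obtain h where h: "h \<in> linear_hom S ?P N" "\<And>x. x \<in> carrier ?F \<Longrightarrow> h (?p x) = h0 x"
    using factor_through_surjection[OF F P N p psurj h0 ann] by auto
  obtain h' where h': "h' \<in> linear_hom S ?P L" "\<And>x. x \<in> carrier ?P \<Longrightarrow> g (h' x) = h x"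
    using lift[OF fp h(1)] by blast
  define w where "w j = h' (?p (unit_vector S n j))" for j
  have w: "w j \<in> carrier L" for j
    unfolding w_def by (rule linear_homD(1)[OF h'(1) linear_homD(1)[OF p unit_vector_closed[OF S]]])
  have w0: "lincomb L n w (a i) = \<zero>\<^bsub>L\<^esub>" if i: "i < m" for i
  proof -
    have "lincomb L n w (A i) = h' (?p (A i))"
      unfolding w_def by (rule linear_hom_free[OF S L linear_hom_comp[OF p h'(1)] A[OF i], symmetric])
    also have "?p (A i) = \<zero>\<^bsub>?P\<^esub>"
      using pker[OF A[OF i]] \<phi>e[OF i] unit_vector_closed[OF S] by (metis imageI)
    also have "h' \<zero>\<^bsub>?P\<^esub> = \<zero>\<^bsub>L\<^esub>" by (rule linear_hom_zero[OF h'(1) P L])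
    finally show ?thesis using lc[OF i] w by simp
  qed
  have "\<exists>v\<in>carrier K. f v = u j \<ominus>\<^bsub>L\<^esub> w j" if j: "j < n" for j
  proof -
    have e: "unit_vector S n j \<in> carrier ?F" by (rule unit_vector_closed[OF S])
    have "g (w j) = h (?p (unit_vector S n j))"
      unfolding w_def by (rule h'(2)[OF linear_homD(1)[OF p e]])
    also have "\<dots> = g (u j)"
      using h(2)[OF e] lincomb_unit_vector[OF L _ j, of u] u by (simp add: h0_def)
    finally have "g (u j \<ominus>\<^bsub>L\<^esub> w j) = \<zero>\<^bsub>N\<^esub>"
      using u j w left_moduleD(2)[OF N] linear_homD(1)[OF g]
      by (simp add: a_minus_def linear_homD[OF g] linear_hom_minus[OF g L N] abelian_group.r_neg)
    then have "u j \<ominus>\<^bsub>L\<^esub> w j \<in> f ` carrier K" using im u j w by (simp add: a_kernel_iff)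
    then show ?thesis by auto
  qed
  then obtain v where v: "\<And>j. j < n \<Longrightarrow> v j \<in> carrier K \<and> f (v j) = u j \<ominus>\<^bsub>L\<^esub> w j" by metis
  have "lincomb K n v (a i) = y i" if i: "i < m" for i
  proof -
    have fv: "f (v j) \<in> carrier L" if "j < n" for j using v[OF that] linear_homD(1)[OF f] by blast
    have ai: "a i j \<in> carrier S" if "j < n" for j using a i that by blast
    have vK: "v j \<in> carrier K" if "j < n" for j using v[OF that] by blast
    have "f (y i) = lincomb L n u (a i)" using eq i by simp
    also have "\<dots> = lincomb L n (\<lambda>j. f (v j) \<oplus>\<^bsub>L\<^esub> w j) (a i)"
      by (rule lincomb_cong[OF L])
        (use fv v w ai u in \<open>auto simp: a_minus_def L.a_assoc L.l_neg\<close>)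
    also have "\<dots> = lincomb L n (\<lambda>j. f (v j)) (a i) \<oplus>\<^bsub>L\<^esub> lincomb L n w (a i)"
      by (rule lincomb_add[OF L]) (use fv w ai in auto)
    also have "\<dots> = lincomb L n (\<lambda>j. f (v j)) (a i)"
      using w0[OF i] lincomb_closed[OF L fv ai] by simp
    also have "\<dots> = f (lincomb K n v (a i))"
      by (rule linear_hom_lincomb[OF K L f, symmetric]) (use vK ai in auto)
    finally show ?thesis
      using inj_onD[OF inj, of "lincomb K n v (a i)" "y i"] lincomb_closed[OF K vK ai] y i by simp
  qed
  then show "\<exists>v. (\<forall>j<n. v j \<in> carrier K) \<and> (\<forall>i<m. lincomb K n v (a i) = y i)"
    using v by blast
qed

text \<open>Lift the images of the generators of \<open>P\<close> arbitrarily to \<open>u\<close> in \<open>L\<close>.  The relations of \<open>P\<close> take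
  values in \<open>K\<close> on \<open>u\<close>; purity finds \<open>v\<close> in \<open>K\<close> with the same values, and \<open>u - v\<close> satisfies the
  relations.\<close>

lemma pure_embedding_imp_pure_exact:
  assumes ex: "short_exact S K f L g N" and pure: "pure_embedding S K f L"
  shows "pure_exact S K f L g N"
  unfolding pure_exact_def
proof (intro conjI allI impI ballI)
  show "short_exact S K f L g N" by fact
  fix P :: "('a, (nat \<Rightarrow> 'a) set) module" and h
  assume fp: "finitely_presented S P" and h: "h \<in> linear_hom S P N"
  have K: "left_module S K" and L: "left_module S L" and N: "left_module S N"
    and f: "f \<in> linear_hom S K L" and g: "g \<in> linear_hom S L N" and inj: "inj_on f (carrier K)"
    and im: "f ` carrier K = a_kernel L N g" and gsurj: "g ` carrier L = carrier N"
    using ex by (auto simp: short_exact_def)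
  have S: "ring S" using K by (rule left_moduleD)
  interpret L: left_module S L by fact
  obtain m n \<phi> p where P: "left_module S P"
    and \<phi>: "\<phi> \<in> linear_hom S (free_module S m) (free_module S n)"
    and p: "p \<in> linear_hom S (free_module S n) P"
    and psurj: "p ` carrier (free_module S n) = carrier P"
    and pker: "a_kernel (free_module S n) P p = \<phi> ` carrier (free_module S m)"
    using fp by (rule finitely_presentedE)
  let ?F = "free_module S n" and ?E = "free_module S m"
  have F: "left_module S ?F" and E: "left_module S ?E" using left_module_free[OF S] by auto
  define a where "a i = \<phi> (unit_vector S m i)" for i
  define e where "e j = unit_vector S n j" for j
  have e: "e j \<in> carrier ?F" for j unfolding e_def by (rule unit_vector_closed[OF S])
  have aF: "a i \<in> carrier ?F" for i
    unfolding a_def by (rule linear_homD(1)[OF \<phi> unit_vector_closed[OF S]])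
  then have ac: "a i j \<in> carrier S" if "j < n" for i j using that by auto
  have "a i \<in> a_kernel ?F P p" for i unfolding pker a_def using unit_vector_closed[OF S] by blast
  then have pa: "p (a i) = \<zero>\<^bsub>P\<^esub>" for i by (simp only: a_kernel_iff)
  have hp: "(\<lambda>x. h (p x)) \<in> linear_hom S ?F N" by (rule linear_hom_comp[OF p h])
  have "\<exists>u. u \<in> carrier L \<and> g u = h (p (e j))" for j
    using linear_homD(1)[OF hp e[of j]] unfolding gsurj[symmetric] by auto
  then obtain u where u: "\<And>j. u j \<in> carrier L" "\<And>j. g (u j) = h (p (e j))" by metis
  have "\<exists>y. y \<in> carrier K \<and> lincomb L n u (a i) = f y" for i
  proof -
    have "g (lincomb L n u (a i)) = lincomb N n (\<lambda>j. h (p (e j))) (a i)"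
      using linear_hom_lincomb[OF L N g, of n u "a i"] u ac by simp
    also have "\<dots> = h (p (a i))"
      unfolding e_def by (rule linear_hom_free[OF S N hp aF, symmetric])
    also have "\<dots> = \<zero>\<^bsub>N\<^esub>" using linear_hom_zero[OF h P N] pa by simp
    finally have "lincomb L n u (a i) \<in> a_kernel L N g"
      using lincomb_closed[OF L, of n u "a i"] u ac by (simp add: a_kernel_iff)
    then show ?thesis unfolding im[symmetric] by auto
  qed
  then obtain y where y: "\<And>i. y i \<in> carrier K" "\<And>i. lincomb L n u (a i) = f (y i)" by metis
  obtain v where v: "\<And>j. j < n \<Longrightarrow> v j \<in> carrier K" "\<And>i. i < m \<Longrightarrow> lincomb K n v (a i) = y i"
    by (rule pure_embeddingD[OF pure, of m n a u y]) (use ac u y in auto)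
  define w where "w j = u j \<ominus>\<^bsub>L\<^esub> f (v j)" for j
  have fv: "f (v j) \<in> carrier L" if "j < n" for j using v(1)[OF that] linear_homD(1)[OF f] by blast
  have w: "w j \<in> carrier L" if "j < n" for j unfolding w_def using u fv[OF that] by simp
  have w0: "lincomb L n w (a i) = \<zero>\<^bsub>L\<^esub>" if i: "i < m" for i
  proof -
    have c: "lincomb L n w (a i) \<in> carrier L" using w ac by (intro lincomb_closed[OF L]) auto
    have "f (y i) = lincomb L n (\<lambda>j. w j \<oplus>\<^bsub>L\<^esub> f (v j)) (a i)"
      unfolding y(2)[symmetric]
      by (rule lincomb_cong[OF L]) (use fv w ac u in \<open>auto simp: w_def a_minus_def L.a_assoc L.l_neg\<close>)
    also have "\<dots> = lincomb L n w (a i) \<oplus>\<^bsub>L\<^esub> lincomb L n (\<lambda>j. f (v j)) (a i)"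
      by (rule lincomb_add[OF L]) (use fv w ac in auto)
    also have "lincomb L n (\<lambda>j. f (v j)) (a i) = f (y i)"
      using linear_hom_lincomb[OF K L f, of n v "a i"] v ac i by simp
    finally have "lincomb L n w (a i) \<oplus>\<^bsub>L\<^esub> f (y i) = f (y i)" by simp
    then show ?thesis using c linear_homD(1)[OF f y(1)[of i]] by simp
  qed
  have k: "lincomb L n w \<in> linear_hom S ?F L" using w by (rule lincomb_linear[OF L])
  have ann: "lincomb L n w x = \<zero>\<^bsub>L\<^esub>" if x: "x \<in> carrier ?F" "p x = \<zero>\<^bsub>P\<^esub>" for x
  proof -
    have "x \<in> \<phi> ` carrier ?E" using x unfolding pker[symmetric] by (simp only: a_kernel_iff)
    then obtain z where z: "z \<in> carrier ?E" "x = \<phi> z" by auto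
    have "lincomb L n w (\<phi> z) = lincomb L m (\<lambda>i. lincomb L n w (\<phi> (unit_vector S m i))) z"
      by (rule linear_hom_free[OF S L linear_hom_comp[OF \<phi> k] z(1)])
    also have "\<dots> = \<zero>\<^bsub>L\<^esub>"
      by (rule lincomb_zero[OF L]) (use z w0 in \<open>auto simp: a_def\<close>)
    finally show ?thesis using z by simp
  qed
  obtain h' where h': "h' \<in> linear_hom S P L" "\<And>x. x \<in> carrier ?F \<Longrightarrow> h' (p x) = lincomb L n w x"
    using factor_through_surjection[OF F P L p psurj k ann] by auto
  have gw: "g (w j) = h (p (e j))" if "j < n" for j
  proof -
    have "f (v j) \<in> a_kernel L N g" using v(1)[OF that] unfolding im[symmetric] by auto
    then have "g (f (v j)) = \<zero>\<^bsub>N\<^esub>" by (simp only: a_kernel_iff)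
    moreover have "g (w j \<oplus>\<^bsub>L\<^esub> f (v j)) = g (u j)"
      using u fv[OF that] by (simp add: w_def a_minus_def L.a_assoc L.l_neg)
    ultimately show ?thesis
      using u w[OF that] fv[OF that] linear_homD(1)[OF g] left_moduleD(2)[OF N]
      by (simp add: linear_homD[OF g] abelian_group.axioms(1) abelian_monoid.r_zero)
  qed
  have "g (h' q) = h q" if q: "q \<in> carrier P" for q
  proof -
    obtain x where x: "x \<in> carrier ?F" "q = p x" using q unfolding psurj[symmetric] by auto
    have "g (h' q) = lincomb N n (\<lambda>j. g (w j)) x"
      using linear_hom_lincomb[OF L N g, of n w x] w x h'(2) by auto
    also have "\<dots> = lincomb N n (\<lambda>j. h (p (e j))) x"
      by (rule lincomb_cong[OF N]) (use gw x e linear_homD(1)[OF hp] in auto)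
    also have "\<dots> = h (p x)"
      unfolding e_def by (rule linear_hom_free[OF S N hp x(1), symmetric])
    finally show ?thesis using x by simp
  qed
  then show "\<exists>h'\<in>linear_hom S P L. \<forall>x\<in>carrier P. g (h' x) = h x" using h'(1) by blast
qed

section \<open>Character modules of finitely presented modules are pure injective\<close>

lemma comm_group_DirProd:
  assumes "comm_group G" "comm_group H" shows "comm_group (G \<times>\<times> H)"
proof -
  interpret G: comm_group G by fact
  interpret H: comm_group H by fact
  show ?thesis
    by (rule group.group_comm_groupI[OF DirProd_group[OF G.is_group H.is_group]])
      (auto simp: G.m_comm H.m_comm)
qed

lemma (in comm_group) character_extends_along:
  assumes "comm_group A" and \<alpha>: "\<alpha> \<in> hom A G" and \<chi>: "\<chi> \<in> hom A QZ"
    and ker: "\<And>a. a \<in> carrier A \<Longrightarrow> \<alpha> a = \<one> \<Longrightarrow> \<chi> a = \<one>\<^bsub>QZ\<^esub>"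
  shows "\<exists>\<xi>\<in>hom G QZ. \<forall>a\<in>carrier A. \<xi> (\<alpha> a) = \<chi> a"
proof -
  interpret A: comm_group A by fact
  interpret \<alpha>: group_hom A G \<alpha> using \<alpha> by unfold_locales
  interpret \<chi>: group_hom A QZ \<chi> using \<chi> by unfold_locales
  let ?B = "(\<lambda>a. (\<alpha> a, \<chi> a)) ` carrier A"
  have "partial_char G ?B"
  proof (rule partial_charI)
    show "(\<one>, \<one>\<^bsub>QZ\<^esub>) \<in> ?B" by (rule image_eqI[of _ _ "\<one>\<^bsub>A\<^esub>"]) auto
    show "(x \<otimes> y, c \<otimes>\<^bsub>QZ\<^esub> d) \<in> ?B" if xy: "(x, c) \<in> ?B" "(y, d) \<in> ?B" for x c y d
    proof -
      obtain a b where "a \<in> carrier A" "x = \<alpha> a" "c = \<chi> a" "b \<in> carrier A" "y = \<alpha> b" "d = \<chi> b"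
        using xy by auto
      then show ?thesis by (intro image_eqI[of _ _ "a \<otimes>\<^bsub>A\<^esub> b"]) auto
    qed
    show "(inv x, inv\<^bsub>QZ\<^esub> c) \<in> ?B" if x: "(x, c) \<in> ?B" for x c
    proof -
      obtain a where "a \<in> carrier A" "x = \<alpha> a" "c = \<chi> a" using x by auto
      then show ?thesis by (intro image_eqI[of _ _ "inv\<^bsub>A\<^esub> a"]) auto
    qed
    show "c = \<one>\<^bsub>QZ\<^esub>" if c: "(\<one>, c) \<in> ?B" for c
    proof -
      obtain a where "a \<in> carrier A" "\<one> = \<alpha> a" "c = \<chi> a" using c by auto
      then show ?thesis using ker by simp
    qed
  qed auto
  from partial_char_extends[OF this]
  obtain \<xi> where "\<xi> \<in> hom G QZ" and \<xi>: "\<forall>a c. (a, c) \<in> ?B \<longrightarrow> \<xi> a = c" ..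
  moreover have "\<xi> (\<alpha> a) = \<chi> a" if "a \<in> carrier A" for a
    by (rule \<xi>[rule_format]) (use that in blast)
  ultimately show ?thesis by blast
qed

text \<open>The values of \<open>h\<close> at the generators \<open>b\<close> form a character of \<open>K\<^sup>n\<close>.  It is well defined on the
  sum of \<open>K\<^sup>n\<close> and the \<open>L\<close>-combinations of the relations \<open>a\<close> when these combinations are sent to
  zero: if such a combination lies in \<open>K\<^sup>n\<close>, then by purity it is a \<open>K\<close>-combination, on which the
  character vanishes because \<open>b\<close> satisfies the relations.\<close>

lemma character_extension:
  fixes R :: "'r ring" and K :: "('r, 'k) module" and L :: "('r, 'l) module" and B :: "('r, 'b) module"
  assumes K: "right_module R K" and L: "right_module R L"
    and f: "f \<in> linear_hom (opposite_ring R) K L" and pure: "pure_embedding (opposite_ring R) K f L"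
    and B: "left_module R B" and h: "h \<in> linear_hom (opposite_ring R) K (character_module B)"
    and b: "\<And>j. j < n \<Longrightarrow> b j \<in> carrier B"
    and a: "\<And>i j. i < m \<Longrightarrow> j < n \<Longrightarrow> a i j \<in> carrier R"
    and rel: "\<And>i. i < m \<Longrightarrow> lincomb B n b (a i) = \<zero>\<^bsub>B\<^esub>"
  obtains \<xi> where "\<xi> \<in> hom (add_monoid (product_module {..<n} (\<lambda>_. L))) QZ"
    and "\<And>x. (\<And>j. j < n \<Longrightarrow> x j \<in> carrier K) \<Longrightarrow>
           \<xi> (\<lambda>j\<in>{..<n}. f (x j)) = finprod QZ (\<lambda>j. h (x j) (b j)) {..<n}"
    and "\<And>l. (\<And>i. i < m \<Longrightarrow> l i \<in> carrier L) \<Longrightarrow>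
           \<xi> (\<lambda>j\<in>{..<n}. lincomb L m l (\<lambda>i. a i j)) = \<one>\<^bsub>QZ\<^esub>"
proof -
  let ?S = "opposite_ring R"
  let ?KN = "product_module {..<n} (\<lambda>_. K)" and ?LM = "product_module {..<m} (\<lambda>_. L)"
    and ?G = "product_module {..<n} (\<lambda>_. L)"
  have S: "ring ?S" using K by (rule left_moduleD)
  have KN: "left_module ?S ?KN" and LM: "left_module ?S ?LM" and G: "left_module ?S ?G"
    using K L S by (intro left_module_product; simp)+
  interpret K: left_module ?S K by fact
  interpret L: left_module ?S L by fact
  have C: "left_module ?S (character_module B)" by (rule left_module_character[OF B])
  have hc: "h x \<in> carrier (character_module B)" if "x \<in> carrier K" for x
    using linear_homD(1)[OF h that] .
  have hb: "h x (b j) \<in> carrier QZ" if "x \<in> carrier K" "j < n" for x j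
    by (rule character_closed[OF hc b]) (use that in auto)
  have hadd: "h (x \<oplus>\<^bsub>K\<^esub> y) (b j) = h x (b j) \<otimes>\<^bsub>QZ\<^esub> h y (b j)"
    if "x \<in> carrier K" "y \<in> carrier K" "j < n" for x y j
    using linear_homD(2)[OF h that(1,2)] b[OF that(3)] by simp
  have h0: "h \<zero>\<^bsub>K\<^esub> (b j) = \<one>\<^bsub>QZ\<^esub>" if "j < n" for j
    using linear_hom_zero[OF h K C] b[OF that] by simp
  define \<beta> where "\<beta> l j = lincomb L m l (\<lambda>i. a i j)" for l j
  have \<beta>: "\<beta> l j \<in> carrier L" if "\<And>i. i < m \<Longrightarrow> l i \<in> carrier L" "j < n" for l j
    unfolding \<beta>_def by (rule lincomb_closed[OF L]) (use that a in auto)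
  define \<alpha> where "\<alpha> q = (\<lambda>j\<in>{..<n}. f (fst q j) \<oplus>\<^bsub>L\<^esub> \<beta> (snd q) j)" for q
  define \<chi> where "\<chi> x = finprod QZ (\<lambda>j. h (x j) (b j)) {..<n}" for x
  have \<chi>add: "\<chi> z = \<chi> x \<otimes>\<^bsub>QZ\<^esub> \<chi> y"
    if "\<And>j. j < n \<Longrightarrow> x j \<in> carrier K" "\<And>j. j < n \<Longrightarrow> y j \<in> carrier K"
      "\<And>j. j < n \<Longrightarrow> z j = x j \<oplus>\<^bsub>K\<^esub> y j" for x y z
  proof -
    have "\<chi> z = finprod QZ (\<lambda>j. h (x j) (b j) \<otimes>\<^bsub>QZ\<^esub> h (y j) (b j)) {..<n}"
      unfolding \<chi>_def by (rule QZ.finprod_cong') (use that hb hadd in auto)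
    also have "\<dots> = \<chi> x \<otimes>\<^bsub>QZ\<^esub> \<chi> y"
      unfolding \<chi>_def by (rule QZ.finprod_multf) (use that hb in auto)
    finally show ?thesis .
  qed
  have \<chi>c: "\<chi> x \<in> carrier QZ" if "\<And>j. j < n \<Longrightarrow> x j \<in> carrier K" for x
    unfolding \<chi>_def by (rule QZ.finprod_closed) (use that hb in auto)
  have \<chi>0: "\<chi> x = \<one>\<^bsub>QZ\<^esub>" if "\<And>j. j < n \<Longrightarrow> x j = \<zero>\<^bsub>K\<^esub>" for x
    unfolding \<chi>_def by (rule QZ.finprod_one_eqI) (use that h0 in auto)
  have \<beta>0: "\<beta> l j = \<zero>\<^bsub>L\<^esub>" if "\<And>i. i < m \<Longrightarrow> l i = \<zero>\<^bsub>L\<^esub>" "j < n" for l j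
    unfolding \<beta>_def by (rule lincomb_zero[OF L]) (use that a in auto)
  have \<beta>add: "\<beta> l'' j = \<beta> l j \<oplus>\<^bsub>L\<^esub> \<beta> l' j"
    if "\<And>i. i < m \<Longrightarrow> l i \<in> carrier L" "\<And>i. i < m \<Longrightarrow> l' i \<in> carrier L"
      "\<And>i. i < m \<Longrightarrow> l'' i = l i \<oplus>\<^bsub>L\<^esub> l' i" "j < n" for l l' l'' j
  proof -
    have "\<beta> l'' j = lincomb L m (\<lambda>i. l i \<oplus>\<^bsub>L\<^esub> l' i) (\<lambda>i. a i j)"
      unfolding \<beta>_def by (rule lincomb_cong[OF L]) (use that a in auto)
    also have "\<dots> = \<beta> l j \<oplus>\<^bsub>L\<^esub> \<beta> l' j"
      unfolding \<beta>_def by (rule lincomb_add[OF L]) (use that a in auto)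
    finally show ?thesis .
  qed
  let ?A = "add_monoid ?KN \<times>\<times> add_monoid ?LM"
  have Acar: "fst q j \<in> carrier K" "i < m \<Longrightarrow> snd q i \<in> carrier L"
    if "q \<in> carrier ?A" "j < n" for q j i
    using that by auto
  have Asnd: "snd q i \<in> carrier L" if "q \<in> carrier ?A" "i < m" for q i
    using that by auto
  have Amult: "fst (q \<otimes>\<^bsub>?A\<^esub> q') j = fst q j \<oplus>\<^bsub>K\<^esub> fst q' j" if "j < n" for q q' j
    using that by (cases q; cases q') simp
  have Amult': "snd (q \<otimes>\<^bsub>?A\<^esub> q') i = snd q i \<oplus>\<^bsub>L\<^esub> snd q' i" if "i < m" for q q' i
    using that by (cases q; cases q') simp
  have \<alpha>: "\<alpha> \<in> hom ?A (add_monoid ?G)"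
  proof (rule homI)
    fix q assume q: "q \<in> carrier ?A"
    have "f (fst q j) \<oplus>\<^bsub>L\<^esub> \<beta> (snd q) j \<in> carrier L" if "j < n" for j
      using \<beta>[OF Asnd[OF q] that] linear_homD(1)[OF f Acar(1)[OF q that]] by simp
    then show "\<alpha> q \<in> carrier (add_monoid ?G)" by (simp add: \<alpha>_def)
    fix q' assume q': "q' \<in> carrier ?A"
    have "f (fst (q \<otimes>\<^bsub>?A\<^esub> q') j) \<oplus>\<^bsub>L\<^esub> \<beta> (snd (q \<otimes>\<^bsub>?A\<^esub> q')) j =
        (f (fst q j) \<oplus>\<^bsub>L\<^esub> \<beta> (snd q) j) \<oplus>\<^bsub>L\<^esub> (f (fst q' j) \<oplus>\<^bsub>L\<^esub> \<beta> (snd q') j)"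
      if j: "j < n" for j
    proof -
      have 1: "\<beta> (snd (q \<otimes>\<^bsub>?A\<^esub> q')) j = \<beta> (snd q) j \<oplus>\<^bsub>L\<^esub> \<beta> (snd q') j"
        by (rule \<beta>add[OF Asnd[OF q] Asnd[OF q'] Amult' j])
      have 2: "f (fst (q \<otimes>\<^bsub>?A\<^esub> q') j) = f (fst q j) \<oplus>\<^bsub>L\<^esub> f (fst q' j)"
        unfolding Amult[OF j] by (rule linear_homD(2)[OF f Acar(1)[OF q j] Acar(1)[OF q' j]])
      show ?thesis unfolding 1 2
        using \<beta>[OF Asnd[OF q] j] \<beta>[OF Asnd[OF q'] j]
          linear_homD(1)[OF f Acar(1)[OF q j]] linear_homD(1)[OF f Acar(1)[OF q' j]]
        by (simp add: L.M.a_ac)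
    qed
    then show "\<alpha> (q \<otimes>\<^bsub>?A\<^esub> q') = \<alpha> q \<otimes>\<^bsub>add_monoid ?G\<^esub> \<alpha> q'"
      unfolding \<alpha>_def by (auto intro!: restrict_ext)
  qed
  have \<chi>': "(\<lambda>q. \<chi> (fst q)) \<in> hom ?A QZ"
  proof (rule homI)
    fix q assume q: "q \<in> carrier ?A"
    show "\<chi> (fst q) \<in> carrier QZ" by (rule \<chi>c[OF Acar(1)[OF q]])
    fix q' assume q': "q' \<in> carrier ?A"
    show "\<chi> (fst (q \<otimes>\<^bsub>?A\<^esub> q')) = \<chi> (fst q) \<otimes>\<^bsub>QZ\<^esub> \<chi> (fst q')"
      by (rule \<chi>add[OF Acar(1)[OF q] Acar(1)[OF q'] Amult])
  qed
  have ker: "\<chi> (fst q) = \<one>\<^bsub>QZ\<^esub>"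
    if q: "q \<in> carrier ?A" and q0: "\<alpha> q = \<one>\<^bsub>add_monoid ?G\<^esub>" for q
  proof -
    define x where "x = fst q"
    define l where "l = snd q"
    have x: "x j \<in> carrier K" if "j < n" for j unfolding x_def using Acar(1)[OF q that] .
    have l: "l i \<in> carrier L" if "i < m" for i unfolding l_def using Asnd[OF q that] .
    have eq: "lincomb L m l (\<lambda>i. a i j) = f (\<ominus>\<^bsub>K\<^esub> x j)" if j: "j < n" for j
    proof -
      have "\<alpha> q j = \<zero>\<^bsub>L\<^esub>" using q0 j by simp
      then have "f (x j) \<oplus>\<^bsub>L\<^esub> \<beta> l j = \<zero>\<^bsub>L\<^esub>" using j by (simp add: \<alpha>_def x_def l_def)
      then have "\<beta> l j \<oplus>\<^bsub>L\<^esub> f (x j) = \<zero>\<^bsub>L\<^esub>"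
        using L.M.a_comm[OF linear_homD(1)[OF f x[OF j]] \<beta>[OF l j]] by simp
      then have "\<ominus>\<^bsub>L\<^esub> f (x j) = \<beta> l j"
        by (rule L.M.minus_equality[OF _ linear_homD(1)[OF f x[OF j]] \<beta>[OF l j]])
      then show ?thesis unfolding \<beta>_def linear_hom_minus[OF f K L x[OF j]] by simp
    qed
    obtain v where v: "\<And>i. i < m \<Longrightarrow> v i \<in> carrier K"
      and vx: "\<And>j. j < n \<Longrightarrow> lincomb K m v (\<lambda>i. a i j) = \<ominus>\<^bsub>K\<^esub> x j"
      by (rule pure_embeddingD[OF pure, of n m "\<lambda>j i. a i j" l "\<lambda>j. \<ominus>\<^bsub>K\<^esub> x j"])
        (use a l x eq in auto)
    have ab: "a i j \<odot>\<^bsub>B\<^esub> b j \<in> carrier B" if "i < m" "j < n" for i j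
      using left_module.smult_closed[OF B a[OF that] b[OF that(2)]] .
    have hv: "h (v i) \<in> carrier (character_module B)" if "i < m" for i by (rule hc[OF v[OF that]])
    have hvab: "h (v i) (a i j \<odot>\<^bsub>B\<^esub> b j) \<in> carrier QZ" if "i < m" "j < n" for i j
      by (rule character_closed[OF hv ab]) (use that in auto)
    have "h (\<ominus>\<^bsub>K\<^esub> x j) (b j) = finprod QZ (\<lambda>i. h (v i) (a i j \<odot>\<^bsub>B\<^esub> b j)) {..<m}"
      if j: "j < n" for j
    proof -
      have "h (\<ominus>\<^bsub>K\<^esub> x j) = lincomb (character_module B) m (\<lambda>i. h (v i)) (\<lambda>i. a i j)"
        unfolding vx[OF j, symmetric]
        by (rule linear_hom_lincomb[OF K C h]) (use v a j in auto)
      then have "h (\<ominus>\<^bsub>K\<^esub> x j) (b j) =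
          finprod QZ (\<lambda>i. (a i j \<odot>\<^bsub>character_module B\<^esub> h (v i)) (b j)) {..<m}"
        unfolding lincomb_def
        using finsum_character_apply[OF B _ b[OF j], of "{..<m}" "\<lambda>i. a i j \<odot>\<^bsub>character_module B\<^esub> h (v i)"]
          left_module.smult_closed[OF C _ hv] a j
        by (simp del: character_module_simps)
      also have "\<dots> = finprod QZ (\<lambda>i. h (v i) (a i j \<odot>\<^bsub>B\<^esub> b j)) {..<m}"
        by (rule QZ.finprod_cong') (use b[OF j] hvab j in auto)
      finally show ?thesis .
    qed
    then have "\<chi> (\<lambda>j. \<ominus>\<^bsub>K\<^esub> x j) =
        finprod QZ (\<lambda>j. finprod QZ (\<lambda>i. h (v i) (a i j \<odot>\<^bsub>B\<^esub> b j)) {..<m}) {..<n}"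
      unfolding \<chi>_def by (intro QZ.finprod_cong') (use hvab in \<open>auto intro!: QZ.finprod_closed\<close>)
    also have "\<dots> = finprod QZ (\<lambda>i. finprod QZ (\<lambda>j. h (v i) (a i j \<odot>\<^bsub>B\<^esub> b j)) {..<n}) {..<m}"
      by (rule QZ.finprod_swap) (use hvab in auto)
    also have "\<dots> = \<one>\<^bsub>QZ\<^esub>"
    proof (rule QZ.finprod_one_eqI)
      fix i assume i: "i \<in> {..<m}"
      have "finprod QZ (\<lambda>j. h (v i) (a i j \<odot>\<^bsub>B\<^esub> b j)) {..<n} = h (v i) (lincomb B n b (a i))"
        unfolding lincomb_def by (rule character_finsum[OF B hv, symmetric]) (use i ab in auto)
      also have "\<dots> = \<one>\<^bsub>QZ\<^esub>"
        using rel character_zero[OF B hv] i by simp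
      finally show "finprod QZ (\<lambda>j. h (v i) (a i j \<odot>\<^bsub>B\<^esub> b j)) {..<n} = \<one>\<^bsub>QZ\<^esub>" .
    qed
    finally have m0: "\<chi> (\<lambda>j. \<ominus>\<^bsub>K\<^esub> x j) = \<one>\<^bsub>QZ\<^esub>" .
    have "\<chi> (\<lambda>_. \<zero>\<^bsub>K\<^esub>) = \<chi> x \<otimes>\<^bsub>QZ\<^esub> \<chi> (\<lambda>j. \<ominus>\<^bsub>K\<^esub> x j)"
      by (rule \<chi>add) (use x in \<open>auto simp: K.M.r_neg\<close>)
    then have "\<chi> (\<lambda>_. \<zero>\<^bsub>K\<^esub>) = \<chi> x"
      using m0 QZ.r_one[OF \<chi>c[of x, OF x]] by simp
    then show ?thesis using \<chi>0[of "\<lambda>_. \<zero>\<^bsub>K\<^esub>"] by (simp add: x_def)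
  qed
  have "\<exists>\<xi>\<in>hom (add_monoid ?G) QZ. \<forall>q\<in>carrier ?A. \<xi> (\<alpha> q) = \<chi> (fst q)"
    by (rule comm_group.character_extends_along[OF left_moduleD(3)[OF G] comm_group_DirProd \<alpha> \<chi>' ker])
      (use left_moduleD(3)[OF KN] left_moduleD(3)[OF LM] in auto)
  then obtain \<xi> where \<xi>: "\<xi> \<in> hom (add_monoid ?G) QZ" "\<And>q. q \<in> carrier ?A \<Longrightarrow> \<xi> (\<alpha> q) = \<chi> (fst q)"
    by auto
  show thesis
  proof (rule that[OF \<xi>(1)])
    fix x assume x: "\<And>j. j < n \<Longrightarrow> x j \<in> carrier K"
    let ?q = "(\<lambda>j\<in>{..<n}. x j, \<lambda>i\<in>{..<m}. \<zero>\<^bsub>L\<^esub>)"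
    have "\<alpha> ?q = (\<lambda>j\<in>{..<n}. f (x j))"
      unfolding \<alpha>_def
      by (rule restrict_ext) (use x \<beta>0[of "\<lambda>i\<in>{..<m}. \<zero>\<^bsub>L\<^esub>"] linear_homD(1)[OF f] in auto)
    moreover have "?q \<in> carrier ?A" using x by auto
    moreover have "\<chi> (fst ?q) = \<chi> x" unfolding \<chi>_def
      by (rule QZ.finprod_cong') (use x hb in auto)
    ultimately show "\<xi> (\<lambda>j\<in>{..<n}. f (x j)) = finprod QZ (\<lambda>j. h (x j) (b j)) {..<n}"
      using \<xi>(2)[of ?q] by (simp add: \<chi>_def)
  next
    fix l assume l: "\<And>i. i < m \<Longrightarrow> l i \<in> carrier L"
    let ?q = "(\<lambda>j\<in>{..<n}. \<zero>\<^bsub>K\<^esub>, \<lambda>i\<in>{..<m}. l i)"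
    have \<beta>l: "\<beta> (restrict l {..<m}) j = lincomb L m l (\<lambda>i. a i j)" if "j < n" for j
      unfolding \<beta>_def by (rule lincomb_cong[OF L]) (use l a that in auto)
    have "\<alpha> ?q = (\<lambda>j\<in>{..<n}. lincomb L m l (\<lambda>i. a i j))"
      unfolding \<alpha>_def
    proof (rule restrict_ext)
      fix j assume j: "j \<in> {..<n}"
      have "lincomb L m l (\<lambda>i. a i j) \<in> carrier L" by (rule lincomb_closed[OF L]) (use l a j in auto)
      then show "f (fst ?q j) \<oplus>\<^bsub>L\<^esub> \<beta> (snd ?q) j = lincomb L m l (\<lambda>i. a i j)"
        using j linear_hom_zero[OF f K L] \<beta>l[of j] by simp
    qed
    moreover have "?q \<in> carrier ?A" using l by auto
    moreover have "\<chi> (fst ?q) = \<one>\<^bsub>QZ\<^esub>" by (rule \<chi>0) simp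
    ultimately show "\<xi> (\<lambda>j\<in>{..<n}. lincomb L m l (\<lambda>i. a i j)) = \<one>\<^bsub>QZ\<^esub>"
      using \<xi>(2)[of ?q] by simp
  qed
qed


text \<open>The extended character \<open>\<xi>\<close> of \<open>L\<^sup>n\<close> defines \<open>h' l\<close> at \<open>\<Sum> x\<^sub>j b\<^sub>j\<close> as \<open>\<xi> (x\<^sub>1 l, \<dots>, x\<^sub>n l)\<close>; this
  depends only on the element of \<open>B\<close> because \<open>\<xi>\<close> vanishes on the combinations of the relations.\<close>

lemma character_module_extension:
  fixes R :: "'r ring" and K :: "('r, 'k) module" and L :: "('r, 'l) module" and B :: "('r, 'b) module"
  assumes K: "right_module R K" and L: "right_module R L"
    and f: "f \<in> linear_hom (opposite_ring R) K L" and pure: "pure_embedding (opposite_ring R) K f L"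
    and fp: "finitely_presented R B" and h: "h \<in> linear_hom (opposite_ring R) K (character_module B)"
  shows "\<exists>h'\<in>linear_hom (opposite_ring R) L (character_module B). \<forall>x\<in>carrier K. h' (f x) = h x"
proof -
  let ?S = "opposite_ring R"
  obtain m n \<phi> p where B: "left_module R B"
    and \<phi>: "\<phi> \<in> linear_hom R (free_module R m) (free_module R n)"
    and p: "p \<in> linear_hom R (free_module R n) B"
    and psurj: "p ` carrier (free_module R n) = carrier B"
    and pker: "a_kernel (free_module R n) B p = \<phi> ` carrier (free_module R m)"
    using fp by (rule finitely_presentedE)
  let ?F = "free_module R n" and ?E = "free_module R m"
  have R: "ring R" using B by (rule left_moduleD)
  have F: "left_module R ?F" and E: "left_module R ?E" using left_module_free[OF R] by auto
  interpret K: left_module ?S K by fact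
  interpret L: left_module ?S L by fact
  have C: "left_module ?S (character_module B)" by (rule left_module_character[OF B])
  define a where "a i = \<phi> (unit_vector R m i)" for i
  define b where "b j = p (unit_vector R n j)" for j
  have b: "b j \<in> carrier B" for j
    unfolding b_def by (rule linear_homD(1)[OF p unit_vector_closed[OF R]])
  have aF: "a i \<in> carrier ?F" for i
    unfolding a_def by (rule linear_homD(1)[OF \<phi> unit_vector_closed[OF R]])
  then have ac: "a i j \<in> carrier R" if "j < n" for i j using that by auto
  have px: "p x = lincomb B n b x" if "x \<in> carrier ?F" for x
    unfolding b_def by (rule linear_hom_free[OF R B p that])
  have rel: "lincomb B n b (a i) = \<zero>\<^bsub>B\<^esub>" for i
  proof -
    have "a i \<in> a_kernel ?F B p" unfolding pker a_def by (rule imageI[OF unit_vector_closed[OF R]])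
    then show ?thesis using px[OF aF] by (simp only: a_kernel_iff)
  qed
  obtain \<xi> where \<xi>: "\<xi> \<in> hom (add_monoid (product_module {..<n} (\<lambda>_. L))) QZ"
    and \<xi>f: "\<And>x. (\<And>j. j < n \<Longrightarrow> x j \<in> carrier K) \<Longrightarrow>
           \<xi> (\<lambda>j\<in>{..<n}. f (x j)) = finprod QZ (\<lambda>j. h (x j) (b j)) {..<n}"
    and \<xi>0: "\<And>l. (\<And>i. i < m \<Longrightarrow> l i \<in> carrier L) \<Longrightarrow>
           \<xi> (\<lambda>j\<in>{..<n}. lincomb L m l (\<lambda>i. a i j)) = \<one>\<^bsub>QZ\<^esub>"
    by (rule character_extension[OF K L f pure B h, of n b m a]) (use b ac rel in auto)
  have \<xi>c: "\<xi> (restrict x {..<n}) \<in> carrier QZ" if "\<And>j. j < n \<Longrightarrow> x j \<in> carrier L" for x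
    using \<xi> that by (auto simp: hom_def Pi_iff)
  have \<xi>add: "\<xi> (\<lambda>j\<in>{..<n}. x j \<oplus>\<^bsub>L\<^esub> y j) = \<xi> (restrict x {..<n}) \<otimes>\<^bsub>QZ\<^esub> \<xi> (restrict y {..<n})"
    if "\<And>j. j < n \<Longrightarrow> x j \<in> carrier L" "\<And>j. j < n \<Longrightarrow> y j \<in> carrier L" for x y
  proof -
    have "\<xi> (restrict x {..<n} \<otimes>\<^bsub>add_monoid (product_module {..<n} (\<lambda>_. L))\<^esub> restrict y {..<n}) =
        \<xi> (restrict x {..<n}) \<otimes>\<^bsub>QZ\<^esub> \<xi> (restrict y {..<n})"
      by (rule hom_mult[OF \<xi>]) (use that in auto)
    then show ?thesis by (simp cong: restrict_cong)
  qed
  define H where "H l x = \<xi> (\<lambda>j\<in>{..<n}. x j \<odot>\<^bsub>L\<^esub> l)" for l and x :: "nat \<Rightarrow> 'r"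
  have xl: "x j \<odot>\<^bsub>L\<^esub> l \<in> carrier L" if "x \<in> carrier ?F" "l \<in> carrier L" "j < n" for x l j
    using L.smult_closed[of "x j" l] that by auto
  have Hc: "H l x \<in> carrier QZ" if "x \<in> carrier ?F" "l \<in> carrier L" for l x
    unfolding H_def by (rule \<xi>c[OF xl[OF that]])
  have Hadd: "H l (x \<oplus>\<^bsub>?F\<^esub> y) = H l x \<otimes>\<^bsub>QZ\<^esub> H l y"
    if "x \<in> carrier ?F" "y \<in> carrier ?F" "l \<in> carrier L" for x y l
  proof -
    have "H l (x \<oplus>\<^bsub>?F\<^esub> y) = \<xi> (\<lambda>j\<in>{..<n}. x j \<odot>\<^bsub>L\<^esub> l \<oplus>\<^bsub>L\<^esub> y j \<odot>\<^bsub>L\<^esub> l)"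
      unfolding H_def by (rule arg_cong[where f = \<xi>], rule restrict_ext)
        (use that L.smult_l_distr in \<open>auto simp: PiE_iff\<close>)
    also have "\<dots> = H l x \<otimes>\<^bsub>QZ\<^esub> H l y"
      unfolding H_def by (rule \<xi>add[OF xl xl]) (use that in auto)
    finally show ?thesis .
  qed
  have Hadd': "H (l \<oplus>\<^bsub>L\<^esub> l') x = H l x \<otimes>\<^bsub>QZ\<^esub> H l' x"
    if "x \<in> carrier ?F" "l \<in> carrier L" "l' \<in> carrier L" for x l l'
  proof -
    have "H (l \<oplus>\<^bsub>L\<^esub> l') x = \<xi> (\<lambda>j\<in>{..<n}. x j \<odot>\<^bsub>L\<^esub> l \<oplus>\<^bsub>L\<^esub> x j \<odot>\<^bsub>L\<^esub> l')"
      unfolding H_def by (rule arg_cong[where f = \<xi>], rule restrict_ext)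
        (use that L.smult_r_distr in \<open>auto simp: PiE_iff\<close>)
    also have "\<dots> = H l x \<otimes>\<^bsub>QZ\<^esub> H l' x"
      unfolding H_def by (rule \<xi>add[OF xl xl]) (use that in auto)
    finally show ?thesis .
  qed
  have Hsmult: "H (s \<odot>\<^bsub>L\<^esub> l) x = H l (s \<odot>\<^bsub>?F\<^esub> x)"
    if "s \<in> carrier R" "x \<in> carrier ?F" "l \<in> carrier L" for s x l
    unfolding H_def
  proof (rule arg_cong[where f = \<xi>], rule restrict_ext)
    fix j assume j: "j \<in> {..<n}"
    then have "x j \<in> carrier R" using that by auto
    then show "x j \<odot>\<^bsub>L\<^esub> (s \<odot>\<^bsub>L\<^esub> l) = (s \<odot>\<^bsub>?F\<^esub> x) j \<odot>\<^bsub>L\<^esub> l"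
      using L.smult_assoc[of "x j" s l] that j by simp
  qed
  have Hker: "H l (\<phi> z) = \<one>\<^bsub>QZ\<^esub>" if z: "z \<in> carrier ?E" and l: "l \<in> carrier L" for z l
  proof -
    have zR: "z i \<in> carrier R" if "i < m" for i using z that by auto
    have "\<phi> z j \<odot>\<^bsub>L\<^esub> l = lincomb L m (\<lambda>i. z i \<odot>\<^bsub>L\<^esub> l) (\<lambda>i. a i j)" if j: "j < n" for j
    proof -
      interpret G: left_module R "regular_module R" using R by (rule left_module_regular)
      have pr: "(\<lambda>y. y j) \<in> linear_hom R ?F (regular_module R)"
        using j by (intro linear_homI) auto
      have "\<phi> z j = lincomb (regular_module R) m (\<lambda>i. a i j) z"
        unfolding a_def by (rule linear_hom_free[OF R G.left_module_axioms linear_hom_comp[OF \<phi> pr] z])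
      also have "\<dots> = finprod (add_monoid (regular_module R)) (\<lambda>i. z i \<otimes>\<^bsub>R\<^esub> a i j) {..<m}"
        by (simp add: lincomb_def finsum_def)
      finally have \<phi>z: "\<phi> z j = finprod (add_monoid (regular_module R)) (\<lambda>i. z i \<otimes>\<^bsub>R\<^esub> a i j) {..<m}" .
      have "(\<lambda>r. r \<odot>\<^bsub>L\<^esub> l) \<in> hom (add_monoid (regular_module R)) (add_monoid L)"
        using l L.smult_closed[of _ l] L.smult_l_distr[of _ _ l] by (intro homI) auto
      then have "\<phi> z j \<odot>\<^bsub>L\<^esub> l = finprod (add_monoid L) (\<lambda>i. (z i \<otimes>\<^bsub>R\<^esub> a i j) \<odot>\<^bsub>L\<^esub> l) {..<m}"
        unfolding \<phi>z
        by (rule finprod_hom[OF G.M.a_comm_group L.M.a_comm_group])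
          (use zR ac[OF j] monoid.m_closed[OF ring.is_monoid[OF R]] in auto)
      then have "\<phi> z j \<odot>\<^bsub>L\<^esub> l = finsum L (\<lambda>i. (z i \<otimes>\<^bsub>R\<^esub> a i j) \<odot>\<^bsub>L\<^esub> l) {..<m}"
        by (simp add: finsum_def)
      also have "\<dots> = lincomb L m (\<lambda>i. z i \<odot>\<^bsub>L\<^esub> l) (\<lambda>i. a i j)"
        unfolding lincomb_def
      proof (rule L.M.finsum_cong')
        show "(\<lambda>i. a i j \<odot>\<^bsub>L\<^esub> (z i \<odot>\<^bsub>L\<^esub> l)) \<in> {..<m} \<rightarrow> carrier L"
          using zR ac[OF j] l L.smult_closed by auto
        show "(z i \<otimes>\<^bsub>R\<^esub> a i j) \<odot>\<^bsub>L\<^esub> l = a i j \<odot>\<^bsub>L\<^esub> (z i \<odot>\<^bsub>L\<^esub> l)" if "i \<in> {..<m}" for i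
          using L.smult_assoc[of "a i j" "z i" l] zR[of i] ac[OF j] l that by simp
      qed simp
      finally show ?thesis .
    qed
    then have "H l (\<phi> z) = \<xi> (\<lambda>j\<in>{..<n}. lincomb L m (\<lambda>i. z i \<odot>\<^bsub>L\<^esub> l) (\<lambda>i. a i j))"
      unfolding H_def by (intro arg_cong[where f = \<xi>] restrict_ext) auto
    also have "\<dots> = \<one>\<^bsub>QZ\<^esub>"
      by (rule \<xi>0) (use zR l L.smult_closed in auto)
    finally show ?thesis .
  qed
  have Heq: "H l x = H l x'"
    if x: "x \<in> carrier ?F" "x' \<in> carrier ?F" "p x = p x'" and l: "l \<in> carrier L" for x x' l
  proof -
    interpret F: left_module R ?F by fact
    interpret B: left_module R B by fact
    have d: "x \<ominus>\<^bsub>?F\<^esub> x' \<in> carrier ?F" by (rule F.M.minus_closed[OF x(1,2)])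
    have "p (x \<ominus>\<^bsub>?F\<^esub> x') = p x \<oplus>\<^bsub>B\<^esub> \<ominus>\<^bsub>B\<^esub> p x'"
      unfolding a_minus_def linear_homD(2)[OF p x(1) F.M.a_inv_closed[OF x(2)]]
        linear_hom_minus[OF p F B x(2)] ..
    also have "\<dots> = \<zero>\<^bsub>B\<^esub>"
      unfolding x(3) by (rule B.M.r_neg[OF linear_homD(1)[OF p x(2)]])
    finally have "x \<ominus>\<^bsub>?F\<^esub> x' \<in> \<phi> ` carrier ?E" using d unfolding pker[symmetric] by (simp only: a_kernel_iff)
    then have "H l (x \<ominus>\<^bsub>?F\<^esub> x') = \<one>\<^bsub>QZ\<^esub>" using Hker l by auto
    moreover have "x \<ominus>\<^bsub>?F\<^esub> x' \<oplus>\<^bsub>?F\<^esub> x' = x"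
      using x(1,2) by (simp add: a_minus_def F.M.a_assoc F.M.l_neg del: free_module_simps)
    then have "H l x = H l (x \<ominus>\<^bsub>?F\<^esub> x') \<otimes>\<^bsub>QZ\<^esub> H l x'"
      using Hadd[OF d x(2) l] by simp
    ultimately show ?thesis using Hc[OF x(2) l] by simp
  qed
  define s where "s y = (SOME x. x \<in> carrier ?F \<and> p x = y)" for y
  have s: "s y \<in> carrier ?F" "p (s y) = y" if "y \<in> carrier B" for y
  proof -
    have "\<exists>x. x \<in> carrier ?F \<and> p x = y" using that unfolding psurj[symmetric] by auto
    then have "s y \<in> carrier ?F \<and> p (s y) = y" unfolding s_def by (rule someI_ex)
    then show "s y \<in> carrier ?F" "p (s y) = y" by auto
  qed
  define h' where "h' l = (\<lambda>y\<in>carrier B. H l (s y))" for l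
  have h'p: "h' l (p x) = H l x" if "x \<in> carrier ?F" "l \<in> carrier L" for l x
  proof -
    have px: "p x \<in> carrier B" by (rule linear_homD(1)[OF p that(1)])
    show ?thesis unfolding h'_def using Heq[OF s(1)[OF px] that(1) s(2)[OF px] that(2)] px by simp
  qed
  have Bp: "\<exists>x\<in>carrier ?F. y = p x" if "y \<in> carrier B" for y
    using s[OF that] by (intro bexI[of _ "s y"]) auto
  have h'c: "h' l \<in> carrier (character_module B)" if l: "l \<in> carrier L" for l
  proof (rule character_moduleI)
    show "h' l y \<in> carrier QZ" if "y \<in> carrier B" for y
      using Bp[OF that] h'p[OF _ l] Hc[OF _ l] by auto
    show "h' l (y \<oplus>\<^bsub>B\<^esub> z) = h' l y \<otimes>\<^bsub>QZ\<^esub> h' l z" if yz: "y \<in> carrier B" "z \<in> carrier B" for y z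
    proof -
      obtain x x' where x: "x \<in> carrier ?F" "y = p x" "x' \<in> carrier ?F" "z = p x'"
        using Bp[OF yz(1)] Bp[OF yz(2)] by auto
      have "h' l (p (x \<oplus>\<^bsub>?F\<^esub> x')) = H l (x \<oplus>\<^bsub>?F\<^esub> x')"
        by (rule h'p[OF abelian_monoid.a_closed[OF abelian_group.axioms(1)[OF left_moduleD(2)[OF F]] x(1,3)] l])
      then show ?thesis
        unfolding linear_homD(2)[OF p x(1,3)] Hadd[OF x(1,3) l] x(2,4) h'p[OF x(1) l] h'p[OF x(3) l] .
    qed
    show "h' l \<in> extensional (carrier B)" by (simp add: h'_def)
  qed
  have "h' \<in> linear_hom ?S L (character_module B)"
  proof (rule linear_homI)
    show "h' l \<in> carrier (character_module B)" if "l \<in> carrier L" for l using that by (rule h'c)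
    show "h' (l \<oplus>\<^bsub>L\<^esub> l') = h' l \<oplus>\<^bsub>character_module B\<^esub> h' l'"
      if "l \<in> carrier L" "l' \<in> carrier L" for l l'
      using that s Hadd' by (auto simp: h'_def intro!: restrict_ext)
    show "h' (t \<odot>\<^bsub>L\<^esub> l) = t \<odot>\<^bsub>character_module B\<^esub> h' l"
      if t: "t \<in> carrier ?S" and l: "l \<in> carrier L" for t l
    proof (rule character_ext[OF h'c])
      show "t \<odot>\<^bsub>L\<^esub> l \<in> carrier L" by (rule L.smult_closed[OF t l])
      show "t \<odot>\<^bsub>character_module B\<^esub> h' l \<in> carrier (character_module B)"
        by (rule left_module.smult_closed[OF C t h'c[OF l]])
      fix y assume y: "y \<in> carrier B"
      have tR: "t \<in> carrier R" using t by simp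
      have tx: "t \<odot>\<^bsub>?F\<^esub> s y \<in> carrier ?F" by (rule left_module.smult_closed[OF F tR s(1)[OF y]])
      have "h' (t \<odot>\<^bsub>L\<^esub> l) y = H l (t \<odot>\<^bsub>?F\<^esub> s y)"
        using y Hsmult[OF tR s(1)[OF y] l] by (simp add: h'_def)
      also have "\<dots> = h' l (p (t \<odot>\<^bsub>?F\<^esub> s y))" by (rule h'p[OF tx l, symmetric])
      also have "p (t \<odot>\<^bsub>?F\<^esub> s y) = t \<odot>\<^bsub>B\<^esub> y"
        using linear_homD(3)[OF p tR s(1)[OF y]] s(2)[OF y] by simp
      finally show "h' (t \<odot>\<^bsub>L\<^esub> l) y = (t \<odot>\<^bsub>character_module B\<^esub> h' l) y" using y by simp
    qed
  qed
  moreover have "h' (f k) = h k" if k: "k \<in> carrier K" for k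
  proof (rule character_ext[OF h'c])
    show fk: "f k \<in> carrier L" by (rule linear_homD(1)[OF f k])
    show hk: "h k \<in> carrier (character_module B)" by (rule linear_homD(1)[OF h k])
    fix y assume y: "y \<in> carrier B"
    obtain x where x: "x \<in> carrier ?F" "y = p x" using Bp[OF y] by auto
    have xR: "x j \<in> carrier R" if "j < n" for j using x that by auto
    have xk: "x j \<odot>\<^bsub>K\<^esub> k \<in> carrier K" if "j < n" for j
      using K.smult_closed[of "x j" k] xR[OF that] k by simp
    have xb: "x j \<odot>\<^bsub>B\<^esub> b j \<in> carrier B" if "j < n" for j
      by (rule left_module.smult_closed[OF B xR[OF that] b])
    have "h' (f k) y = H (f k) x" unfolding x(2) by (rule h'p[OF x(1) fk])
    also have "\<dots> = \<xi> (\<lambda>j\<in>{..<n}. f (x j \<odot>\<^bsub>K\<^esub> k))"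
      unfolding H_def
      by (rule arg_cong[where f = \<xi>], rule restrict_ext) (use linear_homD(3)[OF f _ k] xR in auto)
    also have "\<dots> = finprod QZ (\<lambda>j. h (x j \<odot>\<^bsub>K\<^esub> k) (b j)) {..<n}"
      by (rule \<xi>f[OF xk])
    also have "\<dots> = finprod QZ (\<lambda>j. h k (x j \<odot>\<^bsub>B\<^esub> b j)) {..<n}"
    proof (rule QZ.finprod_cong')
      show "(\<lambda>j. h k (x j \<odot>\<^bsub>B\<^esub> b j)) \<in> {..<n} \<rightarrow> carrier QZ"
        using character_closed[OF hk xb] by auto
      show "h (x j \<odot>\<^bsub>K\<^esub> k) (b j) = h k (x j \<odot>\<^bsub>B\<^esub> b j)" if "j \<in> {..<n}" for j
        using linear_homD(3)[OF h _ k, of "x j"] xR[of j] that b by simp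
    qed simp
    also have "\<dots> = h k (lincomb B n b x)"
      unfolding lincomb_def by (rule character_finsum[OF B hk, symmetric]) (use xb in auto)
    also have "\<dots> = h k y" using px[OF x(1)] x(2) by simp
    finally show "h' (f k) y = h k y" .
  qed
  ultimately show ?thesis by blast
qed


section \<open>A module is pure in its double character module\<close>

definition evaluation :: "('r, 'm) module \<Rightarrow> 'm \<Rightarrow> ('m \<Rightarrow> rat set) \<Rightarrow> rat set" where
  "evaluation M x = (\<lambda>\<chi>\<in>carrier (character_module M). \<chi> x)"

lemma evaluation_linear:
  fixes S :: "'r ring" and M :: "('r, 'm) module"
  assumes M: "left_module S M"
  shows "evaluation M \<in> linear_hom S M (character_module (character_module M))"
proof (rule linear_homI)
  interpret left_module S M by fact
  note [simp del] = character_module_simps(1)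
  have C: "left_module (opposite_ring S) (character_module M)" by (rule left_module_character[OF M])
  show c: "evaluation M x \<in> carrier (character_module (character_module M))" if x: "x \<in> carrier M" for x
  proof (rule character_moduleI)
    show "evaluation M x \<chi> \<in> carrier QZ" if "\<chi> \<in> carrier (character_module M)" for \<chi>
      using character_closed[OF that x] that by (simp add: evaluation_def)
    show "evaluation M x (\<chi> \<oplus>\<^bsub>character_module M\<^esub> \<psi>) = evaluation M x \<chi> \<otimes>\<^bsub>QZ\<^esub> evaluation M x \<psi>"
      if "\<chi> \<in> carrier (character_module M)" "\<psi> \<in> carrier (character_module M)" for \<chi> \<psi>
      using that x abelian_monoid.a_closed[OF abelian_group.axioms(1)[OF left_moduleD(2)[OF C]] that]
      by (simp add: evaluation_def)
    show "evaluation M x \<in> extensional (carrier (character_module M))" by (simp add: evaluation_def)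
  qed
  show "evaluation M (x \<oplus>\<^bsub>M\<^esub> y) =
      evaluation M x \<oplus>\<^bsub>character_module (character_module M)\<^esub> evaluation M y"
    if "x \<in> carrier M" "y \<in> carrier M" for x y
    using that by (auto simp: evaluation_def character_add intro!: restrict_ext)
  show "evaluation M (a \<odot>\<^bsub>M\<^esub> x) = a \<odot>\<^bsub>character_module (character_module M)\<^esub> evaluation M x"
    if "a \<in> carrier S" "x \<in> carrier M" for a x
    using that left_module.smult_closed[OF C, of a]
    by (auto simp: evaluation_def intro!: restrict_ext)
qed


lemma product_finite_decomposition:
  fixes S :: "'r ring" and M :: "('r, 'm) module" and m :: nat
  assumes M: "left_module S M" and z: "z \<in> carrier (product_module {..<m} (\<lambda>_. M))"
    and \<xi>: "\<xi> \<in> hom (add_monoid (product_module {..<m} (\<lambda>_. M))) QZ"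
  shows "\<xi> z = finprod QZ (\<lambda>i. \<xi> (\<lambda>k\<in>{..<m}. if k = i then z i else \<zero>\<^bsub>M\<^esub>)) {..<m}"
proof -
  interpret M: left_module S M by fact
  let ?P = "product_module {..<m} (\<lambda>_. M)"
  define e where "e i = (\<lambda>k\<in>{..<m}. if k = i then z i else \<zero>\<^bsub>M\<^esub>)" for i
  have P: "left_module S ?P" using left_moduleD(1)[OF M] M by (rule left_module_product)
  have zM: "z i \<in> carrier M" if "i < m" for i using z that by auto
  have e: "e i \<in> carrier ?P" if "i \<in> {..<m}" for i using zM that by (auto simp: e_def)
  have sum: "finsum ?P e {..<m} \<in> carrier ?P"
    using e by (intro abelian_monoid.finsum_closed[OF abelian_group.axioms(1)[OF left_moduleD(2)[OF P]]]) auto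
  have "z k = finsum ?P e {..<m} k" for k
  proof (cases "k < m")
    case False
    have "x k = undefined" if "x \<in> carrier ?P" for x using that False by (auto simp: PiE_iff extensional_def)
    then show ?thesis using z sum by metis
  next
    case True
    have "(\<lambda>x. x k) \<in> linear_hom S ?P M" using True by (intro linear_homI) auto
    from linear_hom_finsum[OF this P M, of e "{..<m}"]
    have "finsum ?P e {..<m} k = finsum M (\<lambda>i. e i k) {..<m}" using e by auto
    also have "\<dots> = finsum M (\<lambda>i. if k = i then z i else \<zero>\<^bsub>M\<^esub>) {..<m}"
      by (rule M.M.finsum_cong') (use True zM in \<open>auto simp: e_def\<close>)
    also have "\<dots> = z k" by (rule M.M.finsum_singleton) (use True zM in auto)
    finally show ?thesis by simp
  qed
  then have "\<xi> z = \<xi> (finsum ?P e {..<m})" by (metis ext)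
  also have "\<dots> = finprod QZ (\<lambda>i. \<xi> (e i)) {..<m}"
    unfolding finsum_def
    by (rule finprod_hom[OF left_moduleD(3)[OF P] QZ.comm_group_axioms \<xi>]) (use e in auto)
  finally show ?thesis unfolding e_def .
qed

text \<open>Suppose that a system over \<open>M\<close> is solvable in the double character module but that its constants
  \<open>y\<close> are outside the group of right hand sides that are solvable in \<open>M\<close>.  Separate them from that
  group by a character, with components \<open>X i\<close>.  That it vanishes on the group is a linear relation among
  the \<open>X i\<close> in the character module of \<open>M\<close>; applying the solution \<open>u\<close> to this relation shows that
  the character vanishes at \<open>y\<close> too.\<close>

lemma pure_embedding_evaluation:
  fixes S :: "'r ring" and M :: "('r, 'm) module"
  assumes M: "left_module S M"
  shows "pure_embedding S M (evaluation M) (character_module (character_module M))"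
  unfolding pure_embedding_def
proof (intro allI impI)
  interpret M: left_module S M by fact
  let ?C = "character_module M" and ?D = "character_module (character_module M)"
  fix m n :: nat and a u y
  assume a: "\<forall>i<m. \<forall>j<n. a i j \<in> carrier S" and u: "\<forall>j<n. u j \<in> carrier ?D"
    and y: "\<forall>i<m. y i \<in> carrier M" and eq: "\<forall>i<m. lincomb ?D n u (a i) = evaluation M (y i)"
  have C: "left_module (opposite_ring S) ?C" by (rule left_module_character[OF M])
  have D: "left_module S ?D" using left_module_character[OF C] by simp
  have S: "ring S" using M by (rule left_moduleD)
  let ?G = "product_module {..<m} (\<lambda>_. M)" and ?N = "product_module {..<n} (\<lambda>_. M)"
  have G: "left_module S ?G" and N: "left_module S ?N"
    using M S by (auto intro!: left_module_product)
  define \<alpha> where "\<alpha> v = (\<lambda>i\<in>{..<m}. lincomb M n v (a i))" for v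
  have ac: "a i j \<in> carrier S" if "i < m" "j < n" for i j using a that by blast
  have \<alpha>: "\<alpha> \<in> hom (add_monoid ?N) (add_monoid ?G)"
  proof (rule homI)
    fix v assume v: "v \<in> carrier (add_monoid ?N)"
    have vc: "v j \<in> carrier M" if "j < n" for j using v that by auto
    show "\<alpha> v \<in> carrier (add_monoid ?G)"
      using lincomb_closed[OF M vc ac] by (auto simp: \<alpha>_def)
    fix w assume w: "w \<in> carrier (add_monoid ?N)"
    have wc: "w j \<in> carrier M" if "j < n" for j using w that by auto
    have "lincomb M n (\<lambda>j\<in>{..<n}. v j \<oplus>\<^bsub>M\<^esub> w j) (a i) = lincomb M n v (a i) \<oplus>\<^bsub>M\<^esub> lincomb M n w (a i)"
      if i: "i < m" for i
    proof -
      have "lincomb M n (\<lambda>j\<in>{..<n}. v j \<oplus>\<^bsub>M\<^esub> w j) (a i) = lincomb M n (\<lambda>j. v j \<oplus>\<^bsub>M\<^esub> w j) (a i)"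
        by (rule lincomb_cong[OF M]) (use vc wc ac i in auto)
      also have "\<dots> = lincomb M n v (a i) \<oplus>\<^bsub>M\<^esub> lincomb M n w (a i)"
        by (rule lincomb_add[OF M]) (use vc wc ac i in auto)
      finally show ?thesis .
    qed
    then show "\<alpha> (v \<otimes>\<^bsub>add_monoid ?N\<^esub> w) = \<alpha> v \<otimes>\<^bsub>add_monoid ?G\<^esub> \<alpha> w"
      by (auto simp: \<alpha>_def intro!: restrict_ext)
  qed
  interpret \<alpha>: group_hom "add_monoid ?N" "add_monoid ?G" \<alpha>
    using \<alpha> left_moduleD(4)[OF N] left_moduleD(4)[OF G] by (simp add: group_hom_def group_hom_axioms_def)
  let ?y = "\<lambda>i\<in>{..<m}. y i"
  have yG: "?y \<in> carrier ?G" using y by auto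
  have "?y \<in> \<alpha> ` carrier ?N"
  proof (rule ccontr)
    assume "?y \<notin> \<alpha> ` carrier ?N"
    then obtain \<xi> where \<xi>: "\<xi> \<in> hom (add_monoid ?G) QZ"
      and \<xi>\<alpha>: "\<And>x. x \<in> \<alpha> ` carrier ?N \<Longrightarrow> \<xi> x = \<one>\<^bsub>QZ\<^esub>" and \<xi>y: "\<xi> ?y \<noteq> \<one>\<^bsub>QZ\<^esub>"
      using comm_group.characters_separate[OF left_moduleD(3)[OF G] \<alpha>.img_is_subgroup, of ?y] yG
      by (auto simp del: product_module_simps)
    define X where "X i = (\<lambda>e\<in>carrier M. \<xi> (\<lambda>k\<in>{..<m}. if k = i then e else \<zero>\<^bsub>M\<^esub>))" for i
    have X: "X i \<in> carrier ?C" for i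
    proof (rule character_moduleI)
      show "X i x \<in> carrier QZ" if "x \<in> carrier M" for x
        using \<xi> that by (auto simp: X_def hom_def Pi_iff)
      show "X i (x \<oplus>\<^bsub>M\<^esub> x') = X i x \<otimes>\<^bsub>QZ\<^esub> X i x'" if "x \<in> carrier M" "x' \<in> carrier M" for x x'
      proof -
        let ?e = "\<lambda>x. \<lambda>k\<in>{..<m}. if k = i then x else \<zero>\<^bsub>M\<^esub>"
        have "?e (x \<oplus>\<^bsub>M\<^esub> x') = ?e x \<otimes>\<^bsub>add_monoid ?G\<^esub> ?e x'"
          by (auto intro!: restrict_ext)
        then have "\<xi> (?e (x \<oplus>\<^bsub>M\<^esub> x')) = \<xi> (?e x) \<otimes>\<^bsub>QZ\<^esub> \<xi> (?e x')"
          using hom_mult[OF \<xi>, of "?e x" "?e x'"] that by auto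
        then show ?thesis using that by (simp add: X_def)
      qed
      show "X i \<in> extensional (carrier M)" by (simp add: X_def)
    qed
    have \<xi>X: "\<xi> z = finprod QZ (\<lambda>i. X i (z i)) {..<m}" if z: "z \<in> carrier ?G" for z
      unfolding product_finite_decomposition[OF M z \<xi>]
      by (rule QZ.finprod_cong') (use z character_closed[OF X] in \<open>auto simp: X_def\<close>)
    have aX: "a i j \<odot>\<^bsub>?C\<^esub> X i \<in> carrier ?C" if "i < m" "j < n" for i j
      using left_module.smult_closed[OF C _ X, of "a i j"] ac[OF that] by (simp del: character_module_simps)
    have rel: "finsum ?C (\<lambda>i. a i j \<odot>\<^bsub>?C\<^esub> X i) {..<m} = \<zero>\<^bsub>?C\<^esub>" if j: "j < n" for j
    proof (rule character_ext)
      show "finsum ?C (\<lambda>i. a i j \<odot>\<^bsub>?C\<^esub> X i) {..<m} \<in> carrier ?C"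
        by (rule abelian_monoid.finsum_closed[OF abelian_group.axioms(1)[OF left_moduleD(2)[OF C]]])
          (use aX j in auto)
      show "\<zero>\<^bsub>?C\<^esub> \<in> carrier ?C"
        by (rule abelian_monoid.zero_closed[OF abelian_group.axioms(1)[OF left_moduleD(2)[OF C]]])
      fix e assume e: "e \<in> carrier M"
      have ae: "a i j \<odot>\<^bsub>M\<^esub> e \<in> carrier M" if "i < m" for i
        by (rule M.smult_closed[OF ac[OF that j] e])
      define v where "v = (\<lambda>k\<in>{..<n}. if k = j then e else \<zero>\<^bsub>M\<^esub>)"
      have v: "v \<in> carrier ?N" using e by (auto simp: v_def)
      have lv: "lincomb M n v (a i) = a i j \<odot>\<^bsub>M\<^esub> e" if i: "i < m" for i
      proof -
        have "lincomb M n v (a i) = finsum M (\<lambda>k. if j = k then a i k \<odot>\<^bsub>M\<^esub> e else \<zero>\<^bsub>M\<^esub>) {..<n}"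
          unfolding lincomb_def
          by (rule M.M.finsum_cong') (use ac[OF i] e M.smult_closed in \<open>auto simp: v_def\<close>)
        also have "\<dots> = a i j \<odot>\<^bsub>M\<^esub> e"
          by (rule M.M.finsum_singleton) (use ac[OF i] e j M.smult_closed in auto)
        finally show ?thesis .
      qed
      have "finsum ?C (\<lambda>i. a i j \<odot>\<^bsub>?C\<^esub> X i) {..<m} e =
          finprod QZ (\<lambda>i. (a i j \<odot>\<^bsub>?C\<^esub> X i) e) {..<m}"
        by (rule finsum_character_apply[OF M _ e]) (use aX j in auto)
      also have "\<dots> = finprod QZ (\<lambda>i. X i (\<alpha> v i)) {..<m}"
        by (rule QZ.finprod_cong') (use lv ae e character_closed[OF X ae] in \<open>auto simp: \<alpha>_def\<close>)
      also have "\<dots> = \<xi> (\<alpha> v)" using \<xi>X[of "\<alpha> v"] \<alpha>.hom_closed[of v] v by simp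
      also have "\<dots> = \<one>\<^bsub>QZ\<^esub>" using \<xi>\<alpha> v by blast
      finally show "finsum ?C (\<lambda>i. a i j \<odot>\<^bsub>?C\<^esub> X i) {..<m} e = \<zero>\<^bsub>?C\<^esub> e" using e by simp
    qed
    have uaX: "u j (a i j \<odot>\<^bsub>?C\<^esub> X i) \<in> carrier QZ" if "i < m" "j < n" for i j
      by (rule character_closed[OF _ aX]) (use u that in auto)
    have "\<xi> ?y = finprod QZ (\<lambda>i. X i (?y i)) {..<m}" by (rule \<xi>X[OF yG])
    also have "\<dots> = finprod QZ (\<lambda>i. finprod QZ (\<lambda>j. u j (a i j \<odot>\<^bsub>?C\<^esub> X i)) {..<n}) {..<m}"
    proof (rule QZ.finprod_cong')
      show "(\<lambda>i. finprod QZ (\<lambda>j. u j (a i j \<odot>\<^bsub>?C\<^esub> X i)) {..<n}) \<in> {..<m} \<rightarrow> carrier QZ"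
        using uaX by (intro Pi_I QZ.finprod_closed) auto
      fix i assume "i \<in> {..<m}"
      then have i: "i < m" by simp
      have au: "a i j \<odot>\<^bsub>?D\<^esub> u j \<in> carrier ?D" if "j < n" for j
        by (rule left_module.smult_closed[OF D]) (use ac[OF i that] u that in auto)
      have "X i (y i) = evaluation M (y i) (X i)"
        unfolding evaluation_def using X[of i] by (simp del: character_module_simps)
      also have "\<dots> = lincomb ?D n u (a i) (X i)" using eq i by simp
      also have "\<dots> = finprod QZ (\<lambda>j. (a i j \<odot>\<^bsub>?D\<^esub> u j) (X i)) {..<n}"
        unfolding lincomb_def
        by (rule finsum_character_apply[OF C _ X]) (use au in auto)
      also have "\<dots> = finprod QZ (\<lambda>j. u j (a i j \<odot>\<^bsub>?C\<^esub> X i)) {..<n}"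
      proof (rule QZ.finprod_cong')
        show "(\<lambda>j. u j (a i j \<odot>\<^bsub>?C\<^esub> X i)) \<in> {..<n} \<rightarrow> carrier QZ" using uaX i by auto
        show "(a i j \<odot>\<^bsub>?D\<^esub> u j) (X i) = u j (a i j \<odot>\<^bsub>?C\<^esub> X i)" for j
          unfolding character_module_simps(4)[where M = "character_module M"] using X[of i]
          by (simp del: character_module_simps)
      qed simp
      finally show "X i (?y i) = finprod QZ (\<lambda>j. u j (a i j \<odot>\<^bsub>?C\<^esub> X i)) {..<n}" using i by simp
    qed simp
    also have "\<dots> = finprod QZ (\<lambda>j. finprod QZ (\<lambda>i. u j (a i j \<odot>\<^bsub>?C\<^esub> X i)) {..<m}) {..<n}"
      by (rule QZ.finprod_swap) (use uaX in auto)
    also have "\<dots> = \<one>\<^bsub>QZ\<^esub>"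
    proof (rule QZ.finprod_one_eqI)
      fix j assume "j \<in> {..<n}"
      then have j: "j < n" by simp
      have uj: "u j \<in> carrier ?D" using u j by blast
      have "finprod QZ (\<lambda>i. u j (a i j \<odot>\<^bsub>?C\<^esub> X i)) {..<m} =
          u j (finsum ?C (\<lambda>i. a i j \<odot>\<^bsub>?C\<^esub> X i) {..<m})"
        by (rule character_finsum[OF C uj, symmetric]) (use aX j in auto)
      also have "\<dots> = \<one>\<^bsub>QZ\<^esub>" unfolding rel[OF j] by (rule character_zero[OF C uj])
      finally show "finprod QZ (\<lambda>i. u j (a i j \<odot>\<^bsub>?C\<^esub> X i)) {..<m} = \<one>\<^bsub>QZ\<^esub>" .
    qed
    finally show False using \<xi>y by simp
  qed
  then obtain v where v: "v \<in> carrier ?N" "?y = \<alpha> v" by blast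
  have "lincomb M n v (a i) = y i" if "i < m" for i
    using fun_cong[OF v(2), of i] that by (simp add: \<alpha>_def)
  moreover have "v j \<in> carrier M" if "j < n" for j using v(1) that by auto
  ultimately show "\<exists>v. (\<forall>j<n. v j \<in> carrier M) \<and> (\<forall>i<m. lincomb M n v (a i) = y i)" by blast
qed

lemma evaluation_inj:
  fixes S :: "'r ring" and M :: "('r, 'm) module"
  assumes M: "left_module S M"
  shows "inj_on (evaluation M) (carrier M)"
proof (rule inj_onI, rule ccontr)
  interpret M: left_module S M by fact
  fix x y assume xy: "x \<in> carrier M" "y \<in> carrier M" and eq: "evaluation M x = evaluation M y" and "x \<noteq> y"
  have "x \<ominus>\<^bsub>M\<^esub> y \<notin> {\<zero>\<^bsub>M\<^esub>}"
  proof
    assume "x \<ominus>\<^bsub>M\<^esub> y \<in> {\<zero>\<^bsub>M\<^esub>}"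
    then have "\<ominus>\<^bsub>M\<^esub> (\<ominus>\<^bsub>M\<^esub> y) = x"
      using xy by (intro M.M.minus_equality) (auto simp: a_minus_def)
    then show False using xy \<open>x \<noteq> y\<close> by simp
  qed
  moreover have "subgroup {\<zero>\<^bsub>M\<^esub>} (add_monoid M)"
    using group.triv_subgroup[OF M.M.a_group] by simp
  moreover have "x \<ominus>\<^bsub>M\<^esub> y \<in> carrier (add_monoid M)" using xy by simp
  ultimately obtain \<xi> where \<xi>: "\<xi> \<in> hom (add_monoid M) QZ" "\<xi> (x \<ominus>\<^bsub>M\<^esub> y) \<noteq> \<one>\<^bsub>QZ\<^esub>"
    using comm_group.characters_separate[OF M.M.a_comm_group] by metis
  let ?\<chi> = "restrict \<xi> (carrier M)"
  have \<chi>: "?\<chi> \<in> carrier (character_module M)"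
    using \<xi>(1) by (intro character_moduleI) (auto simp: hom_def Pi_iff)
  have "evaluation M x ?\<chi> = evaluation M y ?\<chi>" using eq by simp
  then have e: "\<xi> x = \<xi> y" using \<chi> xy by (simp add: evaluation_def del: character_module_simps)
  have "\<xi> (x \<ominus>\<^bsub>M\<^esub> y) \<otimes>\<^bsub>QZ\<^esub> \<xi> y = \<xi> ((x \<ominus>\<^bsub>M\<^esub> y) \<oplus>\<^bsub>M\<^esub> y)"
    using hom_mult[OF \<xi>(1), of "x \<ominus>\<^bsub>M\<^esub> y" y] xy by simp
  also have "(x \<ominus>\<^bsub>M\<^esub> y) \<oplus>\<^bsub>M\<^esub> y = x" using xy by (simp add: a_minus_def M.M.a_assoc M.M.l_neg)
  finally have "\<xi> (x \<ominus>\<^bsub>M\<^esub> y) \<otimes>\<^bsub>QZ\<^esub> \<xi> y = \<xi> y" using e by simp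
  moreover have "\<xi> y \<in> carrier QZ" "\<xi> (x \<ominus>\<^bsub>M\<^esub> y) \<in> carrier QZ"
    using \<xi>(1) xy by (auto simp: hom_def Pi_iff)
  ultimately show False using \<xi>(2) by simp
qed

section \<open>Pure injective modules\<close>

theorem summand_of_characters_pure_injective:
  fixes R :: "'r ring" and M :: "('r, 'm) module" and N :: "'i \<Rightarrow> ('r, 'b \<Rightarrow> rat set) module"
  assumes M: "right_module R M" and fp: "\<And>B. B \<in> \<B> \<Longrightarrow> finitely_presented R B"
    and N: "\<And>i. i \<in> I \<Longrightarrow> N i \<in> character_module ` \<B>"
    and MN: "direct_summand (opposite_ring R) M (product_module I N)"
  shows "pure_injective T (opposite_ring R) M"
  unfolding pure_injective_def
proof (intro conjI allI impI ballI)
  let ?S = "opposite_ring R"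
  show "right_module R M" by fact
  fix K L Q :: "('r, 't + (('m \<Rightarrow> rat set) \<Rightarrow> rat set)) module" and f g h
  assume pe: "pure_exact ?S K f L g Q" and h: "h \<in> linear_hom ?S K M"
  have "short_exact ?S K f L g Q" using pe by (simp add: pure_exact_def)
  then have K: "left_module ?S K" and L: "left_module ?S L" and f: "f \<in> linear_hom ?S K L"
    by (auto simp: short_exact_def)
  have pure: "pure_embedding ?S K f L" by (rule pure_exact_imp_pure_embedding[OF pe])
  obtain e r where e: "e \<in> linear_hom ?S M (product_module I N)" and r: "r \<in> linear_hom ?S (product_module I N) M"
    and re: "\<And>x. x \<in> carrier M \<Longrightarrow> r (e x) = x"
    using MN by (auto simp: direct_summand_def)
  have eh: "(\<lambda>x. e (h x)) \<in> linear_hom ?S K (product_module I N)" by (rule linear_hom_comp[OF h e])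
  have "\<exists>k\<in>linear_hom ?S L (N i). \<forall>x\<in>carrier K. k (f x) = e (h x) i" if i: "i \<in> I" for i
  proof -
    obtain B where B: "B \<in> \<B>" "N i = character_module B" using N[OF i] by auto
    have pr: "(\<lambda>x. x i) \<in> linear_hom ?S (product_module I N) (N i)"
      using i by (intro linear_homI) auto
    show ?thesis
      unfolding B(2)
      by (rule character_module_extension[OF K L f pure fp[OF B(1)]])
        (rule linear_hom_comp[OF eh pr, unfolded B(2)])
  qed
  then obtain k where k: "\<And>i. i \<in> I \<Longrightarrow> k i \<in> linear_hom ?S L (N i)"
    and kf: "\<And>i x. i \<in> I \<Longrightarrow> x \<in> carrier K \<Longrightarrow> k i (f x) = e (h x) i" by metis
  have k': "(\<lambda>l. \<lambda>i\<in>I. k i l) \<in> linear_hom ?S L (product_module I N)"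
    by (rule linear_homI) (use linear_homD(1-3)[OF k] in \<open>auto intro!: restrict_ext\<close>)
  have "(\<lambda>i\<in>I. k i (f x)) = e (h x)" if x: "x \<in> carrier K" for x
  proof -
    have "e (h x) \<in> carrier (product_module I N)" by (rule linear_homD(1)[OF eh x])
    then show ?thesis using kf x by (auto simp: PiE_iff intro!: extensionalityI[of _ I])
  qed
  then have "r (\<lambda>i\<in>I. k i (f x)) = h x" if "x \<in> carrier K" for x
    using re[OF linear_homD(1)[OF h that]] that by simp
  then show "\<exists>h'\<in>linear_hom ?S L M. \<forall>x\<in>carrier K. h' (f x) = h x"
    by (intro bexI[OF _ linear_hom_comp[OF k' r]]) simp
qed

text \<open>The definition of pure injectivity admits only sequences whose three modules share one carrier
  type, so the sequence of \<open>M\<close> and its double character module has to be copied there.\<close>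

definition transport_module :: "('m \<Rightarrow> 'n) \<Rightarrow> ('r, 'm) module \<Rightarrow> ('r, 'n) module" where
  "transport_module \<alpha> M =
     \<lparr>carrier = \<alpha> ` carrier M, mult = undefined, one = undefined, ring.zero = \<alpha> \<zero>\<^bsub>M\<^esub>,
      add = (\<lambda>x y. \<alpha> (the_inv_into (carrier M) \<alpha> x \<oplus>\<^bsub>M\<^esub> the_inv_into (carrier M) \<alpha> y)),
      smult = (\<lambda>a x. \<alpha> (a \<odot>\<^bsub>M\<^esub> the_inv_into (carrier M) \<alpha> x))\<rparr>"

context
  fixes S :: "'r ring" and M :: "('r, 'm) module" and \<alpha> :: "'m \<Rightarrow> 'n"
  assumes M: "left_module S M" and \<alpha>: "inj_on \<alpha> (carrier M)"
begin

interpretation left_module S M by (rule M)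

lemma transport_simps:
  "carrier (transport_module \<alpha> M) = \<alpha> ` carrier M" "\<zero>\<^bsub>transport_module \<alpha> M\<^esub> = \<alpha> \<zero>\<^bsub>M\<^esub>"
  "x \<in> carrier M \<Longrightarrow> y \<in> carrier M \<Longrightarrow> \<alpha> x \<oplus>\<^bsub>transport_module \<alpha> M\<^esub> \<alpha> y = \<alpha> (x \<oplus>\<^bsub>M\<^esub> y)"
  "x \<in> carrier M \<Longrightarrow> a \<odot>\<^bsub>transport_module \<alpha> M\<^esub> \<alpha> x = \<alpha> (a \<odot>\<^bsub>M\<^esub> x)"
  by (simp_all add: transport_module_def the_inv_into_f_f[OF \<alpha>])

lemma transport_linear: "\<alpha> \<in> linear_hom S M (transport_module \<alpha> M)"
  by (rule linear_homI) (simp_all add: transport_simps)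

lemma transport_bij: "bij_betw \<alpha> (carrier M) (carrier (transport_module \<alpha> M))"
  using \<alpha> by (simp add: bij_betw_def transport_simps)

lemma transport_inv_linear:
  "the_inv_into (carrier M) \<alpha> \<in> linear_hom S (transport_module \<alpha> M) M"
  by (rule linear_hom_the_inv[OF transport_linear transport_bij M])

lemma left_module_transport: "left_module S (transport_module \<alpha> M)"
proof (rule left_moduleI)
  show "ring S" by unfold_locales
  show "abelian_group (transport_module \<alpha> M)"
  proof (rule abelian_groupI)
    fix X assume "X \<in> carrier (transport_module \<alpha> M)"
    then obtain x where x: "x \<in> carrier M" "X = \<alpha> x" by (auto simp: transport_simps)
    then show "\<exists>Y\<in>carrier (transport_module \<alpha> M). Y \<oplus>\<^bsub>transport_module \<alpha> M\<^esub> X = \<zero>\<^bsub>transport_module \<alpha> M\<^esub>"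
      by (intro bexI[of _ "\<alpha> (\<ominus>\<^bsub>M\<^esub> x)"]) (auto simp: transport_simps M.l_neg)
  qed (auto simp: transport_simps M.a_ac)
qed (auto simp: transport_simps smult_closed smult_l_distr smult_r_distr smult_assoc smult_one)

end

lemma pure_exact_transport:
  fixes S :: "'r ring" and K :: "('r, 'k) module" and M :: "('r, 'm) module" and N :: "('r, 'n) module"
  assumes pe: "pure_exact S K f M g N"
    and \<alpha>: "inj_on \<alpha> (carrier K)" and \<beta>: "inj_on \<beta> (carrier M)" and \<gamma>: "inj_on \<gamma> (carrier N)"
  shows "pure_exact S (transport_module \<alpha> K) (\<lambda>x. \<beta> (f (the_inv_into (carrier K) \<alpha> x)))
    (transport_module \<beta> M) (\<lambda>y. \<gamma> (g (the_inv_into (carrier M) \<beta> y))) (transport_module \<gamma> N)"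
    (is "pure_exact S ?K ?f ?M ?g ?N")
proof -
  have K: "left_module S K" and M: "left_module S M" and N: "left_module S N"
    and f: "f \<in> linear_hom S K M" and g: "g \<in> linear_hom S M N" and inj: "inj_on f (carrier K)"
    and im: "f ` carrier K = a_kernel M N g" and surj: "g ` carrier M = carrier N"
    and lift: "\<And>(P :: ('r, (nat \<Rightarrow> 'r) set) module) h. finitely_presented S P \<Longrightarrow> h \<in> linear_hom S P N \<Longrightarrow>
      \<exists>h' \<in> linear_hom S P M. \<forall>x\<in>carrier P. g (h' x) = h x"
    using pe by (auto simp: pure_exact_def short_exact_def)
  note inv = the_inv_into_f_f[OF \<alpha>] the_inv_into_f_f[OF \<beta>] the_inv_into_f_f[OF \<gamma>]
  have fc: "f x \<in> carrier M" if "x \<in> carrier K" for x by (rule linear_homD(1)[OF f that])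
  have gc: "g x \<in> carrier N" if "x \<in> carrier M" for x by (rule linear_homD(1)[OF g that])
  have f': "?f \<in> linear_hom S ?K ?M"
    by (rule linear_hom_comp[OF linear_hom_comp[OF transport_inv_linear[OF K \<alpha>] f] transport_linear[OF M \<beta>]])
  have g': "?g \<in> linear_hom S ?M ?N"
    by (rule linear_hom_comp[OF linear_hom_comp[OF transport_inv_linear[OF M \<beta>] g] transport_linear[OF N \<gamma>]])
  have inj': "inj_on ?f (carrier ?K)"
  proof (rule inj_onI)
    fix x y assume "x \<in> carrier ?K" "y \<in> carrier ?K" and eq: "?f x = ?f y"
    then obtain u v where u: "u \<in> carrier K" "x = \<alpha> u" and v: "v \<in> carrier K" "y = \<alpha> v"
      by (auto simp: transport_simps[OF K \<alpha>])
    have "\<beta> (f u) = \<beta> (f v)" using eq u v by (simp add: inv)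
    then have "f u = f v" by (rule inj_onD[OF \<beta> _ fc[OF u(1)] fc[OF v(1)]])
    then show "x = y" using inj_onD[OF inj _ u(1) v(1)] u v by simp
  qed
  have fim: "?f ` carrier ?K = \<beta> ` f ` carrier K"
    by (auto simp: transport_simps[OF K \<alpha>] inv image_image)
  have gim: "?g ` carrier ?M = \<gamma> ` g ` carrier M"
    by (auto simp: transport_simps[OF M \<beta>] inv image_image)
  have gz: "\<gamma> (g x) = \<gamma> \<zero>\<^bsub>N\<^esub> \<longleftrightarrow> g x = \<zero>\<^bsub>N\<^esub>" if "x \<in> carrier M" for x
    using inj_on_eq_iff[OF \<gamma> gc[OF that]] abelian_monoid.zero_closed[OF abelian_group.axioms(1)[OF left_moduleD(2)[OF N]]]
    by simp
  have ker: "a_kernel ?M ?N ?g = \<beta> ` a_kernel M N g"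
    by (auto simp: a_kernel_iff transport_simps[OF M \<beta>] transport_simps[OF N \<gamma>] inv gz)
  show ?thesis
    unfolding pure_exact_def short_exact_def
  proof (intro conjI allI impI ballI)
    show "left_module S ?K" "left_module S ?M" "left_module S ?N"
      using left_module_transport[OF K \<alpha>] left_module_transport[OF M \<beta>] left_module_transport[OF N \<gamma>] .
    show "?f \<in> linear_hom S ?K ?M" "?g \<in> linear_hom S ?M ?N" "inj_on ?f (carrier ?K)"
      using f' g' inj' .
    show "?f ` carrier ?K = a_kernel ?M ?N ?g" unfolding fim ker im ..
    show "?g ` carrier ?M = carrier ?N" unfolding gim surj by (simp add: transport_simps[OF N \<gamma>])
    fix P :: "('r, (nat \<Rightarrow> 'r) set) module" and h
    assume P: "finitely_presented S P" and h: "h \<in> linear_hom S P ?N"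
    obtain h' where h': "h' \<in> linear_hom S P M" "\<And>x. x \<in> carrier P \<Longrightarrow> g (h' x) = the_inv_into (carrier N) \<gamma> (h x)"
      using lift[OF P linear_hom_comp[OF h transport_inv_linear[OF N \<gamma>]]] by auto
    have "?g (\<beta> (h' x)) = h x" if x: "x \<in> carrier P" for x
    proof -
      have "h x \<in> \<gamma> ` carrier N" using linear_homD(1)[OF h x] by (simp add: transport_simps[OF N \<gamma>])
      then have "\<gamma> (the_inv_into (carrier N) \<gamma> (h x)) = h x" by (rule f_the_inv_into_f[OF \<gamma>])
      then show ?thesis using h'(2)[OF x] inv(2)[OF linear_homD(1)[OF h'(1) x]] by simp
    qed
    then show "\<exists>h'\<in>linear_hom S P ?M. \<forall>x\<in>carrier P. ?g (h' x) = h x"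
      by (intro bexI[OF _ linear_hom_comp[OF h'(1) transport_linear[OF M \<beta>]]]) simp
  qed
qed

text \<open>The retraction is an extension of the identity of \<open>M\<close> along the pure embedding \<open>evaluation M\<close>.\<close>

theorem pure_injective_splits:
  fixes S :: "'r ring" and M :: "('r, 'm) module"
  assumes pi: "pure_injective (T :: 't itself) S M"
  shows "direct_summand S M (character_module (character_module M))"
proof -
  let ?D = "character_module (character_module M)" and ?ev = "evaluation M"
  have M: "left_module S M" using pi by (simp add: pure_injective_def)
  have D: "left_module S ?D" using left_module_character[OF left_module_character[OF M]] by simp
  have ev: "?ev \<in> linear_hom S M ?D" by (rule evaluation_linear[OF M])
  let ?H = "?ev ` carrier M"
  have H: "submodule ?H S ?D" by (rule submodule_image[OF M D ev])
  let ?Q = "quotient_module ?D ?H" and ?q = "\<lambda>x. ?H +>\<^bsub>?D\<^esub> x"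
  have Q: "left_module S ?Q" by (rule left_module_quotient[OF D H])
  have q: "?q \<in> linear_hom S ?D ?Q" by (rule coset_linear[OF D H])
  have "?H = a_kernel ?D ?Q ?q"
    using coset_eq_zero_iff[OF D H] linear_homD(1)[OF ev] by (auto simp only: a_kernel_iff)
  then have "short_exact S M ?ev ?D ?q ?Q"
    unfolding short_exact_def
    using M D Q ev q evaluation_inj[OF M] quotient_carrier[OF D H] by auto
  then have pe: "pure_exact S M ?ev ?D ?q ?Q"
    by (rule pure_embedding_imp_pure_exact[OF _ pure_embedding_evaluation[OF M]])
  define \<alpha> :: "'m \<Rightarrow> 't + (('m \<Rightarrow> rat set) \<Rightarrow> rat set)" where "\<alpha> x = Inr (?ev x)" for x
  define \<beta> :: "(('m \<Rightarrow> rat set) \<Rightarrow> rat set) \<Rightarrow> 't + (('m \<Rightarrow> rat set) \<Rightarrow> rat set)" where "\<beta> = Inr"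
  \<comment> \<open>A coset is encoded by a representative, which lives on the carrier type of \<open>?D\<close>.\<close>
  define \<gamma> :: "(('m \<Rightarrow> rat set) \<Rightarrow> rat set) set \<Rightarrow> 't + (('m \<Rightarrow> rat set) \<Rightarrow> rat set)" where
    "\<gamma> X = Inr (SOME x. x \<in> carrier ?D \<and> ?q x = X)" for X
  have \<alpha>: "inj_on \<alpha> (carrier M)"
    using evaluation_inj[OF M] by (auto simp: inj_on_def \<alpha>_def)
  have \<beta>: "inj_on \<beta> (carrier ?D)" by (simp add: \<beta>_def)
  have \<gamma>: "inj_on \<gamma> (carrier ?Q)"
  proof (rule inj_onI)
    have some: "?q (SOME x. x \<in> carrier ?D \<and> ?q x = X) = X" if "X \<in> carrier ?Q" for X
    proof -
      have "\<exists>x. x \<in> carrier ?D \<and> ?q x = X" using that unfolding quotient_carrier[OF D H] by auto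
      from someI_ex[OF this] show ?thesis by blast
    qed
    fix X Y assume "X \<in> carrier ?Q" "Y \<in> carrier ?Q" "\<gamma> X = \<gamma> Y"
    then show "X = Y" using some[of X] some[of Y] by (simp add: \<gamma>_def)
  qed
  obtain h' where h': "h' \<in> linear_hom S (transport_module \<beta> ?D) M"
    and eq: "\<And>x. x \<in> carrier (transport_module \<alpha> M) \<Longrightarrow>
      h' (\<beta> (?ev (the_inv_into (carrier M) \<alpha> x))) = the_inv_into (carrier M) \<alpha> x"
    using pi[unfolded pure_injective_def, THEN conjunct2, rule_format,
        OF pure_exact_transport[OF pe \<alpha> \<beta> \<gamma>] transport_inv_linear[OF M \<alpha>]] by auto
  have "h' (\<beta> (?ev x)) = x" if "x \<in> carrier M" for x
    using eq[of "\<alpha> x"] that by (simp add: transport_simps[OF M \<alpha>] the_inv_into_f_f[OF \<alpha>])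
  then show ?thesis
    unfolding direct_summand_def
    by (intro bexI[OF _ ev] bexI[OF _ linear_hom_comp[OF transport_linear[OF D \<beta>] h']]) simp
qed

section \<open>Cocones over finite diagrams in a filtered category\<close>

text \<open>For an identity arrow the condition says that \<open>c\<close> has a leg to \<open>k\<close> at its object, so cocones over
  sets of objects need no separate treatment.  Outside the finite part in question \<open>c\<close> is arbitrary.\<close>

definition compatible_legs :: "('o, 'a) small_category \<Rightarrow> 'a \<Rightarrow> ('o \<times> ('o \<Rightarrow> 'a)) set" where
  "compatible_legs J f = {(k, c).
     c (Dom J f) \<in> Arr J \<and> Dom J (c (Dom J f)) = Dom J f \<and> Cod J (c (Dom J f)) = k \<and>
     c (Cod J f) \<in> Arr J \<and> Dom J (c (Cod J f)) = Cod J f \<and> Cod J (c (Cod J f)) = k \<and>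
     Comp J (c (Cod J f)) f = c (Dom J f)}"

context filtered_category
begin

lemma finite_upper_bound:
  assumes "finite A" "A \<subseteq> Obj J"
  shows "\<exists>k\<in>Obj J. \<exists>c. \<forall>i\<in>A. c i \<in> Arr J \<and> Dom J (c i) = i \<and> Cod J (c i) = k"
  using assms
proof (induction A)
  case empty
  then show ?case using nonempty by auto
next
  case (insert j A)
  then obtain k c where k: "k \<in> Obj J"
    and c: "\<And>i. i \<in> A \<Longrightarrow> c i \<in> Arr J \<and> Dom J (c i) = i \<and> Cod J (c i) = k" by auto
  obtain f g where fg: "f \<in> Arr J" "g \<in> Arr J" "Dom J f = k" "Dom J g = j" "Cod J f = Cod J g"
    using upper_bound[of k j] k insert.prems by auto
  define c' where "c' i = (if i = j then g else Comp J f (c i))" for i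
  have "c' i \<in> Arr J \<and> Dom J (c' i) = i \<and> Cod J (c' i) = Cod J g" if "i \<in> insert j A" for i
    using that fg c[of i] Comp_Arr[of "c i" f] by (auto simp: c'_def)
  then show ?case using Cod_Obj[OF fg(2)] by (intro bexI[of _ "Cod J g"] exI[of _ c']) auto
qed

text \<open>First a common upper bound of the objects; then the arrows are made to commute one after the other
  by composing all legs with a coequalizing arrow, which keeps the equations reached before.\<close>

lemma finite_cocone:
  assumes "finite X" "X \<subseteq> Arr J"
  shows "\<exists>k c. \<forall>f\<in>X. (k, c) \<in> compatible_legs J f"
proof -
  define A where "A = Dom J ` X \<union> Cod J ` X"
  have A: "finite A" "A \<subseteq> Obj J" using assms Dom_Obj Cod_Obj by (auto simp: A_def)
  have "\<exists>k c. (\<forall>i\<in>A. c i \<in> Arr J \<and> Dom J (c i) = i \<and> Cod J (c i) = k) \<and>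
      (\<forall>f\<in>Y. Comp J (c (Cod J f)) f = c (Dom J f))" if "Y \<subseteq> X" for Y
    using finite_subset[OF that assms(1)] that
  proof (induction Y)
    case empty
    then show ?case using finite_upper_bound[OF A] by auto
  next
    case (insert f Y)
    then obtain k c where c': "\<forall>i\<in>A. c i \<in> Arr J \<and> Dom J (c i) = i \<and> Cod J (c i) = k"
      and eq: "\<forall>g\<in>Y. Comp J (c (Cod J g)) g = c (Dom J g)" by auto
    then have c: "c i \<in> Arr J" "Dom J (c i) = i" "Cod J (c i) = k" if "i \<in> A" for i
      using that by auto
    have mem: "Dom J g \<in> A" "Cod J g \<in> A" "g \<in> Arr J" if "g \<in> X" for g
      using that assms(2) by (auto simp: A_def)
    have f: "f \<in> X" using insert.prems by simp
    have p: "Comp J (c (Cod J f)) f \<in> Arr J \<and> Dom J (Comp J (c (Cod J f)) f) = Dom J f \<and>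
        Cod J (Comp J (c (Cod J f)) f) = k"
      using Comp_Arr[of f "c (Cod J f)"] mem[OF f] c by simp
    obtain h where h: "h \<in> Arr J" "Dom J h = k" "Comp J h (Comp J (c (Cod J f)) f) = Comp J h (c (Dom J f))"
      using coequalize[of "Comp J (c (Cod J f)) f" "c (Dom J f)"] p mem[OF f] c by auto
    define c' where "c' i = Comp J h (c i)" for i
    have "c' i \<in> Arr J \<and> Dom J (c' i) = i \<and> Cod J (c' i) = Cod J h" if "i \<in> A" for i
      unfolding c'_def using Comp_Arr[of "c i" h] c[OF that] h by auto
    moreover have "Comp J (c' (Cod J g)) g = c' (Dom J g)" if g: "g \<in> insert f Y" for g
    proof -
      have gX: "g \<in> X" using g insert.prems by auto
      have "Comp J (c' (Cod J g)) g = Comp J h (Comp J (c (Cod J g)) g)"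
        unfolding c'_def using Comp_assoc[of g "c (Cod J g)" h] mem[OF gX] c h by simp
      also have "\<dots> = Comp J h (c (Dom J g))" using g h(3) eq by auto
      finally show ?thesis by (simp add: c'_def)
    qed
    ultimately show ?case by blast
  qed
  from this[OF order_refl] obtain k c where
    "\<forall>i\<in>A. c i \<in> Arr J \<and> Dom J (c i) = i \<and> Cod J (c i) = k"
    "\<forall>f\<in>X. Comp J (c (Cod J f)) f = c (Dom J f)" by auto
  then have "(k, c) \<in> compatible_legs J f" if "f \<in> X" for f
    using that by (auto simp: compatible_legs_def A_def)
  then show ?thesis by blast
qed

definition cocone_filter where
  "cocone_filter = (INF f\<in>Arr J. principal (compatible_legs J f))"

lemma cocone_filter_not_bot: "cocone_filter \<noteq> bot"
  unfolding cocone_filter_def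
proof (rule INF_filter_not_bot)
  fix X assume X: "X \<subseteq> Arr J" "finite X"
  obtain k c where "\<forall>f\<in>X. (k, c) \<in> compatible_legs J f" using finite_cocone[OF X(2,1)] by auto
  then have "(\<Inter>f\<in>X. compatible_legs J f) \<noteq> {}" by blast
  then show "(INF f\<in>X. principal (compatible_legs J f)) \<noteq> bot"
    by (simp add: INF_principal_finite[OF X(2)] principal_eq_bot_iff)
qed

lemma eventually_compatible:
  assumes "f \<in> Arr J" shows "eventually (\<lambda>z. z \<in> compatible_legs J f) cocone_filter"
  unfolding cocone_filter_def
  by (rule eventually_INF1[OF assms]) (simp add: eventually_principal)

end


section \<open>Direct sums and generated submodules\<close>

lemma left_module_on_submodule:
  fixes S :: "'r ring" and M :: "('r, 'm) module"
  assumes M: "left_module S M" and H: "submodule H S M"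
  shows "left_module S (M\<lparr>carrier := H\<rparr>)"
proof -
  interpret left_module S M by fact
  interpret H: submodule H S M by fact
  have sub: "x \<in> carrier M" if "x \<in> H" for x using H.subset that by auto
  have inv: "\<ominus>\<^bsub>M\<^esub> x \<in> H" if "x \<in> H" for x using H.m_inv_closed[OF that] by (simp add: a_inv_def)
  have add: "x \<oplus>\<^bsub>M\<^esub> y \<in> H" if "x \<in> H" "y \<in> H" for x y using H.m_closed[OF that] by simp
  have zero: "\<zero>\<^bsub>M\<^esub> \<in> H" using H.one_closed by simp
  show ?thesis
  proof (rule left_moduleI)
    show "ring S" by unfold_locales
    show "abelian_group (M\<lparr>carrier := H\<rparr>)"
    proof (rule abelian_groupI)
      fix x assume "x \<in> carrier (M\<lparr>carrier := H\<rparr>)"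
      then show "\<exists>y\<in>carrier (M\<lparr>carrier := H\<rparr>). y \<oplus>\<^bsub>M\<lparr>carrier := H\<rparr>\<^esub> x = \<zero>\<^bsub>M\<lparr>carrier := H\<rparr>\<^esub>"
        by (intro bexI[of _ "\<ominus>\<^bsub>M\<^esub> x"]) (auto simp: inv sub M.l_neg)
    qed (auto simp: add zero sub M.a_ac)
  qed (auto simp: sub H.smult_closed smult_l_distr smult_r_distr smult_assoc smult_one)
qed

lemma submodule_carrier:
  assumes "left_module S M" shows "submodule (carrier M) S M"
proof -
  interpret left_module S M by fact
  show ?thesis by (rule submoduleI'[OF assms]) (auto simp: smult_closed)
qed

lemma submoduleD:
  assumes "submodule H S M"
  shows "H \<subseteq> carrier M" "\<zero>\<^bsub>M\<^esub> \<in> H" "x \<in> H \<Longrightarrow> y \<in> H \<Longrightarrow> x \<oplus>\<^bsub>M\<^esub> y \<in> H" "x \<in> H \<Longrightarrow> \<ominus>\<^bsub>M\<^esub> x \<in> H"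
    "a \<in> carrier S \<Longrightarrow> x \<in> H \<Longrightarrow> a \<odot>\<^bsub>M\<^esub> x \<in> H"
proof -
  interpret H: submodule H S M by fact
  show "H \<subseteq> carrier M" "\<zero>\<^bsub>M\<^esub> \<in> H" "x \<in> H \<Longrightarrow> y \<in> H \<Longrightarrow> x \<oplus>\<^bsub>M\<^esub> y \<in> H" "x \<in> H \<Longrightarrow> \<ominus>\<^bsub>M\<^esub> x \<in> H"
    "a \<in> carrier S \<Longrightarrow> x \<in> H \<Longrightarrow> a \<odot>\<^bsub>M\<^esub> x \<in> H"
    using H.subset H.one_closed H.m_closed[of x y] H.m_inv_closed[of x] H.smult_closed[of a x]
    by (simp_all add: a_inv_def)
qed

lemma generated_submodule:
  fixes S :: "'r ring" and M :: "('r, 'm) module"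
  assumes M: "left_module S M" and X: "X \<subseteq> carrier M"
  shows "submodule (generated_submodule S M X) S M" "X \<subseteq> generated_submodule S M X"
    and "submodule H S M \<Longrightarrow> X \<subseteq> H \<Longrightarrow> generated_submodule S M X \<subseteq> H"
proof -
  show "X \<subseteq> generated_submodule S M X" by (auto simp: generated_submodule_def)
  show "submodule H S M \<Longrightarrow> X \<subseteq> H \<Longrightarrow> generated_submodule S M X \<subseteq> H"
    by (auto simp: generated_submodule_def)
  show "submodule (generated_submodule S M X) S M"
  proof (rule submoduleI'[OF M])
    show "generated_submodule S M X \<subseteq> carrier M"
      using submodule_carrier[OF M] X by (auto simp: generated_submodule_def)
  qed (auto simp: generated_submodule_def submoduleD)
qed

lemma direct_sum_simps:
  "carrier (direct_sum_module I N) = {x \<in> carrier (product_module I N). finite {i \<in> I. x i \<noteq> \<zero>\<^bsub>N i\<^esub>}}"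
  "\<zero>\<^bsub>direct_sum_module I N\<^esub> = \<zero>\<^bsub>product_module I N\<^esub>"
  "x \<oplus>\<^bsub>direct_sum_module I N\<^esub> y = x \<oplus>\<^bsub>product_module I N\<^esub> y"
  "a \<odot>\<^bsub>direct_sum_module I N\<^esub> x = a \<odot>\<^bsub>product_module I N\<^esub> x"
  by (simp_all add: direct_sum_module_def)

context
  fixes S :: "'r ring" and I :: "'i set" and N :: "'i \<Rightarrow> ('r, 'm) module"
  assumes S: "ring S" and N: "\<And>i. i \<in> I \<Longrightarrow> left_module S (N i)"
begin

lemma zero_closed_summand: "i \<in> I \<Longrightarrow> \<zero>\<^bsub>N i\<^esub> \<in> carrier (N i)"
  using N left_moduleD(2) abelian_group.axioms(1) abelian_monoid.zero_closed by blast

lemma left_module_direct_sum: "left_module S (direct_sum_module I N)"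
proof -
  let ?P = "product_module I N"
  let ?H = "{x \<in> carrier ?P. finite {i \<in> I. x i \<noteq> \<zero>\<^bsub>N i\<^esub>}}"
  have P: "left_module S ?P" using S N by (rule left_module_product)
  interpret P: left_module S ?P by (rule P)
  have "submodule ?H S ?P"
  proof (rule submoduleI'[OF P])
    show "\<zero>\<^bsub>?P\<^esub> \<in> ?H" using P.M.zero_closed by simp
    fix x assume x: "x \<in> ?H"
    have "{i \<in> I. (\<ominus>\<^bsub>?P\<^esub> x) i \<noteq> \<zero>\<^bsub>N i\<^esub>} \<subseteq> {i \<in> I. x i \<noteq> \<zero>\<^bsub>N i\<^esub>}"
    proof safe
      fix i assume i: "i \<in> I" "x i = \<zero>\<^bsub>N i\<^esub>" "(\<ominus>\<^bsub>?P\<^esub> x) i \<noteq> \<zero>\<^bsub>N i\<^esub>"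
      interpret Ni: left_module S "N i" using N i by blast
      have "\<ominus>\<^bsub>N i\<^esub> \<zero>\<^bsub>N i\<^esub> = \<zero>\<^bsub>N i\<^esub>" by (rule Ni.M.minus_equality) auto
      have "x \<in> carrier ?P" using x by simp
      from product_module_minus[OF S N this i(1)] show False
        using \<open>\<ominus>\<^bsub>N i\<^esub> \<zero>\<^bsub>N i\<^esub> = \<zero>\<^bsub>N i\<^esub>\<close> i by simp
    qed
    then show "\<ominus>\<^bsub>?P\<^esub> x \<in> ?H" using x P.M.a_inv_closed[of x] finite_subset by blast
    fix y assume y: "y \<in> ?H"
    have "{i \<in> I. (x \<oplus>\<^bsub>?P\<^esub> y) i \<noteq> \<zero>\<^bsub>N i\<^esub>} \<subseteq> {i \<in> I. x i \<noteq> \<zero>\<^bsub>N i\<^esub>} \<union> {i \<in> I. y i \<noteq> \<zero>\<^bsub>N i\<^esub>}"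
      using zero_closed_summand abelian_monoid.l_zero[OF abelian_group.axioms(1)[OF left_moduleD(2)[OF N]]]
      by auto
    then show "x \<oplus>\<^bsub>?P\<^esub> y \<in> ?H"
      using x y P.M.a_closed[of x y] finite_subset[of _ "{i \<in> I. x i \<noteq> \<zero>\<^bsub>N i\<^esub>} \<union> {i \<in> I. y i \<noteq> \<zero>\<^bsub>N i\<^esub>}"]
      by blast
  next
    fix a x assume a: "a \<in> carrier S" and x: "x \<in> ?H"
    have "{i \<in> I. (a \<odot>\<^bsub>?P\<^esub> x) i \<noteq> \<zero>\<^bsub>N i\<^esub>} \<subseteq> {i \<in> I. x i \<noteq> \<zero>\<^bsub>N i\<^esub>}"
      using left_module.smult_zero[OF N a] by auto
    then show "a \<odot>\<^bsub>?P\<^esub> x \<in> ?H" using x P.smult_closed[OF a, of x] finite_subset by blast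
  qed auto
  from left_module_on_submodule[OF P this] show ?thesis
    by (simp add: direct_sum_module_def)
qed

lemma sum_inj_closed: "i \<in> I \<Longrightarrow> x \<in> carrier (N i) \<Longrightarrow> sum_inj I N i x \<in> carrier (direct_sum_module I N)"
proof -
  assume i: "i \<in> I" "x \<in> carrier (N i)"
  have "{j \<in> I. sum_inj I N i x j \<noteq> \<zero>\<^bsub>N j\<^esub>} \<subseteq> {i}" by (auto simp: sum_inj_def)
  then have "finite {j \<in> I. sum_inj I N i x j \<noteq> \<zero>\<^bsub>N j\<^esub>}" by (rule finite_subset) simp
  moreover have "sum_inj I N i x \<in> carrier (product_module I N)"
    using i zero_closed_summand by (auto simp: sum_inj_def)
  ultimately show ?thesis by (simp add: direct_sum_simps(1) del: product_module_simps)
qed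

lemma sum_inj_linear: "i \<in> I \<Longrightarrow> sum_inj I N i \<in> linear_hom S (N i) (direct_sum_module I N)"
proof (rule linear_homI)
  assume i: "i \<in> I"
  show "sum_inj I N i x \<in> carrier (direct_sum_module I N)" if "x \<in> carrier (N i)" for x by (rule sum_inj_closed[OF i that])
  show "sum_inj I N i (x \<oplus>\<^bsub>N i\<^esub> y) = sum_inj I N i x \<oplus>\<^bsub>direct_sum_module I N\<^esub> sum_inj I N i y" for x y
    unfolding direct_sum_simps product_module_simps
    using zero_closed_summand abelian_monoid.l_zero[OF abelian_group.axioms(1)[OF left_moduleD(2)[OF N]]]
    by (auto simp: sum_inj_def intro!: restrict_ext)
  show "sum_inj I N i (a \<odot>\<^bsub>N i\<^esub> x) = a \<odot>\<^bsub>direct_sum_module I N\<^esub> sum_inj I N i x" if "a \<in> carrier S" for a x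
    unfolding direct_sum_simps product_module_simps
    using left_module.smult_zero[OF N that]
    by (auto simp: sum_inj_def intro!: restrict_ext)
qed

text \<open>By induction on the size of the support, splitting off one component.\<close>

lemma direct_sum_hom_eqI:
  assumes \<chi>: "\<chi> \<in> hom (add_monoid (direct_sum_module I N)) QZ" and \<psi>: "\<psi> \<in> hom (add_monoid (direct_sum_module I N)) QZ"
    and eq: "\<And>i x. i \<in> I \<Longrightarrow> x \<in> carrier (N i) \<Longrightarrow> \<chi> (sum_inj I N i x) = \<psi> (sum_inj I N i x)"
    and d: "d \<in> carrier (direct_sum_module I N)"
  shows "\<chi> d = \<psi> d"
proof -
  have "\<chi> d = \<psi> d" if "finite A" "d \<in> carrier (direct_sum_module I N)" "{i \<in> I. d i \<noteq> \<zero>\<^bsub>N i\<^esub>} \<subseteq> A" for A d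
    using that
  proof (induction A arbitrary: d)
    case empty
    then have "d = \<zero>\<^bsub>direct_sum_module I N\<^esub>"
      by (auto simp: direct_sum_simps PiE_iff intro!: extensionalityI[of _ I])
    then show ?case
      using hom_one[OF \<chi> left_moduleD(4)[OF left_module_direct_sum] QZ.is_group]
        hom_one[OF \<psi> left_moduleD(4)[OF left_module_direct_sum] QZ.is_group] by simp
  next
    case (insert k A)
    show ?case
    proof (cases "k \<in> I")
      case False
      then have "{i \<in> I. d i \<noteq> \<zero>\<^bsub>N i\<^esub>} \<subseteq> A" using insert.prems by auto
      then show ?thesis by (rule insert.IH[OF insert.prems(1)])
    next
      case k: True
      define d' where "d' = (\<lambda>i\<in>I. if i = k then \<zero>\<^bsub>N i\<^esub> else d i)"
      have dN: "d i \<in> carrier (N i)" if "i \<in> I" for i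
        using insert.prems(1) that by (auto simp: direct_sum_simps)
      have sup: "{i \<in> I. d' i \<noteq> \<zero>\<^bsub>N i\<^esub>} \<subseteq> {i \<in> I. d i \<noteq> \<zero>\<^bsub>N i\<^esub>}" "{i \<in> I. d' i \<noteq> \<zero>\<^bsub>N i\<^esub>} \<subseteq> A"
        using insert.prems(2) by (auto simp: d'_def)
      have "finite {i \<in> I. d i \<noteq> \<zero>\<^bsub>N i\<^esub>}" using insert.prems(1) by (auto simp: direct_sum_simps)
      from finite_subset[OF sup(1) this] have d': "d' \<in> carrier (direct_sum_module I N)"
        unfolding direct_sum_simps
        using dN zero_closed_summand by (auto simp: d'_def)
      have s: "sum_inj I N k (d k) \<in> carrier (direct_sum_module I N)" by (rule sum_inj_closed[OF k dN[OF k]])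
      have "d = d' \<oplus>\<^bsub>direct_sum_module I N\<^esub> sum_inj I N k (d k)"
      proof (rule extensionalityI[of _ I])
        show "d \<in> extensional I" using insert.prems(1) by (auto simp: direct_sum_simps PiE_iff)
        show "d' \<oplus>\<^bsub>direct_sum_module I N\<^esub> sum_inj I N k (d k) \<in> extensional I" by (simp add: direct_sum_simps)
        show "d i = (d' \<oplus>\<^bsub>direct_sum_module I N\<^esub> sum_inj I N k (d k)) i" if i: "i \<in> I" for i
          using dN[OF i] zero_closed_summand[OF i] i
            abelian_monoid.l_zero[OF abelian_group.axioms(1)[OF left_moduleD(2)[OF N[OF i]]]]
            abelian_monoid.r_zero[OF abelian_group.axioms(1)[OF left_moduleD(2)[OF N[OF i]]]]
          by (cases "i = k") (simp_all add: direct_sum_simps d'_def sum_inj_def)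
      qed
      then have "\<chi> d = \<chi> d' \<otimes>\<^bsub>QZ\<^esub> \<chi> (sum_inj I N k (d k))"
        and "\<psi> d = \<psi> d' \<otimes>\<^bsub>QZ\<^esub> \<psi> (sum_inj I N k (d k))"
        using hom_mult[OF \<chi>, of d' "sum_inj I N k (d k)"] hom_mult[OF \<psi>, of d' "sum_inj I N k (d k)"] d' s
        by simp_all
      then show ?thesis using insert.IH[OF d' sup(2)] eq[OF k dN[OF k]] by simp
    qed
  qed
  moreover have "finite {i \<in> I. d i \<noteq> \<zero>\<^bsub>N i\<^esub>}" using d by (auto simp: direct_sum_simps)
  ultimately show ?thesis using d by blast
qed

lemma direct_sum_character:
  assumes \<chi>: "\<And>i. i \<in> I \<Longrightarrow> \<chi> i \<in> hom (add_monoid (N i)) QZ"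
  obtains \<psi> where "\<psi> \<in> hom (add_monoid (direct_sum_module I N)) QZ"
    and "\<And>i x. i \<in> I \<Longrightarrow> x \<in> carrier (N i) \<Longrightarrow> \<psi> (sum_inj I N i x) = \<chi> i x"
proof -
  let ?A = "\<lambda>i. add_monoid (N i)"
  let ?\<psi> = "\<lambda>d. gfinprod QZ (\<lambda>i. \<chi> i (d i)) I"
  have grp: "group (?A i)" if "i \<in> I" for i by (rule left_moduleD(4)[OF N[OF that]])
  have \<psi>: "?\<psi> \<in> hom (sum_group I ?A) QZ"
    by (rule QZ.hom_group_sum[OF \<chi> grp])
  have "carrier (sum_group I ?A) = carrier (direct_sum_module I N)"
    using carrier_sum_group[of I ?A] grp by (simp add: direct_sum_simps)
  then have \<psi>': "?\<psi> \<in> hom (add_monoid (direct_sum_module I N)) QZ"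
    using \<psi> by (simp add: hom_def direct_sum_simps)
  have "?\<psi> (sum_inj I N i x) = \<chi> i x" if i: "i \<in> I" and x: "x \<in> carrier (N i)" for i x
  proof -
    have c: "\<chi> j (sum_inj I N i x j) \<in> carrier QZ" if "j \<in> I" for j
      using \<chi>[OF that] sum_inj_closed[OF i x] that by (auto simp: hom_def Pi_iff direct_sum_simps)
    have z: "\<chi> j \<zero>\<^bsub>N j\<^esub> = \<one>\<^bsub>QZ\<^esub>" if "j \<in> I" for j
      using hom_one[OF \<chi>[OF that] grp[OF that] QZ.is_group] by simp
    have "?\<psi> (sum_inj I N i x) = gfinprod QZ (\<lambda>j. \<chi> j (sum_inj I N i x j)) {i}"
      by (rule QZ.gfinprod_mono_neutral_cong_right) (use i c z in \<open>auto simp: sum_inj_def\<close>)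
    also have "\<dots> = \<chi> i x"
      using c[OF i] i by (simp add: sum_inj_def)
    finally show ?thesis .
  qed
  from that[OF \<psi>' this] show thesis by simp
qed

end

section \<open>The character module of a filtered colimit\<close>

locale colimit_diagram = module_diagram S J F \<phi>
  for S :: "'r ring" and J :: "('o, 'a) small_category" and F :: "'o \<Rightarrow> ('r, 'm) module"
    and \<phi> :: "'a \<Rightarrow> 'm \<Rightarrow> 'm" +
  assumes S: "ring S"
begin

abbreviation (input) "D \<equiv> direct_sum_module (Obj J) F"
abbreviation (input) "\<kappa> \<equiv> sum_inj (Obj J) F"

definition identifications where
  "identifications = {\<kappa> (Cod J f) (\<phi> f x) \<ominus>\<^bsub>D\<^esub> \<kappa> (Dom J f) x | f x. f \<in> Arr J \<and> x \<in> carrier (F (Dom J f))}"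

abbreviation (input) "G \<equiv> generated_submodule S D identifications"
abbreviation (input) "C \<equiv> colimit_module S J F \<phi>"

lemma D_module: "left_module S D"
  using S F_module by (rule left_module_direct_sum)

lemma arrow_closed:
  "f \<in> Arr J \<Longrightarrow> x \<in> carrier (F (Dom J f)) \<Longrightarrow> \<phi> f x \<in> carrier (F (Cod J f))"
  by (rule linear_homD(1)[OF \<phi>_hom])

lemma D_group: "abelian_group D"
  by (rule left_moduleD(2)[OF D_module])

lemma \<kappa>_closed: "k \<in> Obj J \<Longrightarrow> x \<in> carrier (F k) \<Longrightarrow> \<kappa> k x \<in> carrier D"
  by (rule sum_inj_closed[OF S F_module])

lemma \<kappa>_linear: "k \<in> Obj J \<Longrightarrow> \<kappa> k \<in> linear_hom S (F k) D"
  by (rule sum_inj_linear[OF S F_module])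

lemma identifications_closed: "identifications \<subseteq> carrier D"
  using \<kappa>_closed arrow_closed Dom_Obj Cod_Obj abelian_group.minus_closed[OF D_group]
  by (auto simp: identifications_def)

lemma G_submodule: "submodule G S D"
  by (rule generated_submodule(1)[OF D_module identifications_closed])

lemma colimit_eq: "C = quotient_module D G"
  by (simp add: colimit_module_def identifications_def Let_def)

lemma left_module_colimit: "left_module S C"
  unfolding colimit_eq by (rule left_module_quotient[OF D_module G_submodule])

abbreviation (input) "q \<equiv> (\<lambda>d. G +>\<^bsub>D\<^esub> d)"

lemma q_linear: "q \<in> linear_hom S D C"
  unfolding colimit_eq by (rule coset_linear[OF D_module G_submodule])

lemma q_surj: "q ` carrier D = carrier C"
  unfolding colimit_eq by (rule quotient_carrier[OF D_module G_submodule, symmetric])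

lemma q_arrow:
  assumes f: "f \<in> Arr J" and x: "x \<in> carrier (F (Dom J f))"
  shows "q (\<kappa> (Cod J f) (\<phi> f x)) = q (\<kappa> (Dom J f) x)"
proof -
  have "\<kappa> (Cod J f) (\<phi> f x) \<ominus>\<^bsub>D\<^esub> \<kappa> (Dom J f) x \<in> G"
    using generated_submodule(2)[OF D_module identifications_closed] f x
    by (auto simp: identifications_def)
  then show ?thesis
    using coset_eq_iff[OF D_module G_submodule \<kappa>_closed[OF Cod_Obj[OF f] arrow_closed[OF f x]]
        \<kappa>_closed[OF Dom_Obj[OF f] x]] by simp
qed

lemma colimit_character_comp:
  assumes "\<chi> \<in> carrier (character_module C)"
  shows "(\<lambda>d. \<chi> (q d)) \<in> hom (add_monoid D) QZ"
  using character_closed[OF assms linear_homD(1)[OF q_linear]]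
    character_add[OF assms linear_homD(1)[OF q_linear] linear_homD(1)[OF q_linear]]
    linear_homD(2)[OF q_linear]
  by (intro homI) simp_all

text \<open>The universal property of the colimit for characters.  The kernel of a single character need not
  be a submodule, so it need not contain the submodule generated by the identifications; the common
  kernel of a family that is closed under scalar multiplication does.\<close>

lemma descend_linear_family:
  fixes P :: "('r, 'p) module"
  assumes P: "left_module (opposite_ring S) P"
    and s: "\<And>k. k \<in> Obj J \<Longrightarrow> s k \<in> linear_hom (opposite_ring S) P (character_module (F k))"
    and compat: "\<And>p f x. p \<in> carrier P \<Longrightarrow> f \<in> Arr J \<Longrightarrow> x \<in> carrier (F (Dom J f)) \<Longrightarrow>
           s (Cod J f) p (\<phi> f x) = s (Dom J f) p x"
  obtains t where "t \<in> linear_hom (opposite_ring S) P (character_module C)"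
    and "\<And>p k x. p \<in> carrier P \<Longrightarrow> k \<in> Obj J \<Longrightarrow> x \<in> carrier (F k) \<Longrightarrow> t p (q (\<kappa> k x)) = s k p x"
proof -
  interpret D: left_module S D by (rule D_module)
  have sc: "s k p \<in> carrier (character_module (F k))" if "k \<in> Obj J" "p \<in> carrier P" for k p
    by (rule linear_homD(1)[OF s[OF that(1)] that(2)])
  have "\<exists>\<sigma>. \<sigma> \<in> hom (add_monoid D) QZ \<and> (\<forall>k\<in>Obj J. \<forall>x\<in>carrier (F k). \<sigma> (\<kappa> k x) = s k p x)"
    if p: "p \<in> carrier P" for p
  proof -
    obtain \<sigma> where "\<sigma> \<in> hom (add_monoid D) QZ"
      "\<And>k x. k \<in> Obj J \<Longrightarrow> x \<in> carrier (F k) \<Longrightarrow> \<sigma> (\<kappa> k x) = s k p x"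
      by (rule direct_sum_character[where I = "Obj J" and N = F and \<chi> = "\<lambda>k. s k p", OF S F_module]) (use sc[OF _ p] in auto)
    then show ?thesis by auto
  qed
  then obtain \<sigma> where \<sigma>: "\<And>p. p \<in> carrier P \<Longrightarrow> \<sigma> p \<in> hom (add_monoid D) QZ"
    and \<sigma>\<kappa>: "\<And>p k x. p \<in> carrier P \<Longrightarrow> k \<in> Obj J \<Longrightarrow> x \<in> carrier (F k) \<Longrightarrow> \<sigma> p (\<kappa> k x) = s k p x"
    by metis
  have \<sigma>c: "\<sigma> p d \<in> carrier QZ" if "p \<in> carrier P" "d \<in> carrier D" for p d
    using \<sigma>[OF that(1)] that(2) by (auto simp: hom_def Pi_iff)
  have \<sigma>m: "\<sigma> p (d \<oplus>\<^bsub>D\<^esub> d') = \<sigma> p d \<otimes>\<^bsub>QZ\<^esub> \<sigma> p d'"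
    if "p \<in> carrier P" "d \<in> carrier D" "d' \<in> carrier D" for p d d'
    using hom_mult[OF \<sigma>[OF that(1)], of d d'] that(2,3) by simp
  have \<sigma>0: "\<sigma> p \<zero>\<^bsub>D\<^esub> = \<one>\<^bsub>QZ\<^esub>" if "p \<in> carrier P" for p
    using hom_one[OF \<sigma>[OF that] D.M.a_group QZ.is_group] by simp
  have \<sigma>i: "\<sigma> p (\<ominus>\<^bsub>D\<^esub> d) = inv\<^bsub>QZ\<^esub> \<sigma> p d" if "p \<in> carrier P" "d \<in> carrier D" for p d
  proof -
    interpret h: group_hom "add_monoid D" QZ "\<sigma> p"
      using \<sigma>[OF that(1)] D.M.a_group QZ.is_group by (simp add: group_hom_def group_hom_axioms_def)
    show ?thesis using h.hom_inv[of d] that(2) by (simp add: a_inv_def)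
  qed
  have Pa: "p \<oplus>\<^bsub>P\<^esub> p' \<in> carrier P" if "p \<in> carrier P" "p' \<in> carrier P" for p p'
    by (rule abelian_monoid.a_closed[OF abelian_group.axioms(1)[OF left_moduleD(2)[OF P]] that])
  have Ps: "a \<odot>\<^bsub>P\<^esub> p \<in> carrier P" if "a \<in> carrier S" "p \<in> carrier P" for a p
    using left_module.smult_closed[OF P _ that(2), of a] that(1) by simp
  have \<sigma>add: "\<sigma> (p \<oplus>\<^bsub>P\<^esub> p') d = \<sigma> p d \<otimes>\<^bsub>QZ\<^esub> \<sigma> p' d"
    if p: "p \<in> carrier P" "p' \<in> carrier P" and d: "d \<in> carrier D" for p p' d
  proof (rule direct_sum_hom_eqI[OF S F_module, where \<psi> = "\<lambda>d. \<sigma> p d \<otimes>\<^bsub>QZ\<^esub> \<sigma> p' d"])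
    show "\<sigma> (p \<oplus>\<^bsub>P\<^esub> p') \<in> hom (add_monoid D) QZ" by (rule \<sigma>[OF Pa[OF p]])
    show "(\<lambda>d. \<sigma> p d \<otimes>\<^bsub>QZ\<^esub> \<sigma> p' d) \<in> hom (add_monoid D) QZ"
      using \<sigma>c[OF p(1)] \<sigma>c[OF p(2)] \<sigma>m[OF p(1)] \<sigma>m[OF p(2)] by (intro homI) (simp_all add: QZ.m_ac)
    show "\<sigma> (p \<oplus>\<^bsub>P\<^esub> p') (\<kappa> k x) = \<sigma> p (\<kappa> k x) \<otimes>\<^bsub>QZ\<^esub> \<sigma> p' (\<kappa> k x)"
      if "k \<in> Obj J" "x \<in> carrier (F k)" for k x
      using linear_homD(2)[OF s[OF that(1)] p] that(2)
      by (simp add: \<sigma>\<kappa>[OF Pa[OF p] that] \<sigma>\<kappa>[OF p(1) that] \<sigma>\<kappa>[OF p(2) that])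
  qed (use d in simp_all)
  have \<sigma>smult: "\<sigma> (a \<odot>\<^bsub>P\<^esub> p) d = \<sigma> p (a \<odot>\<^bsub>D\<^esub> d)"
    if a: "a \<in> carrier S" and p: "p \<in> carrier P" and d: "d \<in> carrier D" for a p d
  proof (rule direct_sum_hom_eqI[OF S F_module, where \<psi> = "\<lambda>d. \<sigma> p (a \<odot>\<^bsub>D\<^esub> d)"])
    show "\<sigma> (a \<odot>\<^bsub>P\<^esub> p) \<in> hom (add_monoid D) QZ" by (rule \<sigma>[OF Ps[OF a p]])
    show "(\<lambda>d. \<sigma> p (a \<odot>\<^bsub>D\<^esub> d)) \<in> hom (add_monoid D) QZ"
      using \<sigma>c[OF p] \<sigma>m[OF p] D.smult_closed[OF a] D.smult_r_distr[OF a] by (intro homI) simp_all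
    show "\<sigma> (a \<odot>\<^bsub>P\<^esub> p) (\<kappa> k x) = \<sigma> p (a \<odot>\<^bsub>D\<^esub> \<kappa> k x)"
      if k: "k \<in> Obj J" and x: "x \<in> carrier (F k)" for k x
    proof -
      have ax: "a \<odot>\<^bsub>F k\<^esub> x \<in> carrier (F k)" by (rule left_module.smult_closed[OF F_module[OF k] a x])
      have "\<sigma> p (a \<odot>\<^bsub>D\<^esub> \<kappa> k x) = s k p (a \<odot>\<^bsub>F k\<^esub> x)"
        unfolding linear_homD(3)[OF \<kappa>_linear[OF k] a x, symmetric] by (rule \<sigma>\<kappa>[OF p k ax])
      also have "\<dots> = s k (a \<odot>\<^bsub>P\<^esub> p) x"
        using linear_homD(3)[OF s[OF k] _ p, of a] a x by simp
      finally show ?thesis using \<sigma>\<kappa>[OF Ps[OF a p] k x] by simp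
    qed
  qed (use d in simp_all)
  let ?Z = "{d \<in> carrier D. \<forall>p\<in>carrier P. \<sigma> p d = \<one>\<^bsub>QZ\<^esub>}"
  have Z: "submodule ?Z S D"
    by (rule submoduleI'[OF D_module])
      (auto simp: \<sigma>m \<sigma>0 \<sigma>i D.smult_closed \<sigma>smult[symmetric] Ps)
  have "identifications \<subseteq> ?Z"
  proof
    fix d assume "d \<in> identifications"
    then obtain f x where f: "f \<in> Arr J" and x: "x \<in> carrier (F (Dom J f))"
      and d: "d = \<kappa> (Cod J f) (\<phi> f x) \<ominus>\<^bsub>D\<^esub> \<kappa> (Dom J f) x" by (auto simp: identifications_def)
    have k1: "\<kappa> (Cod J f) (\<phi> f x) \<in> carrier D" by (rule \<kappa>_closed[OF Cod_Obj[OF f] arrow_closed[OF f x]])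
    have k2: "\<kappa> (Dom J f) x \<in> carrier D" by (rule \<kappa>_closed[OF Dom_Obj[OF f] x])
    have "\<sigma> p d = \<one>\<^bsub>QZ\<^esub>" if p: "p \<in> carrier P" for p
    proof -
      have "\<sigma> p (\<kappa> (Cod J f) (\<phi> f x)) = \<sigma> p (\<kappa> (Dom J f) x)"
        unfolding \<sigma>\<kappa>[OF p Cod_Obj[OF f] arrow_closed[OF f x]] \<sigma>\<kappa>[OF p Dom_Obj[OF f] x]
        by (rule compat[OF p f x])
      then show ?thesis
        unfolding d a_minus_def \<sigma>m[OF p k1 D.M.a_inv_closed[OF k2]] \<sigma>i[OF p k2]
        using QZ.r_inv[OF \<sigma>c[OF p k2]] by simp
    qed
    then show "d \<in> ?Z" using D.M.minus_closed[OF k1 k2] d by simp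
  qed
  then have GZ: "G \<subseteq> ?Z" by (rule generated_submodule(3)[OF D_module identifications_closed Z])
  have \<sigma>q: "\<sigma> p d = \<sigma> p d'"
    if p: "p \<in> carrier P" and d: "d \<in> carrier D" "d' \<in> carrier D" and eq: "q d = q d'" for p d d'
  proof -
    have "d \<ominus>\<^bsub>D\<^esub> d' \<in> ?Z" using eq coset_eq_iff[OF D_module G_submodule d] GZ by auto
    then have "\<sigma> p (d \<ominus>\<^bsub>D\<^esub> d') = \<one>\<^bsub>QZ\<^esub>" using p by simp
    moreover have "d = (d \<ominus>\<^bsub>D\<^esub> d') \<oplus>\<^bsub>D\<^esub> d'"
      using d by (simp add: a_minus_def D.M.a_assoc D.M.l_neg)
    then have "\<sigma> p d = \<sigma> p (d \<ominus>\<^bsub>D\<^esub> d') \<otimes>\<^bsub>QZ\<^esub> \<sigma> p d'"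
      using \<sigma>m[OF p D.M.minus_closed[OF d] d(2)] by simp
    ultimately show ?thesis using \<sigma>c[OF p d(2)] by simp
  qed
  define r where "r X = (SOME d. d \<in> carrier D \<and> q d = X)" for X
  have r: "r X \<in> carrier D" "q (r X) = X" if "X \<in> carrier C" for X
  proof -
    have "\<exists>d. d \<in> carrier D \<and> q d = X" using that unfolding q_surj[symmetric] by auto
    then have "r X \<in> carrier D \<and> q (r X) = X" unfolding r_def by (rule someI_ex)
    then show "r X \<in> carrier D" "q (r X) = X" by auto
  qed
  define t where "t p = (\<lambda>X\<in>carrier C. \<sigma> p (r X))" for p
  have tq: "t p (q d) = \<sigma> p d" if p: "p \<in> carrier P" and d: "d \<in> carrier D" for p d
  proof -
    have c: "q d \<in> carrier C" by (rule linear_homD(1)[OF q_linear d])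
    show ?thesis unfolding t_def using \<sigma>q[OF p r(1)[OF c] d r(2)[OF c]] c by simp
  qed
  have Cq: "\<exists>d\<in>carrier D. X = q d" if "X \<in> carrier C" for X
    using r[OF that] by (intro bexI[of _ "r X"]) auto
  have tc: "t p \<in> carrier (character_module C)" if p: "p \<in> carrier P" for p
  proof (rule character_moduleI)
    show "t p X \<in> carrier QZ" if "X \<in> carrier C" for X
      using Cq[OF that] tq[OF p] \<sigma>c[OF p] by auto
    show "t p (X \<oplus>\<^bsub>C\<^esub> Y) = t p X \<otimes>\<^bsub>QZ\<^esub> t p Y" if XY: "X \<in> carrier C" "Y \<in> carrier C" for X Y
    proof -
      obtain d e where d: "d \<in> carrier D" "X = q d" and e: "e \<in> carrier D" "Y = q e"
        using Cq[OF XY(1)] Cq[OF XY(2)] by auto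
      have "t p (q (d \<oplus>\<^bsub>D\<^esub> e)) = \<sigma> p (d \<oplus>\<^bsub>D\<^esub> e)" by (rule tq[OF p D.M.a_closed[OF d(1) e(1)]])
      then show ?thesis
        unfolding linear_homD(2)[OF q_linear d(1) e(1)] \<sigma>m[OF p d(1) e(1)] d(2) e(2) tq[OF p d(1)] tq[OF p e(1)] .
    qed
    show "t p \<in> extensional (carrier C)" by (simp add: t_def)
  qed
  show thesis
  proof (rule that)
    show "t \<in> linear_hom (opposite_ring S) P (character_module C)"
    proof (rule linear_homI)
      show "t p \<in> carrier (character_module C)" if "p \<in> carrier P" for p by (rule tc[OF that])
      show "t (p \<oplus>\<^bsub>P\<^esub> p') = t p \<oplus>\<^bsub>character_module C\<^esub> t p'" if "p \<in> carrier P" "p' \<in> carrier P" for p p'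
        using \<sigma>add[OF that r(1)] by (auto simp: t_def intro!: restrict_ext)
      show "t (a \<odot>\<^bsub>P\<^esub> p) = a \<odot>\<^bsub>character_module C\<^esub> t p"
        if a: "a \<in> carrier (opposite_ring S)" and p: "p \<in> carrier P" for a p
      proof (rule character_ext[OF tc])
        have aS: "a \<in> carrier S" using a by simp
        show "a \<odot>\<^bsub>P\<^esub> p \<in> carrier P" by (rule Ps[OF aS p])
        show "a \<odot>\<^bsub>character_module C\<^esub> t p \<in> carrier (character_module C)"
          by (rule left_module.smult_closed[OF left_module_character[OF left_module_colimit] a tc[OF p]])
        fix X assume X: "X \<in> carrier C"
        obtain d where d: "d \<in> carrier D" "X = q d" using Cq[OF X] by auto
        have "t (a \<odot>\<^bsub>P\<^esub> p) X = \<sigma> p (a \<odot>\<^bsub>D\<^esub> d)"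
          unfolding d(2) tq[OF Ps[OF aS p] d(1)] by (rule \<sigma>smult[OF aS p d(1)])
        also have "\<dots> = t p (q (a \<odot>\<^bsub>D\<^esub> d))" by (rule tq[OF p D.smult_closed[OF aS d(1)], symmetric])
        also have "q (a \<odot>\<^bsub>D\<^esub> d) = a \<odot>\<^bsub>C\<^esub> X" unfolding d(2) by (rule linear_homD(3)[OF q_linear aS d(1)])
        finally show "t (a \<odot>\<^bsub>P\<^esub> p) X = (a \<odot>\<^bsub>character_module C\<^esub> t p) X" using X by simp
      qed
    qed
    show "t p (q (\<kappa> k x)) = s k p x" if "p \<in> carrier P" "k \<in> Obj J" "x \<in> carrier (F k)" for p k x
      using tq[OF that(1) \<kappa>_closed[OF that(2,3)]] \<sigma>\<kappa>[OF that] by simp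
  qed
qed

lemma colimit_character_eqI:
  assumes \<chi>: "\<chi> \<in> carrier (character_module C)" and \<psi>: "\<psi> \<in> carrier (character_module C)"
    and eq: "\<And>k x. k \<in> Obj J \<Longrightarrow> x \<in> carrier (F k) \<Longrightarrow> \<chi> (q (\<kappa> k x)) = \<psi> (q (\<kappa> k x))"
  shows "\<chi> = \<psi>"
proof (rule character_ext[OF \<chi> \<psi>])
  fix X assume "X \<in> carrier C"
  then obtain d where d: "d \<in> carrier D" "X = q d" unfolding q_surj[symmetric] by auto
  show "\<chi> X = \<psi> X"
    unfolding d(2)
    by (rule direct_sum_hom_eqI[OF S F_module colimit_character_comp[OF \<chi>] colimit_character_comp[OF \<psi>] eq d(1)])
qed

text \<open>The retraction \<open>t\<close> is induced by the limits \<open>s j p x\<close> of \<open>p k (\<phi> (c j) x)\<close> along \<open>cocone_filter\<close>.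
  They are compatible with an arrow \<open>f\<close> of the diagram because eventually \<open>f\<close> belongs to the part of
  the diagram over which \<open>(k, c)\<close> is a cocone.\<close>

theorem colimit_character_summand:
  assumes filt: "filtered_category J"
  shows "direct_summand (opposite_ring S) (character_module C)
    (product_module (Obj J) (\<lambda>k. character_module (F k)))"
proof -
  interpret filtered_category J by (rule filt)
  let ?S = "opposite_ring S"
  let ?P = "product_module (Obj J) (\<lambda>k. character_module (F k))"
  have P: "left_module ?S ?P"
    using S left_module_character[OF F_module] by (intro left_module_product) auto
  define e where "e \<chi> = (\<lambda>k\<in>Obj J. \<lambda>x\<in>carrier (F k). \<chi> (q (\<kappa> k x)))" for \<chi> :: "('o \<Rightarrow> 'm) set \<Rightarrow> rat set"
  note [simp del] = character_module_simps(1)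
  have \<kappa>C: "q (\<kappa> k x) \<in> carrier C" if "k \<in> Obj J" "x \<in> carrier (F k)" for k x
    by (rule linear_homD(1)[OF q_linear \<kappa>_closed[OF that]])
  have \<kappa>add: "q (\<kappa> k (x \<oplus>\<^bsub>F k\<^esub> y)) = q (\<kappa> k x) \<oplus>\<^bsub>C\<^esub> q (\<kappa> k y)"
    if "k \<in> Obj J" "x \<in> carrier (F k)" "y \<in> carrier (F k)" for k x y
    using linear_homD(2)[OF linear_hom_comp[OF \<kappa>_linear[OF that(1)] q_linear] that(2,3)] .
  have \<kappa>smult: "q (\<kappa> k (a \<odot>\<^bsub>F k\<^esub> x)) = a \<odot>\<^bsub>C\<^esub> q (\<kappa> k x)"
    if "k \<in> Obj J" "a \<in> carrier S" "x \<in> carrier (F k)" for k a x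
    using linear_homD(3)[OF linear_hom_comp[OF \<kappa>_linear[OF that(1)] q_linear] that(2,3)] .
  have Fs: "a \<odot>\<^bsub>F k\<^esub> x \<in> carrier (F k)" if "k \<in> Obj J" "a \<in> carrier S" "x \<in> carrier (F k)" for k a x
    by (rule left_module.smult_closed[OF F_module[OF that(1)] that(2,3)])
  have Fa: "x \<oplus>\<^bsub>F k\<^esub> y \<in> carrier (F k)" if "k \<in> Obj J" "x \<in> carrier (F k)" "y \<in> carrier (F k)" for k x y
    by (rule abelian_monoid.a_closed[OF abelian_group.axioms(1)[OF left_moduleD(2)[OF F_module[OF that(1)]]] that(2,3)])
  have e: "e \<in> linear_hom ?S (character_module C) ?P"
  proof (rule linear_homI)
    fix \<chi> assume \<chi>: "\<chi> \<in> carrier (character_module C)"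
    have "(\<lambda>x\<in>carrier (F k). \<chi> (q (\<kappa> k x))) \<in> carrier (character_module (F k))" if k: "k \<in> Obj J" for k
      by (rule character_moduleI)
        (simp_all add: character_closed[OF \<chi> \<kappa>C[OF k]] \<kappa>add[OF k] character_add[OF \<chi> \<kappa>C[OF k] \<kappa>C[OF k]] Fa[OF k])
    then show "e \<chi> \<in> carrier ?P" by (simp add: e_def)
    fix \<psi> assume \<psi>: "\<psi> \<in> carrier (character_module C)"
    show "e (\<chi> \<oplus>\<^bsub>character_module C\<^esub> \<psi>) = e \<chi> \<oplus>\<^bsub>?P\<^esub> e \<psi>"
      using \<kappa>C by (auto simp: e_def intro!: restrict_ext)
  next
    fix a \<chi> assume a: "a \<in> carrier ?S" and \<chi>: "\<chi> \<in> carrier (character_module C)"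
    show "e (a \<odot>\<^bsub>character_module C\<^esub> \<chi>) = a \<odot>\<^bsub>?P\<^esub> e \<chi>"
      using \<kappa>C \<kappa>smult Fs a by (auto simp: e_def intro!: restrict_ext)
  qed
  obtain \<Phi> :: "('o \<times> ('o \<Rightarrow> 'a) \<Rightarrow> rat set) \<Rightarrow> rat set" where
    \<Phi>: "(\<forall>g. \<Phi> g \<in> carrier QZ) \<and>
      (\<forall>g h k. eventually (\<lambda>x. g x \<in> carrier QZ \<and> h x \<in> carrier QZ \<and>
          k x = g x \<otimes>\<^bsub>QZ\<^esub> h x) cocone_filter \<longrightarrow> \<Phi> k = \<Phi> g \<otimes>\<^bsub>QZ\<^esub> \<Phi> h) \<and>
      (\<forall>g c. c \<in> carrier QZ \<longrightarrow> eventually (\<lambda>x. g x = c) cocone_filter \<longrightarrow> \<Phi> g = c) \<and>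
      (\<forall>g h. eventually (\<lambda>x. g x = h x) cocone_filter \<longrightarrow> \<Phi> g = \<Phi> h)"
    using limit_functional[OF cocone_filter_not_bot] ..
  note \<Phi>c = \<Phi>[THEN conjunct1, rule_format] and \<Phi>m = \<Phi>[THEN conjunct2, THEN conjunct1, rule_format]
    and \<Phi>const = \<Phi>[THEN conjunct2, THEN conjunct2, THEN conjunct1, rule_format]
    and \<Phi>eq = \<Phi>[THEN conjunct2, THEN conjunct2, THEN conjunct2, rule_format]
  define ev where "ev p j x z = p (fst z) (\<phi> (snd z j) x)"
    for p :: "'o \<Rightarrow> 'm \<Rightarrow> rat set" and j x and z :: "'o \<times> ('o \<Rightarrow> 'a)"
  have leg: "eventually (\<lambda>z. snd z j \<in> Arr J \<and> Dom J (snd z j) = j \<and> Cod J (snd z j) = fst z) cocone_filter"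
    if j: "j \<in> Obj J" for j
    using eventually_compatible[of "Ident J j"] Ident_Arr[OF j]
    by (auto simp: compatible_legs_def elim!: eventually_mono)
  have pc: "p k \<in> carrier (character_module (F k))" if "p \<in> carrier ?P" "k \<in> Obj J" for p k
    using that by auto
  define s where "s j p = (\<lambda>x\<in>carrier (F j). \<Phi> (ev p j x))" for j p
  have legD: "\<phi> (snd z j) x \<in> carrier (F (fst z))" "fst z \<in> Obj J"
    "\<phi> (snd z j) \<in> linear_hom S (F j) (F (fst z))"
    if "snd z j \<in> Arr J \<and> Dom J (snd z j) = j \<and> Cod J (snd z j) = fst z" "x \<in> carrier (F j)" for z j x
    using arrow_closed[of "snd z j" x] Cod_Obj[of "snd z j"] \<phi>_hom[of "snd z j"] that by auto
  have s_lin: "s j \<in> linear_hom ?S ?P (character_module (F j))" if j: "j \<in> Obj J" for j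
  proof (rule linear_homI)
    fix p assume p: "p \<in> carrier ?P"
    show "s j p \<in> carrier (character_module (F j))"
    proof (rule character_moduleI)
      fix x y assume x: "x \<in> carrier (F j)" and y: "y \<in> carrier (F j)"
      have "\<Phi> (ev p j (x \<oplus>\<^bsub>F j\<^esub> y)) = \<Phi> (ev p j x) \<otimes>\<^bsub>QZ\<^esub> \<Phi> (ev p j y)"
      proof (rule \<Phi>m, rule eventually_mono[OF leg[OF j]])
        fix z assume z: "snd z j \<in> Arr J \<and> Dom J (snd z j) = j \<and> Cod J (snd z j) = fst z"
        note P1 = pc[OF p legD(2)[OF z x]]
        show "ev p j x z \<in> carrier QZ \<and> ev p j y z \<in> carrier QZ \<and>
            ev p j (x \<oplus>\<^bsub>F j\<^esub> y) z = ev p j x z \<otimes>\<^bsub>QZ\<^esub> ev p j y z"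
          unfolding ev_def linear_homD(2)[OF legD(3)[OF z x] x y]
          using character_closed[OF P1 legD(1)[OF z x]] character_closed[OF P1 legD(1)[OF z y]]
            character_add[OF P1 legD(1)[OF z x] legD(1)[OF z y]] by simp
      qed
      then show "s j p (x \<oplus>\<^bsub>F j\<^esub> y) = s j p x \<otimes>\<^bsub>QZ\<^esub> s j p y"
        using x y Fa[OF j x y] by (simp add: s_def)
    qed (auto simp: s_def \<Phi>c)
    fix p' assume p': "p' \<in> carrier ?P"
    have "\<Phi> (ev (p \<oplus>\<^bsub>?P\<^esub> p') j x) = \<Phi> (ev p j x) \<otimes>\<^bsub>QZ\<^esub> \<Phi> (ev p' j x)" if x: "x \<in> carrier (F j)" for x
    proof (rule \<Phi>m, rule eventually_mono[OF leg[OF j]])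
      fix z assume z: "snd z j \<in> Arr J \<and> Dom J (snd z j) = j \<and> Cod J (snd z j) = fst z"
      show "ev p j x z \<in> carrier QZ \<and> ev p' j x z \<in> carrier QZ \<and>
          ev (p \<oplus>\<^bsub>?P\<^esub> p') j x z = ev p j x z \<otimes>\<^bsub>QZ\<^esub> ev p' j x z"
        unfolding ev_def
        using character_closed[OF pc[OF p legD(2)[OF z x]] legD(1)[OF z x]]
          character_closed[OF pc[OF p' legD(2)[OF z x]] legD(1)[OF z x]] legD(1,2)[OF z x] by simp
    qed
    then show "s j (p \<oplus>\<^bsub>?P\<^esub> p') = s j p \<oplus>\<^bsub>character_module (F j)\<^esub> s j p'"
      unfolding s_def by (auto intro!: restrict_ext simp del: product_module_simps)
  next
    fix a p assume a: "a \<in> carrier ?S" and p: "p \<in> carrier ?P"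
    have aS: "a \<in> carrier S" using a by simp
    have "\<Phi> (ev (a \<odot>\<^bsub>?P\<^esub> p) j x) = \<Phi> (ev p j (a \<odot>\<^bsub>F j\<^esub> x))" if x: "x \<in> carrier (F j)" for x
    proof (rule \<Phi>eq, rule eventually_mono[OF leg[OF j]])
      fix z assume z: "snd z j \<in> Arr J \<and> Dom J (snd z j) = j \<and> Cod J (snd z j) = fst z"
      show "ev (a \<odot>\<^bsub>?P\<^esub> p) j x z = ev p j (a \<odot>\<^bsub>F j\<^esub> x) z"
        unfolding ev_def linear_homD(3)[OF legD(3)[OF z x] aS x]
        using legD(1,2)[OF z x] by simp
    qed
    then show "s j (a \<odot>\<^bsub>?P\<^esub> p) = a \<odot>\<^bsub>character_module (F j)\<^esub> s j p"
      unfolding s_def using Fs[OF j aS] by (auto intro!: restrict_ext simp del: product_module_simps)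
  qed
  have s_compat: "s (Cod J f) p (\<phi> f x) = s (Dom J f) p x"
    if p: "p \<in> carrier ?P" and f: "f \<in> Arr J" and x: "x \<in> carrier (F (Dom J f))" for p f x
  proof -
    have "\<Phi> (ev p (Cod J f) (\<phi> f x)) = \<Phi> (ev p (Dom J f) x)"
    proof (rule \<Phi>eq, rule eventually_mono[OF eventually_compatible[OF f]])
      fix z assume z: "z \<in> compatible_legs J f"
      show "ev p (Cod J f) (\<phi> f x) z = ev p (Dom J f) x z"
        using z \<phi>_Comp[OF f _ _ x, of "snd z (Cod J f)"]
        by (auto simp: ev_def compatible_legs_def)
    qed
    then show ?thesis using x arrow_closed[OF f x] by (simp add: s_def)
  qed
  obtain t where t: "t \<in> linear_hom ?S ?P (character_module C)"
    and ts: "\<And>p k x. p \<in> carrier ?P \<Longrightarrow> k \<in> Obj J \<Longrightarrow> x \<in> carrier (F k) \<Longrightarrow> t p (q (\<kappa> k x)) = s k p x"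
  proof (rule descend_linear_family[OF P s_lin s_compat])
    fix t assume "t \<in> linear_hom ?S ?P (character_module C)"
      and "\<And>p k x. p \<in> carrier ?P \<Longrightarrow> k \<in> Obj J \<Longrightarrow> x \<in> carrier (F k) \<Longrightarrow> t p (q (\<kappa> k x)) = s k p x"
    then show thesis by (rule that)
  qed
  have "t (e \<chi>) = \<chi>" if \<chi>: "\<chi> \<in> carrier (character_module C)" for \<chi>
  proof (rule colimit_character_eqI[OF linear_homD(1)[OF t linear_homD(1)[OF e \<chi>]] \<chi>])
    fix k x assume k: "k \<in> Obj J" and x: "x \<in> carrier (F k)"
    have "\<Phi> (ev (e \<chi>) k x) = \<chi> (q (\<kappa> k x))"
    proof (rule \<Phi>const[OF character_closed[OF \<chi> \<kappa>C[OF k x]]], rule eventually_mono[OF leg[OF k]])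
      fix z assume z: "snd z k \<in> Arr J \<and> Dom J (snd z k) = k \<and> Cod J (snd z k) = fst z"
      have "q (\<kappa> (fst z) (\<phi> (snd z k) x)) = q (\<kappa> k x)" using q_arrow[of "snd z k" x] z x by simp
      then show "ev (e \<chi>) k x z = \<chi> (q (\<kappa> k x))"
        using legD(1,2)[OF z x] by (simp add: ev_def e_def)
    qed
    then show "t (e \<chi>) (q (\<kappa> k x)) = \<chi> (q (\<kappa> k x))"
      using ts[OF linear_homD(1)[OF e \<chi>] k x] x by (simp add: s_def)
  qed
  then show ?thesis unfolding direct_summand_def by (intro bexI[OF _ e] bexI[OF _ t]) simp
qed

end


section \<open>Modules determined by character modules\<close>

lemma direct_summand_product:
  assumes "\<And>i. i \<in> I \<Longrightarrow> direct_summand S (M i) (N i)"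
  shows "direct_summand S (product_module I M) (product_module I N)"
proof -
  obtain f g where f: "\<And>i. i \<in> I \<Longrightarrow> f i \<in> linear_hom S (M i) (N i)"
    and g: "\<And>i. i \<in> I \<Longrightarrow> g i \<in> linear_hom S (N i) (M i)"
    and gf: "\<And>i x. i \<in> I \<Longrightarrow> x \<in> carrier (M i) \<Longrightarrow> g i (f i x) = x"
    using assms unfolding direct_summand_def by metis
  have "(\<lambda>x. \<lambda>i\<in>I. f i (x i)) \<in> linear_hom S (product_module I M) (product_module I N)"
    by (rule linear_homI) (use linear_homD(1-3)[OF f] in \<open>auto simp: PiE_iff intro!: restrict_ext\<close>)
  moreover have "(\<lambda>x. \<lambda>i\<in>I. g i (x i)) \<in> linear_hom S (product_module I N) (product_module I M)"
    by (rule linear_homI) (use linear_homD(1-3)[OF g] in \<open>auto simp: PiE_iff intro!: restrict_ext\<close>)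
  moreover have "(\<lambda>i\<in>I. g i ((\<lambda>i\<in>I. f i (x i)) i)) = x" if "x \<in> carrier (product_module I M)" for x
    using that gf by (auto simp: PiE_iff intro!: extensionalityI[of _ I])
  ultimately show ?thesis unfolding direct_summand_def by (intro bexI) simp_all
qed

theorem mainTheorem6:
  fixes R :: "'r ring"
    and \<B> :: "('r, 'b) module set"
    and \<E> :: "('r, 'm) module set"
  assumes "ring R"
    and "\<And>B. B \<in> \<B> \<Longrightarrow> finitely_presented R B"
    and "additive_full_subcategory R \<B>"
    and "\<And>E. E \<in> \<E> \<Longrightarrow> right_module R E"
    and "closed_under_summands_and_products TYPE('i) (opposite_ring R) \<E>"
    and "\<And>B. B \<in> \<B> \<Longrightarrow> belongs_to (opposite_ring R) (character_module B) \<E>"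
    and "\<And>E. E \<in> \<E> \<Longrightarrow> character_module E \<in> filtered_colimits TYPE('i) TYPE('a) R \<B>"
  shows "Mod_char TYPE('i) R \<B> = \<E> \<inter> PureInj TYPE('t) R"
proof (intro equalityI subsetI IntI)
  let ?S = "opposite_ring R"
  fix M :: "('r, 'm) module" assume "M \<in> Mod_char TYPE('i) R \<B>"
  then obtain I :: "'i set" and N where M: "right_module R M"
    and N: "\<And>i. i \<in> I \<Longrightarrow> N i \<in> character_module ` \<B>"
    and MN: "direct_summand ?S M (product_module I N)"
    by (auto simp: Mod_char_def summands_of_products_def)
  have "\<exists>E\<in>\<E>. direct_summand ?S (N i) E" if i: "i \<in> I" for i
  proof -
    obtain B where B: "B \<in> \<B>" "N i = character_module B" using N[OF i] by auto
    obtain E where E: "E \<in> \<E>" "module_isomorphic ?S (character_module B) E"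
      using assms(6)[OF B(1)] by (auto simp: belongs_to_def)
    have "left_module R B" using assms(2)[OF B(1)] by (simp add: finitely_presented_def)
    then have "right_module R (character_module B)" by (rule left_module_character)
    from module_isomorphic_direct_summand(1)[OF E(2) this] show ?thesis using B(2) E(1) by auto
  qed
  then obtain E where E: "\<And>i. i \<in> I \<Longrightarrow> E i \<in> \<E>" "\<And>i. i \<in> I \<Longrightarrow> direct_summand ?S (N i) (E i)"
    by metis
  have "direct_summand ?S M (product_module I E)"
    by (rule direct_summand_trans[OF MN direct_summand_product[OF E(2)]])
  then have "M \<in> summands_of_products TYPE('i) ?S \<E>"
    using M E(1) by (auto simp: summands_of_products_def)
  then show "M \<in> \<E>" using assms(5) by (auto simp: closed_under_summands_and_products_def)
  have "pure_injective TYPE('t) ?S M"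
    by (rule summand_of_characters_pure_injective[OF M assms(2) N MN])
  then show "M \<in> PureInj TYPE('t) R" using M by (simp add: PureInj_def)
next
  let ?S = "opposite_ring R"
  fix E :: "('r, 'm) module" assume E: "E \<in> \<E> \<inter> PureInj TYPE('t) R"
  then have M: "right_module R E" and pi: "pure_injective TYPE('t) ?S E" by (auto simp: PureInj_def)
  have C: "left_module R (character_module E)" using left_module_character[OF M] by simp
  obtain J :: "('i, 'a) small_category" and F \<phi> where J: "filtered_category J" "module_diagram R J F \<phi>"
    and F: "\<forall>i\<in>Obj J. F i \<in> \<B>"
    and iso: "module_isomorphic R (character_module E) (colimit_module R J F \<phi>)"
    using assms(7)[of E] E unfolding filtered_colimits_def by auto
  interpret colim: colimit_diagram R J F \<phi>
    by (intro colimit_diagram.intro colimit_diagram_axioms.intro J(2) assms(1))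
  have "direct_summand ?S (character_module (character_module E)) (character_module (colimit_module R J F \<phi>))"
    by (rule direct_summand_character[OF iso C colim.left_module_colimit])
  from direct_summand_trans[OF this colim.colimit_character_summand[OF J(1)]]
  have "direct_summand ?S E (product_module (Obj J) (\<lambda>i. character_module (F i)))"
    by (rule direct_summand_trans[OF pure_injective_splits[OF pi]])
  then have "\<exists>(I :: 'i set) N. (\<forall>i\<in>I. N i \<in> character_module ` \<B>) \<and> direct_summand ?S E (product_module I N)"
    using F by (intro exI[of _ "Obj J"] exI[of _ "\<lambda>i. character_module (F i)"]) simp
  then show "E \<in> Mod_char TYPE('i) R \<B>"
    using M by (simp add: Mod_char_def summands_of_products_def)
qed

end
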